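(* Let $n\ge2$ and let $H:\mathbb{R}^n\times\mathbb{R}^n\to\mathbb{R}$ satisfy: (A1) $H$ is continuous and for each $p$ the map $y\mapsto H(y,p)$ is $\mathbb{Z}^n$-periodic; (A2) $\lim_{|p|\to\infty}\inf_{y\in\mathbb{R}^n}H(y,p)=+\infty$; (A3) for each $y$ the map $p\mapsto H(y,p)$ is convex; (A5) for each $y\in\mathbb{R}^n$, $\min_{p\in\mathbb{R}^n}H(y,p)=H(y,0)=0$. Let $D\Subset\left(-\frac12,\frac12\right)^n$ be an open connected set containing $0$ with connected $C^1$ boundary, let $\eta:\left[0,\frac12\right)\to\left[0,\frac12\right)$ satisfy $\lim_{\varepsilon\to0}\eta(\varepsilon)=0$, and for $\varepsilon\in\left(0,\frac12\right)$ put $\Omega^{\eta(\varepsilon)}=\mathbb{R}^n\setminus\bigcup_{m\in\mathbb{Z}^n}(m+\eta(\varepsilon)\overline D)$. Then for every $R>0$ there exists a constant $C>0$ depending only on $n$, $\partial D$, $H$ and $R$ such that, for all $\varepsilon\in\left(0,\frac12\right)$, $$\left|\overline H_{\Omega^{\eta(\varepsilon)}}(p)-\overline H_0(p)\right|\le C(\varepsilon+\eta(\varepsilon))\qquad\text{for all }p\in\mathbb{R}^n\text{ with }|p|\le R .$$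
   Context: For a $\mathbb{Z}^n$-periodic open set $\Omega$ and $p\in\mathbb{R}^n$, $\overline H_\Omega(p)$ is the unique constant for which the state-constraint cell problem $H(y,p+Dv(y))\le\overline H_\Omega(p)$ in $\Omega$, $H(y,p+Dv(y))\ge\overline H_\Omega(p)$ on $\overline\Omega$ has a $\mathbb{Z}^n$-periodic viscosity solution $v$; here the subsolution property is the usual one in the open set $\Omega$, and the supersolution property on $\overline\Omega$ means: whenever $\varphi$ is $C^1$ and $v-\varphi$ has a local minimum relative to $\overline\Omega$ at $y_0$, $H(y_0,p+D\varphi(y_0))\ge\overline H_\Omega(p)$. $\overline H_0(p)$ is the unique constant for which $H(y,p+Dv_0(y))=\overline H_0(p)$ in $\mathbb{R}^n$ has a $\mathbb{Z}^n$-periodic viscosity solution $v_0$. *)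

theory Defs
  imports "HOL-Analysis.Analysis"
begin

definition int_lattice :: "(real^'n) set"
  where "int_lattice = {m. \<forall>i. m $ i \<in> \<int>}"

definition periodic_on :: "(real^'n) set \<Rightarrow> (real^'n \<Rightarrow> 'b) \<Rightarrow> bool"
  where "periodic_on S f \<longleftrightarrow>
    (\<forall>x m. x \<in> S \<longrightarrow> m \<in> int_lattice \<longrightarrow> x + m \<in> S \<longrightarrow> f (x + m) = f x)"

definition C1_with_gradient :: "('a::euclidean_space \<Rightarrow> real) \<Rightarrow> ('a \<Rightarrow> 'a) \<Rightarrow> bool"
  where "C1_with_gradient \<phi> g \<longleftrightarrow>
    (\<forall>x. (\<phi> has_derivative (\<lambda>h. g x \<bullet> h)) (at x)) \<and> continuous_on UNIV g"

(* Near each boundary point, after relabelling and reorienting the coordinate axes,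
   D is the open region strictly above the graph of a C^1 function of the other n - 1
   coordinates. Such a function is represented by a C^1 function on the whole space
   that is invariant under translation along the i-th axis. *)
definition C1_boundary :: "(real^'n) set \<Rightarrow> bool"
  where "C1_boundary D \<longleftrightarrow>
    (\<forall>x0\<in>frontier D. \<exists>r>0. \<exists>i. \<exists>s\<in>{-1, 1::real}. \<exists>\<gamma> g.
       C1_with_gradient \<gamma> g \<and>
       (\<forall>x t. \<gamma> (x + t *\<^sub>R axis i 1) = \<gamma> x) \<and>
       D \<inter> ball x0 r = {x \<in> ball x0 r. \<gamma> x < s * (x $ i)})"

definition local_max_rel :: "('a::topological_space) set \<Rightarrow> ('a \<Rightarrow> real) \<Rightarrow> 'a \<Rightarrow> bool"
  where "local_max_rel S f y0 \<longleftrightarrow> y0 \<in> S \<and> (\<forall>\<^sub>F y in at y0 within S. f y \<le> f y0)"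

definition local_min_rel :: "('a::topological_space) set \<Rightarrow> ('a \<Rightarrow> real) \<Rightarrow> 'a \<Rightarrow> bool"
  where "local_min_rel S f y0 \<longleftrightarrow> y0 \<in> S \<and> (\<forall>\<^sub>F y in at y0 within S. f y0 \<le> f y)"

(* F is the Hamiltonian of the equation F(y, Dv) = c; S need not be open. *)
definition visc_subsolution ::
    "('a::euclidean_space \<Rightarrow> 'a \<Rightarrow> real) \<Rightarrow> real \<Rightarrow> 'a set \<Rightarrow> ('a \<Rightarrow> real) \<Rightarrow> bool"
  where "visc_subsolution F c S v \<longleftrightarrow>
    (\<forall>\<phi> g y0. C1_with_gradient \<phi> g \<longrightarrow> local_max_rel S (\<lambda>y. v y - \<phi> y) y0 \<longrightarrow> F y0 (g y0) \<le> c)"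

definition visc_supersolution ::
    "('a::euclidean_space \<Rightarrow> 'a \<Rightarrow> real) \<Rightarrow> real \<Rightarrow> 'a set \<Rightarrow> ('a \<Rightarrow> real) \<Rightarrow> bool"
  where "visc_supersolution F c S v \<longleftrightarrow>
    (\<forall>\<phi> g y0. C1_with_gradient \<phi> g \<longrightarrow> local_min_rel S (\<lambda>y. v y - \<phi> y) y0 \<longrightarrow> F y0 (g y0) \<ge> c)"

definition state_constraint_cell_solution ::
    "(real^'n \<Rightarrow> real^'n \<Rightarrow> real) \<Rightarrow> (real^'n) set \<Rightarrow> real^'n \<Rightarrow> real \<Rightarrow> (real^'n \<Rightarrow> real) \<Rightarrow> bool"
  where "state_constraint_cell_solution H \<Omega> p c v \<longleftrightarrow>
    continuous_on (closure \<Omega>) v \<and> periodic_on (closure \<Omega>) v \<and>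
    visc_subsolution (\<lambda>y q. H y (p + q)) c \<Omega> v \<and>
    visc_supersolution (\<lambda>y q. H y (p + q)) c (closure \<Omega>) v"

definition cell_solution ::
    "(real^'n \<Rightarrow> real^'n \<Rightarrow> real) \<Rightarrow> real^'n \<Rightarrow> real \<Rightarrow> (real^'n \<Rightarrow> real) \<Rightarrow> bool"
  where "cell_solution H p c v \<longleftrightarrow>
    continuous_on UNIV v \<and> periodic_on UNIV v \<and>
    visc_subsolution (\<lambda>y q. H y (p + q)) c UNIV v \<and>
    visc_supersolution (\<lambda>y q. H y (p + q)) c UNIV v"

definition effective_H_constraint ::
    "(real^'n \<Rightarrow> real^'n \<Rightarrow> real) \<Rightarrow> (real^'n) set \<Rightarrow> real^'n \<Rightarrow> real"
  where "effective_H_constraint H \<Omega> p = (THE c. \<exists>v. state_constraint_cell_solution H \<Omega> p c v)"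

definition effective_H ::
    "(real^'n \<Rightarrow> real^'n \<Rightarrow> real) \<Rightarrow> real^'n \<Rightarrow> real"
  where "effective_H H p = (THE c. \<exists>v. cell_solution H p c v)"

definition perforated_space :: "(real^'n) set \<Rightarrow> real \<Rightarrow> (real^'n) set"
  where "perforated_space D t = UNIV - (\<Union>m\<in>int_lattice. (\<lambda>x. m + t *\<^sub>R x) ` closure D)"

end

theory Submission
  imports Defs
begin

text \<open>The constants \<open>c\<close> and \<open>c\<^sub>0\<close> of the perforated and the unperforated cell problem are compared
  through their subsolutions. Restricting a solution on the whole space to the perforated domain gives
  \<open>c \<le> c\<^sub>0\<close> by comparison. Conversely, let \<open>v\<close> be a subsolution at level \<open>c\<close> outside holes of size
  \<open>t\<close>. Since \<open>v + p \<bullet> y\<close> is Lipschitz up to the holes with a constant depending only on \<open>H\<close> and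
  \<open>R\<close>, it oscillates by \<open>O(t)\<close> around each hole. As \<open>H(y, \<cdot>)\<close> is convex with minimum \<open>0\<close> at gradient
  zero, it can be flattened to a constant there and extended into the hole at the cost of raising the
  level by \<open>O(t)\<close>, whence \<open>c\<^sub>0 \<le> c + O(t)\<close>. For \<open>t = 0\<close>, where lattice points are removed, uniqueness
  of the constant follows from this estimate as \<open>t\<close> tends to zero.

  Both constants are well defined: existence is Perron's method at the smallest level admitting
  subsolutions, and uniqueness is the comparison principle.\<close>

section \<open>Subsolutions and support functions\<close>

text \<open>The obstacle is uniformity in \<open>t\<close>: the hole shrinks, and a compactness
  argument carried out for each \<open>t\<close> separately would give constants without control.
  Dilating by \<open>1 / t\<close> turns every hole into \<open>D\<close> itself, and for
  \<open>t < 1/2\<close> the dilated cell contains the fixed box \<open>(-1, 1)^n\<close>. One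
  oscillation bound \<open>M0\<close>, valid for the whole family of functions with a given
  Lipschitz constant on that box minus \<open>closure D\<close>, therefore serves all
  \<open>t\<close>; scaling back multiplies it by \<open>t\<close>. The loss is linear in
  \<open>t\<close> by convexity alone. The extension perturbs an admissible gradient
  \<open>a\<close> by a vector \<open>b\<close> of size \<open>O(t)\<close>, and
  \<open>a + b\<close> is the convex combination \<open>(1 - t) a + t (a + b/t)\<close> whose second
  point stays in a fixed ball. Existence works directly at the critical level. If every maximal
  subsolution normalised at a point fails to be a solution, each can be raised to be strict near its
  point, and averaging finitely many of them contradicts minimality of the level.\<close>

definition set_lip :: "('a::euclidean_space) set \<Rightarrow> 'a set \<Rightarrow> ('a \<Rightarrow> real) \<Rightarrow> bool"
  where "set_lip K S u \<longleftrightarrow> (\<forall>y\<in>S. \<forall>z\<in>S. \<exists>q\<in>K. u y - u z \<le> q \<bullet> (y - z))"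

lemma set_lip_subset: "set_lip K S u \<Longrightarrow> K \<subseteq> K' \<Longrightarrow> S' \<subseteq> S \<Longrightarrow> set_lip K' S' u"
  unfolding set_lip_def by blast

lemma set_lip_cong: "set_lip K S u \<Longrightarrow> (\<And>x. x \<in> S \<Longrightarrow> w x = u x) \<Longrightarrow> set_lip K S w"
  unfolding set_lip_def by simp

text \<open>A compact convex set is cut out by its supporting half-spaces, so estimates in single
  directions \<xi> add up to membership.\<close>

lemma support_mem:
  fixes K :: "'a::euclidean_space set"
  assumes "compact K" "convex K" "\<And>\<xi>. \<exists>q\<in>K. g \<bullet> \<xi> \<le> q \<bullet> \<xi>"
  shows "g \<in> K"
proof (rule ccontr)
  assume "g \<notin> K"
  then obtain a b where ab: "a \<bullet> g < b" "\<forall>x\<in>K. b < a \<bullet> x"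
    using separating_hyperplane_closed_point[of K g] assms compact_imp_closed by blast
  obtain q where "q \<in> K" "g \<bullet> (-a) \<le> q \<bullet> (-a)" using assms(3) by blast
  with ab show False by (force simp: inner_commute)
qed

text \<open>The maximiser lets the existential in \<open>set_lip\<close> be read as a bound by the
  support function of \<open>K\<close>: one \<open>q\<close> dominates all other choices in the
  direction \<xi>.\<close>

lemma support_attained:
  fixes K :: "'a::euclidean_space set"
  assumes "compact K" "K \<noteq> {}"
  obtains q where "q \<in> K" "\<And>p. p \<in> K \<Longrightarrow> p \<bullet> \<xi> \<le> q \<bullet> \<xi>"
proof -
  have "continuous_on K (\<lambda>q. q \<bullet> \<xi>)" by (intro continuous_intros)
  from continuous_attains_sup[OF assms this] that show ?thesis by auto
qed

text \<open>Going from \<open>x0\<close> in direction \<open>-\<xi>\<close>, \<phi> would drop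
  faster than the support function of \<open>K\<close> lets \<open>u\<close> drop if
  \<open>g \<bullet> \<xi>\<close> exceeded that support function; touching from above forbids this.
  It suffices to look along rays, hence differentiability at the single point
  \<open>x0\<close>.\<close>

lemma set_lip_test:
  fixes u :: "'a::euclidean_space \<Rightarrow> real"
  assumes lip: "set_lip K (ball x0 r) u" and r: "r > 0" and K: "compact K" "convex K"
    and der: "(\<phi> has_derivative (\<lambda>h. g \<bullet> h)) (at x0)"
    and max: "\<forall>\<^sub>F y in at x0. u y - \<phi> y \<le> u x0 - \<phi> x0"
  shows "g \<in> K"
proof (rule support_mem[OF K])
  fix \<xi> :: 'a
  have "x0 \<in> ball x0 r" using r by simp
  with lip have "K \<noteq> {}" unfolding set_lip_def by blast
  then obtain q where q: "q \<in> K" "\<And>p. p \<in> K \<Longrightarrow> p \<bullet> \<xi> \<le> q \<bullet> \<xi>"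
    using support_attained[OF K(1)] by blast
  have "g \<bullet> \<xi> \<le> q \<bullet> \<xi>"
  proof (rule ccontr)
    assume neg: "\<not> g \<bullet> \<xi> \<le> q \<bullet> \<xi>"
    define h where "h s = \<phi> (x0 - s *\<^sub>R \<xi>) + s * (q \<bullet> \<xi>)" for s :: real
    have "((\<lambda>s. x0 - s *\<^sub>R \<xi>) has_derivative (\<lambda>s. - (s *\<^sub>R \<xi>))) (at (0::real))"
      by (auto intro!: derivative_eq_intros)
    moreover have "(\<phi> has_derivative (\<lambda>h. g \<bullet> h)) (at (x0 - 0 *\<^sub>R \<xi>))" using der by simp
    ultimately have "((\<lambda>s. \<phi> (x0 - s *\<^sub>R \<xi>)) has_derivative (\<lambda>s. g \<bullet> (- (s *\<^sub>R \<xi>)))) (at (0::real))"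
      by (rule has_derivative_compose)
    then have "(h has_derivative (\<lambda>s. g \<bullet> (- (s *\<^sub>R \<xi>)) + s * (q \<bullet> \<xi>))) (at (0::real))"
      unfolding h_def by (auto intro!: derivative_eq_intros)
    moreover have "(\<lambda>s. g \<bullet> (- (s *\<^sub>R \<xi>)) + s * (q \<bullet> \<xi>)) = (*) (q \<bullet> \<xi> - g \<bullet> \<xi>)"
      by (auto simp: algebra_simps)
    ultimately have "DERIV h 0 :> q \<bullet> \<xi> - g \<bullet> \<xi>" by (simp add: has_field_derivative_def)
    then obtain d where d: "d > 0" "\<And>s. 0 < s \<Longrightarrow> s < d \<Longrightarrow> h (0 + s) < h 0"
      using DERIV_neg_dec_right[of h "q \<bullet> \<xi> - g \<bullet> \<xi>" 0] neg by auto
    obtain e where e: "e > 0" "\<And>y. dist y x0 < e \<Longrightarrow> u y - \<phi> y \<le> u x0 - \<phi> x0"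
    proof -
      obtain e where e: "e > 0" "\<And>y. y \<noteq> x0 \<Longrightarrow> dist y x0 < e \<Longrightarrow> u y - \<phi> y \<le> u x0 - \<phi> x0"
        using max unfolding eventually_at by auto
      have "u y - \<phi> y \<le> u x0 - \<phi> x0" if "dist y x0 < e" for y
        using e(2)[of y] that by (cases "y = x0") auto
      with e(1) that show ?thesis by blast
    qed
    have "((\<lambda>s. s * norm \<xi>) \<longlongrightarrow> 0 * norm \<xi>) (at_right 0)" by (intro tendsto_intros)
    then have "\<forall>\<^sub>F s in at_right 0. s * norm \<xi> < min e r"
      using e r by (intro order_tendstoD(2)) auto
    moreover have "\<forall>\<^sub>F s in at_right 0. 0 < s \<and> s < d"
      using d(1) by (auto simp: eventually_at_right_field)
    ultimately have "\<forall>\<^sub>F s in at_right 0. s * norm \<xi> < min e r \<and> 0 < s \<and> s < d"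
      by eventually_elim simp
    then obtain s where s: "0 < s" "s < d" and sm: "s * norm \<xi> < min e r"
      using eventually_happens'[OF trivial_limit_at_right_real] by blast
    have near: "dist (x0 - s *\<^sub>R \<xi>) x0 < e" "x0 - s *\<^sub>R \<xi> \<in> ball x0 r"
      using sm s(1) by (auto simp: dist_norm)
    obtain p where p: "p \<in> K" "u x0 - u (x0 - s *\<^sub>R \<xi>) \<le> p \<bullet> (x0 - (x0 - s *\<^sub>R \<xi>))"
      using lip near(2) \<open>x0 \<in> ball x0 r\<close> unfolding set_lip_def by meson
    have "p \<bullet> (x0 - (x0 - s *\<^sub>R \<xi>)) \<le> s * (q \<bullet> \<xi>)"
      using q(2)[OF p(1)] s(1) by (simp add: mult_left_mono)
    with p e(2)[OF near(1)] have "h s \<ge> h 0" by (simp add: h_def)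
    with d(2)[OF s] show False by simp
  qed
  with q(1) show "\<exists>q\<in>K. g \<bullet> \<xi> \<le> q \<bullet> \<xi>" by blast
qed

lemma interior_local_max:
  assumes "open U" "x \<in> U" "U \<subseteq> S" "\<And>y. y \<in> U \<Longrightarrow> f y \<le> f x"
  shows "local_max_rel S f x"
proof -
  have "\<forall>\<^sub>F y in at x within S. y \<in> U"
    using assms(1,2) by (rule eventually_at_in_open'[THEN filter_leD[OF at_le, rotated]]) auto
  then show ?thesis unfolding local_max_rel_def using assms by (auto elim: eventually_mono)
qed

text \<open>Integrates the gradient constraint along a segment without mollifying \<open>u\<close>.
  If \<open>u y - u z\<close> exceeds the support function of \<open>K\<close> at
  \<open>y - z\<close>, then \<open>u\<close> minus a function of slightly smaller slope, still
  above the support function, attains its maximum over a thin cylinder around the segment in the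
  interior, where testing contradicts the choice of slope.\<close>

lemma visc_sub_set_lip:
  fixes u :: "'a::euclidean_space \<Rightarrow> real"
  assumes S: "open S" "convex S" and u: "continuous_on S u"
    and sub: "visc_subsolution F c S u"
    and K: "compact K" "K \<noteq> {}" "\<And>x q. x \<in> S \<Longrightarrow> F x q \<le> c \<Longrightarrow> q \<in> K"
  shows "set_lip K S u"
proof (rule ccontr)
  assume "\<not> set_lip K S u"
  then obtain y z where yz: "y \<in> S" "z \<in> S" and big: "\<And>q. q \<in> K \<Longrightarrow> q \<bullet> (y - z) < u y - u z"
    unfolding set_lip_def by force
  define \<xi> where "\<xi> = y - z"
  have "\<xi> \<noteq> 0" using big K(2) by (auto simp: \<xi>_def)
  obtain qm where qm: "qm \<in> K" "\<And>p. p \<in> K \<Longrightarrow> p \<bullet> \<xi> \<le> qm \<bullet> \<xi>"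
    using support_attained[OF K(1,2)] by blast
  \<comment> \<open>The excess is four \<delta>: one raises the slope to \<open>k\<close>, one
    absorbs \<open>x ^ M\<close> at \<open>y\<close>, and more than one remains against the values
    of \<open>u\<close> near \<open>z\<close>.\<close>
  define \<delta> where "\<delta> = (u y - u z - qm \<bullet> \<xi>) / 4"
  have \<delta>: "\<delta> > 0" using big[OF qm(1)] by (simp add: \<delta>_def \<xi>_def)
  define k where "k = qm \<bullet> \<xi> + \<delta>"
  obtain d where d: "d > 0" "cball y d \<subseteq> S"
    using S(1) yz(1) open_contains_cball by blast
  \<comment> \<open>The segment is prolonged beyond \<open>y\<close>, so that a steep barrier can be
    built past \<open>y\<close> without disturbing the value at \<open>y\<close>.\<close>
  define \<rho> where "\<rho> = d / norm \<xi>"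
  have \<rho>: "\<rho> > 0" "y + \<rho> *\<^sub>R \<xi> \<in> S"
    using d \<open>\<xi> \<noteq> 0\<close> by (auto simp: \<rho>_def dist_norm intro!: subsetD[OF d(2)])
  define a where "a w = (w - z) \<bullet> \<xi> / (\<xi> \<bullet> \<xi>)" for w
  define P where "P w = w - z - a w *\<^sub>R \<xi>" for w
  have xi2: "\<xi> \<bullet> \<xi> > 0" using \<open>\<xi> \<noteq> 0\<close> by simp
  have P\<xi>: "P w \<bullet> \<xi> = 0" for w using xi2 by (simp add: P_def a_def inner_diff_left)
  have contP: "continuous_on UNIV P" and conta: "continuous_on UNIV a"
    unfolding P_def a_def using xi2 by (auto intro!: continuous_intros)
  have seg: "closed_segment z (y + \<rho> *\<^sub>R \<xi>) \<subseteq> S"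
    using closed_segment_subset[OF yz(2) \<rho>(2) S(2)] .
  obtain r where r: "r > 0" "(\<Union>x\<in>closed_segment z (y + \<rho> *\<^sub>R \<xi>). cball x r) \<subseteq> S"
    using compact_subset_open_imp_cball_epsilon_subset[OF _ S(1) seg] by auto
  define Cyl where "Cyl = {w. 0 \<le> a w \<and> a w \<le> 1 + \<rho> \<and> norm (P w) \<le> r}"
  have decomp: "w = (z + a w *\<^sub>R \<xi>) + P w" for w by (simp add: P_def)
  have CylS: "Cyl \<subseteq> S"
  proof
    fix w assume w: "w \<in> Cyl"
    have "z + a w *\<^sub>R \<xi> \<in> closed_segment z (y + \<rho> *\<^sub>R \<xi>)"
    proof -
      have "z + a w *\<^sub>R \<xi> = (1 - a w / (1 + \<rho>)) *\<^sub>R z + (a w / (1 + \<rho>)) *\<^sub>R (z + (1 + \<rho>) *\<^sub>R \<xi>)"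
        using \<rho>(1) by (simp add: scaleR_diff_left scaleR_add_right)
      moreover have "z + (1 + \<rho>) *\<^sub>R \<xi> = y + \<rho> *\<^sub>R \<xi>" by (simp add: \<xi>_def scaleR_add_left)
      moreover have "0 \<le> a w / (1 + \<rho>)" "a w / (1 + \<rho>) \<le> 1" using w \<rho>(1) by (auto simp: Cyl_def)
      ultimately show ?thesis unfolding in_segment by metis
    qed
    moreover have "w \<in> cball (z + a w *\<^sub>R \<xi>) r"
      using w decomp[of w] by (auto simp: Cyl_def dist_norm P_def norm_minus_commute algebra_simps)
    ultimately show "w \<in> S" using r by blast
  qed
  have Cylcomp: "compact Cyl"
  proof -
    have "closed Cyl" unfolding Cyl_def
      by (intro closed_Collect_conj closed_Collect_le continuous_intros conta contP)
    moreover have "bounded Cyl"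
    proof (rule boundedI)
      fix w assume w: "w \<in> Cyl"
      have "norm w \<le> norm z + norm (a w *\<^sub>R \<xi>) + norm (P w)"
        using norm_triangle_ineq[of "z + a w *\<^sub>R \<xi>" "P w"] norm_triangle_ineq[of z "a w *\<^sub>R \<xi>"]
          arg_cong[OF decomp[of w], of norm] by linarith
      also have "\<dots> \<le> norm z + (1 + \<rho>) * norm \<xi> + r"
        using w by (auto simp: Cyl_def intro!: add_mono mult_right_mono)
      finally show "norm w \<le> norm z + (1 + \<rho>) * norm \<xi> + r" .
    qed
    ultimately show ?thesis by (simp add: compact_eq_bounded_closed)
  qed
  have "compact (u ` Cyl)" using compact_continuous_image[OF continuous_on_subset[OF u CylS] Cylcomp] .
  then obtain A where A: "A > 0" "\<And>w. w \<in> Cyl \<Longrightarrow> \<bar>u w\<bar> \<le> A"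
    using compact_imp_bounded bounded_pos by (metis image_eqI real_norm_def)
  obtain r' where r': "r' > 0" "\<And>w. dist w z < r' \<Longrightarrow> w \<in> S \<Longrightarrow> u w < u z + \<delta>"
  proof -
    have "\<forall>\<^sub>F w in at z within S. u w < u z + \<delta>"
      using u yz(2) \<delta> by (auto simp: continuous_on_def intro!: order_tendstoD)
    then obtain d where "d > 0" "\<forall>w\<in>S. w \<noteq> z \<and> dist w z < d \<longrightarrow> u w < u z + \<delta>"
      unfolding eventually_at by blast
    then have d: "u w < u z + \<delta>" if "dist w z < d" "w \<in> S" for w
      using that \<delta> by (cases "w = z") auto
    with \<open>d > 0\<close> show ?thesis by (rule that)
  qed
  \<comment> \<open>In the axial coordinate, \<open>y\<close> sits at \<open>1\<close> and the far
    cap at \<open>1 + \<rho>\<close>. With \<open>x < 1 < (1 + \<rho>) * x\<close> a single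
    increasing power \<open>(x * s) ^ M\<close> is negligible at \<open>y\<close> and an impassable
    barrier at the cap.\<close>
  define x where "x = 1 / (1 + \<rho>/2)"
  define X where "X = (1 + \<rho>) * x"
  have x: "0 < x" "x < 1" "1 < X" using \<rho>(1) by (auto simp: x_def X_def field_simps)
  have "\<forall>\<^sub>F M in sequentially. x ^ M < \<delta> \<and> X ^ M > 2 * A + \<bar>k\<bar> * (1 + \<rho>) + 1 \<and> M > 0"
  proof (intro eventually_conj)
    show "\<forall>\<^sub>F M in sequentially. x ^ M < \<delta>"
      using LIMSEQ_realpow_zero[of x] x \<delta> by (auto intro: order_tendstoD)
    show "\<forall>\<^sub>F M in sequentially. X ^ M > 2 * A + \<bar>k\<bar> * (1 + \<rho>) + 1"
    proof -
      obtain M0 where "2 * A + \<bar>k\<bar> * (1 + \<rho>) + 1 < X ^ M0" using real_arch_pow[OF x(3)] by blast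
      then have "2 * A + \<bar>k\<bar> * (1 + \<rho>) + 1 < X ^ M" if "M0 \<le> M" for M
        using power_increasing[OF that, of X] x(3) by linarith
      then show ?thesis by (rule eventually_sequentiallyI)
    qed
    show "\<forall>\<^sub>F M in sequentially. (0::nat) < M" by (rule eventually_gt_at_top)
  qed
  then obtain M where M: "x ^ M < \<delta>" "X ^ M > 2 * A + \<bar>k\<bar> * (1 + \<rho>) + 1" "M > 0"
    using eventually_happens'[OF sequentially_bot] by blast
  \<comment> \<open>The penalty exceeds every competing term once \<open>norm (P w)\<close> reaches
    \<open>min r r'\<close>. The bound \<open>r\<close> keeps the maximum off the lateral side, and
    \<open>r'\<close> puts a maximum on the bottom so close to \<open>z\<close> that
    \<open>u\<close> is below \<open>u z + \<delta>\<close> there.\<close>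
  define N where "N = (2 * A + \<bar>k\<bar> * (1 + \<rho>) + 1) / (min r r')\<^sup>2"
  have Npos: "N > 0" using A r r' \<rho> by (auto simp: N_def intro!: divide_pos_pos add_nonneg_pos add_pos_nonneg)
  have Nr: "N * t\<^sup>2 \<ge> 2 * A + \<bar>k\<bar> * (1 + \<rho>) + 1" if "t \<ge> min r r'" for t
  proof -
    have m: "min r r' > 0" using r r' by simp
    have "N * t\<^sup>2 \<ge> N * (min r r')\<^sup>2" using that m Npos by (intro mult_left_mono power_mono) auto
    then show ?thesis using m by (simp add: N_def)
  qed
  define \<psi> where "\<psi> s = k * s + (x * s) ^ M" for s :: real
  define \<phi> where "\<phi> w = \<psi> (a w) + N * (P w \<bullet> P w)" for w
  define g where "g w = ((k + real M * (x * a w) ^ (M - 1) * x) / (\<xi> \<bullet> \<xi>)) *\<^sub>R \<xi> + (2 * N) *\<^sub>R P w" for w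
  have C1: "C1_with_gradient \<phi> g"
    unfolding C1_with_gradient_def
  proof
    show "continuous_on UNIV g" unfolding g_def using xi2
      by (intro continuous_intros conta contP) auto
    show "\<forall>w. (\<phi> has_derivative (\<lambda>h. g w \<bullet> h)) (at w)"
    proof
      fix w
      have a': "(a has_derivative (\<lambda>h. h \<bullet> \<xi> / (\<xi> \<bullet> \<xi>))) (at w)"
        unfolding a_def using xi2 by (auto intro!: derivative_eq_intros)
      have P': "(P has_derivative (\<lambda>h. h - (h \<bullet> \<xi> / (\<xi> \<bullet> \<xi>)) *\<^sub>R \<xi>)) (at w)"
        unfolding P_def by (auto intro!: derivative_eq_intros a')
      have "(\<phi> has_derivative (\<lambda>h. k * (h \<bullet> \<xi> / (\<xi> \<bullet> \<xi>)) + real M * (x * (h \<bullet> \<xi> / (\<xi> \<bullet> \<xi>))) * (x * a w) ^ (M - 1)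
          + N * (P w \<bullet> (h - (h \<bullet> \<xi> / (\<xi> \<bullet> \<xi>)) *\<^sub>R \<xi>) + (h - (h \<bullet> \<xi> / (\<xi> \<bullet> \<xi>)) *\<^sub>R \<xi>) \<bullet> P w))) (at w)"
        unfolding \<phi>_def \<psi>_def
        by (auto intro!: derivative_eq_intros a' P')
      moreover have "(\<lambda>h. k * (h \<bullet> \<xi> / (\<xi> \<bullet> \<xi>)) + real M * (x * (h \<bullet> \<xi> / (\<xi> \<bullet> \<xi>))) * (x * a w) ^ (M - 1)
          + N * (P w \<bullet> (h - (h \<bullet> \<xi> / (\<xi> \<bullet> \<xi>)) *\<^sub>R \<xi>) + (h - (h \<bullet> \<xi> / (\<xi> \<bullet> \<xi>)) *\<^sub>R \<xi>) \<bullet> P w)) = (\<lambda>h. g w \<bullet> h)"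
        using P\<xi>[of w] by (auto simp: fun_eq_iff g_def inner_diff_right inner_diff_left inner_add_left inner_commute algebra_simps add_divide_distrib)
      ultimately show "(\<phi> has_derivative (\<lambda>h. g w \<bullet> h)) (at w)" by simp
    qed
  qed
  have zC: "y \<in> Cyl"
  proof -
    have "a y = 1" using xi2 by (simp add: a_def \<xi>_def)
    then show ?thesis using \<rho> r by (simp add: Cyl_def P_def \<xi>_def)
  qed
  have "continuous_on Cyl (\<lambda>w. u w - \<phi> w)"
    unfolding \<phi>_def \<psi>_def
    by (intro continuous_intros continuous_on_subset[OF u CylS] continuous_on_subset[OF conta] continuous_on_subset[OF contP]) auto
  then obtain w where w: "w \<in> Cyl" "\<And>w'. w' \<in> Cyl \<Longrightarrow> u w' - \<phi> w' \<le> u w - \<phi> w"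
    using continuous_attains_sup[OF Cylcomp] zC by blast
  have ay: "a y = 1" "P y = 0" using xi2 by (simp_all add: a_def \<xi>_def P_def)
  have lower: "u w - \<phi> w > u z + \<delta>"
  proof -
    have "u y - \<phi> y > u z + \<delta>" using M(1) \<delta> by (simp add: \<phi>_def \<psi>_def ay k_def \<delta>_def field_simps)
    with w(2)[OF zC] show ?thesis by simp
  qed
  have lower': "u w - (k * a w + (x * a w) ^ M + N * (P w \<bullet> P w)) > u z + \<delta>"
    using lower by (simp add: \<phi>_def \<psi>_def)
  have aw: "0 \<le> a w" "a w \<le> 1 + \<rho>" "norm (P w) \<le> r" using w by (auto simp: Cyl_def)
  have kb: "\<bar>k * a w\<bar> \<le> \<bar>k\<bar> * (1 + \<rho>)" using aw by (auto simp: abs_mult intro!: mult_left_mono)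
  have pw: "(x * a w) ^ M \<ge> 0" using x aw by simp
  have zin: "z \<in> Cyl" using \<rho> r by (simp add: Cyl_def a_def P_def)
  have uz: "u w \<le> A" "u z \<ge> -A" using A(2)[OF w(1)] A(2)[OF zin] by auto
  have PP: "P w \<bullet> P w = (norm (P w))\<^sup>2" by (simp add: power2_norm_eq_inner)
  have NP: "N * (P w \<bullet> P w) \<ge> 0" using Npos by simp
  have n1: "norm (P w) < min r r'"
  proof (rule ccontr)
    assume "\<not> ?thesis"
    then have "N * (P w \<bullet> P w) \<ge> 2 * A + \<bar>k\<bar> * (1 + \<rho>) + 1" using Nr[of "norm (P w)"] unfolding PP by linarith
    with lower' uz pw kb \<delta> show False by linarith
  qed
  have n2: "a w > 0"
  proof (rule ccontr)
    assume "\<not> ?thesis"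
    then have a0: "a w = 0" using aw by simp
    then have "P w = w - z" by (simp add: P_def)
    then have "dist w z < r'" using n1 by (simp add: dist_norm)
    then have "u w < u z + \<delta>" using r'(2) w(1) CylS by blast
    then show False using lower' NP pw a0 M(3) by (simp add: zero_power)
  qed
  have n3: "a w < 1 + \<rho>"
  proof (rule ccontr)
    assume "\<not> ?thesis"
    then have "a w = 1 + \<rho>" using aw by simp
    then have "x * a w = X" unfolding X_def by (simp only: mult.commute)
    then have "(x * a w) ^ M = X ^ M" by (simp only:)
    with lower' uz kb \<delta> M(2) NP show False by linarith
  qed
  define U where "U = {w. 0 < a w \<and> a w < 1 + \<rho> \<and> norm (P w) < r}"
  have "open U" unfolding U_def
    by (intro open_Collect_conj open_Collect_less continuous_intros conta contP)
  moreover have "w \<in> U" "U \<subseteq> Cyl" using n1 n2 n3 by (auto simp: U_def Cyl_def)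
  ultimately have "local_max_rel S (\<lambda>y. u y - \<phi> y) w"
    using w(2) CylS by (intro interior_local_max[of U]) auto
  with sub C1 have "F w (g w) \<le> c" unfolding visc_subsolution_def by blast
  then have "g w \<in> K" using K(3) w(1) CylS by blast
  then have "g w \<bullet> \<xi> \<le> qm \<bullet> \<xi>" by (rule qm(2))
  moreover have "g w \<bullet> \<xi> = k + real M * (x * a w) ^ (M - 1) * x"
    using P\<xi>[of w] xi2 by (simp add: g_def inner_add_left)
  moreover have "real M * (x * a w) ^ (M - 1) * x \<ge> 0" using x aw by simp
  ultimately show False using \<delta> by (simp add: k_def)
qed

section \<open>Comparison in domains with inward cones\<close>

text \<open>Perforated domains are not convex, so a gradient bound controls differences only along
  segments inside \<open>S\<close>; other pairs of points have to be joined by several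
  segments.\<close>

definition seg_lip :: "real \<Rightarrow> ('a::euclidean_space) set \<Rightarrow> ('a \<Rightarrow> real) \<Rightarrow> bool"
  where "seg_lip L S u \<longleftrightarrow> (\<forall>a b. closed_segment a b \<subseteq> S \<longrightarrow> \<bar>u a - u b\<bar> \<le> L * dist a b)"

text \<open>Soner's uniform interior cone condition near \<open>z\<close>, with base points taken in
  the closure. The direction \<open>e = 0\<close> is allowed and is the one used for points of the
  open set.\<close>

definition inward :: "('a::euclidean_space) set \<Rightarrow> 'a \<Rightarrow> 'a \<Rightarrow> real \<Rightarrow> bool"
  where "inward \<Omega> z e \<delta> \<longleftrightarrow> \<delta> > 0 \<and>
    (\<forall>y\<in>closure \<Omega> \<inter> ball z \<delta>. \<forall>e'\<in>ball e \<delta>. \<forall>s\<in>{0<..<\<delta>}. y + s *\<^sub>R e' \<in> \<Omega>)"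

lemma interior_local_min_rel:
  assumes "open U" "x \<in> U" "x \<in> S" "\<And>y. y \<in> U \<inter> S \<Longrightarrow> f x \<le> f y"
  shows "local_min_rel S f x"
proof -
  have "\<forall>\<^sub>F y in at x within S. y \<in> U \<inter> S"
    using assms(1-3) unfolding eventually_at_topological by blast
  then show ?thesis unfolding local_min_rel_def using assms by (auto elim: eventually_mono)
qed

lemma set_lip_continuous_on:
  fixes u :: "'a::euclidean_space \<Rightarrow> real"
  assumes "bounded K" "set_lip K S u"
  shows "continuous_on S u"
proof -
  obtain B where B: "B > 0" "\<And>q. q \<in> K \<Longrightarrow> norm q \<le> B"
    using assms(1) bounded_pos by blast
  have *: "u y - u z \<le> B * dist y z" if yz: "y \<in> S" "z \<in> S" for y z
  proof -
    obtain q where q: "q \<in> K" "u y - u z \<le> q \<bullet> (y - z)"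
      using assms(2) yz unfolding set_lip_def by blast
    have "q \<bullet> (y - z) \<le> norm q * norm (y - z)" by (rule norm_cauchy_schwarz)
    also have "\<dots> \<le> B * norm (y - z)" using B(2)[OF q(1)] by (intro mult_right_mono) auto
    finally show ?thesis using q(2) by (simp add: dist_norm)
  qed
  have "B-lipschitz_on S u"
  proof (rule lipschitz_onI)
    fix y z assume "y \<in> S" "z \<in> S"
    with *[of y z] *[of z y] show "dist (u y) (u z) \<le> B * dist y z"
      by (simp add: dist_real_def dist_commute abs_le_iff)
  qed (use B in auto)
  then show ?thesis by (rule lipschitz_on_continuous_on)
qed

locale coercive_hamiltonian =
  fixes F :: "'a::euclidean_space \<Rightarrow> 'a \<Rightarrow> real"
  assumes F_cont: "continuous_on UNIV (\<lambda>(y, q). F y q)"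
    and F_coercive: "\<exists>L. \<forall>y q. F y q \<le> B \<longrightarrow> norm q \<le> L"
    and F_convex: "convex_on UNIV (F y)"
begin

lemma F_cont2 [continuous_intros]:
  assumes "continuous_on S f" "continuous_on S g"
  shows "continuous_on S (\<lambda>x. F (f x) (g x))"
proof -
  have "continuous_on S (\<lambda>x. (f x, g x))" using assms by (intro continuous_intros)
  from continuous_on_compose2[OF F_cont this] show ?thesis by simp
qed

lemma level_compact: "compact {q. F y q \<le> c}"
proof -
  have "closed {q. F y q \<le> c}"
    by (intro closed_Collect_le continuous_intros)
  moreover have "bounded {q. F y q \<le> c}"
    using F_coercive[of c] by (auto simp: bounded_iff)
  ultimately show ?thesis by (simp add: compact_eq_bounded_closed)
qed

lemma level_convex: "convex {q. F y q \<le> c}"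
  unfolding convex_def
proof (intro ballI allI impI, unfold mem_Collect_eq)
  fix a b and s t :: real
  assume *: "F y a \<le> c" "F y b \<le> c" "0 \<le> s" "0 \<le> t" "s + t = 1"
  have "F y (s *\<^sub>R a + t *\<^sub>R b) \<le> s * F y a + t * F y b"
    using F_convex[of y] * unfolding convex_on_def by blast
  also have "\<dots> \<le> s * c + t * c" using * by (intro add_mono mult_left_mono) auto
  finally show "F y (s *\<^sub>R a + t *\<^sub>R b) \<le> c" using * by (simp flip: distrib_right)
qed

lemma F_uniform:
  assumes "\<kappa> > 0"
  obtains \<delta> where "\<delta> > 0"
    "\<And>x y q q'. \<lbrakk>x \<in> cball z 1; y \<in> cball z 1; norm q \<le> L; norm q' \<le> L; dist x y < \<delta>; dist q q' < \<delta>\<rbrakk>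
       \<Longrightarrow> \<bar>F x q - F y q'\<bar> < \<kappa>"
proof -
  have "uniformly_continuous_on (cball z 1 \<times> cball 0 L) (\<lambda>(y, q). F y q)"
    by (rule compact_uniformly_continuous)
       (auto intro: continuous_on_subset[OF F_cont] compact_Times)
  then obtain d where d: "d > 0"
    "\<And>a b. a \<in> cball z 1 \<times> cball 0 L \<Longrightarrow> b \<in> cball z 1 \<times> cball 0 L \<Longrightarrow> dist a b < d \<Longrightarrow>
      dist ((\<lambda>(y, q). F y q) a) ((\<lambda>(y, q). F y q) b) < \<kappa>"
    using assms unfolding uniformly_continuous_on_def by (metis dist_commute)
  show ?thesis
  proof (rule that[of "d/2"])
    fix x y q q' :: 'a assume *: "x \<in> cball z 1" "y \<in> cball z 1" "norm q \<le> L" "norm q' \<le> L"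
      "dist x y < d/2" "dist q q' < d/2"
    have "dist (x, q) (y, q') \<le> dist x y + dist q q'"
      unfolding dist_Pair_Pair by (rule sqrt_sum_squares_le_sum) auto
    with * have "dist (x, q) (y, q') < d" by simp
    with d(2)[of "(x, q)" "(y, q')"] * show "\<bar>F x q - F y q'\<bar> < \<kappa>"
      by (simp add: dist_real_def)
  qed (use d in auto)
qed

text \<open>Coercivity confines the relevant \<open>q\<close> to a ball on which continuity in
  \<open>x\<close> is uniform, so sublevel sets at nearby points fit into a slightly higher sublevel
  set at \<open>x0\<close>.\<close>

lemma level_local:
  assumes "c < c'"
  obtains r where "r > 0" "\<And>x q. x \<in> ball x0 r \<Longrightarrow> F x q \<le> c \<Longrightarrow> F x0 q \<le> c'"
proof -
  obtain L where L: "\<And>y q. F y q \<le> c \<Longrightarrow> norm q \<le> L" using F_coercive by blast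
  obtain \<delta> where \<delta>: "\<delta> > 0"
    "\<And>x y q q'. \<lbrakk>x \<in> cball x0 1; y \<in> cball x0 1; norm q \<le> L; norm q' \<le> L; dist x y < \<delta>; dist q q' < \<delta>\<rbrakk>
       \<Longrightarrow> \<bar>F x q - F y q'\<bar> < c' - c"
    using F_uniform[of "c' - c" x0 L] assms by auto
  show ?thesis
  proof (rule that[of "min \<delta> 1"])
    fix x q assume x: "x \<in> ball x0 (min \<delta> 1)" and q: "F x q \<le> c"
    have "\<bar>F x q - F x0 q\<bar> < c' - c"
      using x L[OF q] \<delta> by (intro \<delta>(2)) (auto simp: dist_commute)
    with q show "F x0 q \<le> c'" by simp
  qed (use \<delta> in auto)
qed

text \<open>For convex Hamiltonians the viscosity inequality amounts to local Lipschitz bounds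
  by the support functions of the sublevel sets. These bounds involve no test functions
  and survive suprema, infima, truncations and convex combinations.\<close>

lemma visc_sub_set_lip_local:
  assumes "c < c'" "F x0 q0 \<le> c'"
  obtains r where "r > 0"
    "\<And>S u. \<lbrakk>open S; convex S; S \<subseteq> ball x0 r; continuous_on S u; visc_subsolution F c S u\<rbrakk>
       \<Longrightarrow> set_lip {q. F x0 q \<le> c'} S u"
proof -
  obtain r where r: "r > 0" "\<And>x q. x \<in> ball x0 r \<Longrightarrow> F x q \<le> c \<Longrightarrow> F x0 q \<le> c'"
    using level_local[OF assms(1)] by blast
  show ?thesis
    by (rule that[OF r(1)], rule visc_sub_set_lip[where F=F and c=c])
       (use assms(2) r(2) level_compact in auto)
qed

text \<open>The converse direction. Only a frozen set at each level \<open>c' > c\<close> is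
  demanded, since freezing the base point costs an arbitrarily small rise; \<open>K\<close> may be
  any compact convex set below \<open>c'\<close>, which later admits sums of sets.\<close>

lemma visc_subI:
  assumes S: "open S"
    and lip: "\<And>x0 c'. x0 \<in> S \<Longrightarrow> c < c' \<Longrightarrow> \<exists>r>0. \<exists>K. compact K \<and> convex K \<and>
      set_lip K (ball x0 r) u \<and> (\<forall>q\<in>K. F x0 q \<le> c')"
  shows "visc_subsolution F c S u"
  unfolding visc_subsolution_def
proof (intro allI impI)
  fix \<phi> g x0 assume C1: "C1_with_gradient \<phi> g" and max: "local_max_rel S (\<lambda>y. u y - \<phi> y) x0"
  have x0: "x0 \<in> S" using max by (simp add: local_max_rel_def)
  have ev: "\<forall>\<^sub>F y in at x0. u y - \<phi> y \<le> u x0 - \<phi> x0"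
    using max at_within_open[OF x0 S] by (simp add: local_max_rel_def)
  show "F x0 (g x0) \<le> c"
  proof (rule dense_le)
    fix c'' show "c'' \<le> c" if "c'' < F x0 (g x0)"
    proof (rule ccontr)
      assume "\<not> c'' \<le> c"
      then obtain r K where "r > 0" "compact K" "convex K" "set_lip K (ball x0 r) u" "\<forall>q\<in>K. F x0 q \<le> c''"
        using lip[OF x0, of c''] by auto
      with set_lip_test[of K x0 r u \<phi> "g x0"] C1 ev have "F x0 (g x0) \<le> c''"
        by (auto simp: C1_with_gradient_def)
      with that show False by simp
    qed
  qed
qed

text \<open>A neighbourhood of a single segment is convex, being a Minkowski sum of the segment and
  a ball, so the convex case applies there with \<open>K\<close> a ball around \<open>q0\<close>.
  Subtracting \<open>q0 \<bullet> y\<close> recentres that ball at the origin.\<close>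

lemma visc_sub_seg_lip:
  assumes "open S" "continuous_on S u" "visc_subsolution F c S u" "L \<ge> 0"
    and L: "\<And>y q. y \<in> S \<Longrightarrow> F y q \<le> c \<Longrightarrow> norm (q - q0) \<le> L"
  shows "seg_lip L S (\<lambda>y. u y - q0 \<bullet> y)"
  unfolding seg_lip_def
proof (intro allI impI)
  fix a b :: 'a assume seg: "closed_segment a b \<subseteq> S"
  obtain r where r: "r > 0" "(\<Union>x\<in>closed_segment a b. cball x r) \<subseteq> S"
    using compact_subset_open_imp_cball_epsilon_subset[OF _ assms(1) seg] by auto
  define N where "N = (\<Union>x\<in>closed_segment a b. ball x r)"
  have NS: "N \<subseteq> S" using r(2) ball_subset_cball unfolding N_def by blast
  have "ball x r = (\<Union>y\<in>ball 0 r. {x + y})" for x :: 'a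
  proof (intro set_eqI iffI)
    fix w assume "w \<in> ball x r"
    then have "w - x \<in> ball 0 r" "w = x + (w - x)" by (auto simp: dist_norm norm_minus_commute)
    then show "w \<in> (\<Union>y\<in>ball 0 r. {x + y})" by blast
  qed (auto simp: dist_norm)
  then have "N = (\<Union>x\<in>closed_segment a b. \<Union>y\<in>ball 0 r. {x + y})"
    unfolding N_def by (rule SUP_cong[OF refl])
  then have "convex N" using convex_sums[of "closed_segment a b" "ball 0 r"] by simp
  moreover have "open N" by (auto simp: N_def)
  moreover have "visc_subsolution F c N u"
    unfolding visc_subsolution_def
  proof (intro allI impI)
    fix \<phi> g y0 assume *: "C1_with_gradient \<phi> g" "local_max_rel N (\<lambda>y. u y - \<phi> y) y0"
    then have "local_max_rel S (\<lambda>y. u y - \<phi> y) y0"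
      using NS \<open>open N\<close> \<open>open S\<close> by (auto simp: local_max_rel_def at_within_open[of _ N] at_within_open[of _ S] subset_iff)
    with * assms(3) show "F y0 (g y0) \<le> c" unfolding visc_subsolution_def by blast
  qed
  ultimately have "set_lip (cball q0 L) N u"
    using NS assms L by (intro visc_sub_set_lip[where F=F and c=c])
      (auto intro: continuous_on_subset simp: dist_norm norm_minus_commute)
  moreover have "a \<in> N" "b \<in> N"
    unfolding N_def using r(1) ends_in_segment[of a b] centre_in_ball[of _ r] by blast+
  ultimately obtain p q where pq: "p \<in> cball q0 L" "q \<in> cball q0 L" "u a - u b \<le> p \<bullet> (a - b)" "u b - u a \<le> q \<bullet> (b - a)"
    unfolding set_lip_def by meson
  have "(p - q0) \<bullet> (a - b) \<le> L * dist a b" "(q - q0) \<bullet> (b - a) \<le> L * dist a b"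
    using norm_cauchy_schwarz[of "p - q0" "a - b"] norm_cauchy_schwarz[of "q - q0" "b - a"] pq(1,2)
      mult_right_mono[of "norm (p - q0)" L "norm (a - b)"] mult_right_mono[of "norm (q - q0)" L "norm (b - a)"]
    by (auto simp: dist_norm norm_minus_commute)
  with pq show "\<bar>u a - q0 \<bullet> a - (u b - q0 \<bullet> b)\<bar> \<le> L * dist a b"
    unfolding inner_diff_left inner_diff_right by linarith
qed

text \<open>Soner's device: in the doubled functional the two points are kept at the relative
  position \<open>\<epsilon> e\<close>, with \<open>e\<close> pointing inward, so that the subsolution is tested in
  the open set.\<close>

lemma comparison_local:
  assumes \<Omega>: "open \<Omega>" and z0: "z0 \<in> closure \<Omega>" and inw: "inward \<Omega> z0 e \<delta>e"
    and v1: "continuous_on (closure \<Omega>) v1" and v2: "continuous_on (closure \<Omega>) v2"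
    and sub: "visc_subsolution F c1 \<Omega> v1" and super: "visc_supersolution F c2 (closure \<Omega>) v2"
    and max: "\<And>y. y \<in> closure \<Omega> \<Longrightarrow> v1 y - v2 y \<le> v1 z0 - v2 z0"
  shows "c2 \<le> c1"
proof (rule field_le_epsilon)
  fix \<kappa> :: real assume "\<kappa> > 0"
  obtain L where L: "\<And>y q. F y q \<le> c1 \<Longrightarrow> norm q \<le> L" using F_coercive by blast
  obtain \<delta>F where \<delta>F: "\<delta>F > 0"
    "\<And>x y q q'. \<lbrakk>x \<in> cball z0 1; y \<in> cball z0 1; norm q \<le> L + 1; norm q' \<le> L + 1; dist x y < \<delta>F; dist q q' < \<delta>F\<rbrakk>
       \<Longrightarrow> \<bar>F x q - F y q'\<bar> < \<kappa>"
    using F_uniform[OF \<open>\<kappa> > 0\<close>, of z0 "L + 1"] by blast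
  have \<delta>e: "\<delta>e > 0"
    and inw': "\<And>y e' s. \<lbrakk>y \<in> closure \<Omega>; y \<in> ball z0 \<delta>e; e' \<in> ball e \<delta>e; 0 < s; s < \<delta>e\<rbrakk> \<Longrightarrow> y + s *\<^sub>R e' \<in> \<Omega>"
    using inw unfolding inward_def by auto
  define B where "B = cball z0 1 \<inter> closure \<Omega>"
  have B: "compact B" "B \<subseteq> closure \<Omega>" by (auto simp: B_def compact_Int_closed)
  have z0B: "z0 \<in> B" using z0 by (simp add: B_def)
  note v1B = continuous_on_subset[OF v1 B(2)] and v2B = continuous_on_subset[OF v2 B(2)]
  obtain A where A: "A > 0" "\<And>w. w \<in> B \<Longrightarrow> \<bar>v1 w\<bar> \<le> A"
    using compact_imp_bounded[OF compact_continuous_image[OF v1B B(1)]] bounded_pos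
    by (metis image_eqI real_norm_def)
  \<comment> \<open>Target accuracy for both error terms: below the cone aperture, within the unit
    ball, and with \<open>2 * \<tau> < \<delta>F\<close> because the two test gradients will differ
    by \<open>2 * norm (y - z0)\<close>.\<close>
  define \<tau> where "\<tau> = min (min \<delta>e 1) \<delta>F / 4"
  have \<tau>: "0 < \<tau>" "\<tau> < \<delta>e" "\<tau> \<le> 1/4" "2 * \<tau> < \<delta>F" using \<delta>e \<delta>F(1) by (auto simp: \<tau>_def)
  obtain \<delta>1 where \<delta>1: "\<delta>1 > 0" "\<And>x y. \<lbrakk>x \<in> B; y \<in> B; dist x y < \<delta>1\<rbrakk> \<Longrightarrow> \<bar>v1 x - v1 y\<bar> < \<tau>\<^sup>2 / 2"
  proof -
    have "uniformly_continuous_on B v1" using compact_uniformly_continuous[OF v1B B(1)] .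
    moreover have "\<tau>\<^sup>2 / 2 > 0" using \<tau> by simp
    ultimately show ?thesis using that unfolding uniformly_continuous_on_def dist_real_def by metis
  qed
  define b where "b = 2 * A + 1 + norm e"
  define m where "m = min (min \<delta>1 (1/4)) (min \<delta>F \<delta>e)"
  \<comment> \<open>\<open>b\<close> will bound \<open>norm (E x y + e)\<close>, and
    \<open>\<epsilon> * b < m\<close> keeps the doubled points, as well as \<open>z0\<close> and
    \<open>z1\<close>, within \<open>m\<close> of each other.\<close>
  define \<epsilon> where "\<epsilon> = m / (2 * (b + 1))"
  have b: "b \<ge> 0" "norm e \<le> b" using A by (auto simp: b_def)
  have m: "m > 0" "m \<le> \<delta>1" "m \<le> 1/4" "m \<le> \<delta>F" "m \<le> \<delta>e" using \<delta>1 \<delta>F \<delta>e by (auto simp: m_def)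
  have \<epsilon>: "0 < \<epsilon>" using m b by (simp add: \<epsilon>_def)
  have "\<epsilon> * (b + 1) = m / 2" using b by (simp add: \<epsilon>_def field_simps)
  then have \<epsilon>b: "\<epsilon> * b < m" "\<epsilon> < m"
    using m(1) \<epsilon> mult_nonneg_nonneg[of \<epsilon> b] b(1) unfolding distrib_left by linarith+
  have "\<epsilon> * norm e \<le> \<epsilon> * b" using b(2) \<epsilon> by simp
  then have \<epsilon>e: "\<epsilon> * norm e < m" using \<epsilon>b(1) by linarith
  define z1 where "z1 = z0 + \<epsilon> *\<^sub>R e"
  have "z1 \<in> \<Omega>" unfolding z1_def using \<epsilon> \<epsilon>b m \<delta>e z0 by (intro inw') auto
  have dz1: "dist z1 z0 < m" using \<epsilon>e \<epsilon> by (simp add: z1_def dist_norm)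
  have z1B: "z1 \<in> B" using \<open>z1 \<in> \<Omega>\<close> dz1 m closure_subset[of \<Omega>] by (auto simp: B_def dist_commute)
  define E where "E x y = (1/\<epsilon>) *\<^sub>R (x - y) - e" for x y
  \<comment> \<open>The penalty \<open>E\<close> vanishes at relative position
    \<open>\<epsilon> *\<^sub>R e\<close> instead of on the diagonal; the last term turns
    \<open>z0\<close> into a strict maximum so that the maximisers localise there.\<close>
  define \<Phi> where "\<Phi> p = v1 (fst p) - v2 (snd p) - E (fst p) (snd p) \<bullet> E (fst p) (snd p)
      - (snd p - z0) \<bullet> (snd p - z0)" for p
  have "continuous_on (B \<times> B) \<Phi>"
    unfolding \<Phi>_def E_def
    by (intro continuous_intros continuous_on_compose2[OF v1B] continuous_on_compose2[OF v2B]) auto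
  then obtain p where p: "p \<in> B \<times> B" "\<And>p'. p' \<in> B \<times> B \<Longrightarrow> \<Phi> p' \<le> \<Phi> p"
    using continuous_attains_sup[of "B \<times> B" \<Phi>] compact_Times[OF B(1) B(1)] z0B by blast
  define x y where "x = fst p" and "y = snd p"
  have xy: "x \<in> B" "y \<in> B" using p(1) by (auto simp: x_def y_def)
  have maxxy: "v1 x' - v2 y' - E x' y' \<bullet> E x' y' - (y' - z0) \<bullet> (y' - z0)
     \<le> v1 x - v2 y - E x y \<bullet> E x y - (y - z0) \<bullet> (y - z0)" if "x' \<in> B" "y' \<in> B" for x' y'
    using p(2)[of "(x', y')"] that by (simp add: \<Phi>_def x_def y_def)
  have E10: "E z1 z0 = 0" using \<epsilon> by (simp add: E_def z1_def)
  \<comment> \<open>Comparison of the maximum with the pair \<open>(z1, z0)\<close>, where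
    \<open>E\<close> is zero, followed by maximality of \<open>z0\<close> at the point
    \<open>y\<close>: the values of \<open>v2\<close> cancel and only the modulus of continuity of
    \<open>v1\<close> is left.\<close>
  have key: "(norm (E x y))\<^sup>2 + (norm (y - z0))\<^sup>2 \<le> (v1 x - v1 y) + (v1 z0 - v1 z1)"
    using maxxy[OF z1B z0B] max[of y] xy(2) B(2) E10
    by (auto simp: power2_norm_eq_inner)
  have "(norm (E x y))\<^sup>2 \<le> (2 * A + 1)\<^sup>2"
  proof -
    have "(norm (E x y))\<^sup>2 \<le> 4 * A"
      using key zero_le_power2[of "norm (y - z0)"] A(2)[OF xy(1)] A(2)[OF xy(2)] A(2)[OF z0B] A(2)[OF z1B] by linarith
    also have "\<dots> \<le> (2 * A + 1)\<^sup>2" using zero_le_power2[of A] by (simp add: power2_eq_square algebra_simps)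
    finally show ?thesis .
  qed
  then have "norm (E x y) \<le> 2 * A + 1" using A(1) by (simp add: power2_le_iff_abs_le)
  then have Eb: "norm (E x y + e) \<le> b" using norm_triangle_ineq[of "E x y" e] by (simp add: b_def)
  have xyE: "x = y + \<epsilon> *\<^sub>R (E x y + e)" using \<epsilon> by (simp add: E_def)
  have "x - y = \<epsilon> *\<^sub>R (E x y + e)" using \<epsilon> by (simp add: E_def)
  then have "dist x y = \<epsilon> * norm (E x y + e)" using \<epsilon> by (simp only: dist_norm norm_scaleR abs_of_pos)
  moreover have "\<epsilon> * norm (E x y + e) \<le> \<epsilon> * b" using Eb \<epsilon> by simp
  ultimately have dxy: "dist x y < m" using \<epsilon>b(1) by linarith
  have "(norm (E x y))\<^sup>2 + (norm (y - z0))\<^sup>2 < \<tau>\<^sup>2"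
  proof -
    have "\<bar>v1 x - v1 y\<bar> < \<tau>\<^sup>2 / 2" using \<delta>1(2)[OF xy] dxy m by linarith
    moreover have "\<bar>v1 z1 - v1 z0\<bar> < \<tau>\<^sup>2 / 2" using \<delta>1(2)[OF z1B z0B] dz1 m by linarith
    ultimately show ?thesis using key by linarith
  qed
  then have "(norm (E x y))\<^sup>2 < \<tau>\<^sup>2" "(norm (y - z0))\<^sup>2 < \<tau>\<^sup>2"
    using zero_le_power2[of "norm (y - z0)"] zero_le_power2[of "norm (E x y)"] by linarith+
  then have small: "norm (E x y) < \<tau>" "norm (y - z0) < \<tau>"
    using \<tau>(1) by (auto intro: power_less_imp_less_base[of _ 2])
  \<comment> \<open>Smallness of \<open>E x y\<close> places \<open>E x y + e\<close> in the ball of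
    inward directions, hence \<open>x\<close> in the open set.\<close>
  have "y + \<epsilon> *\<^sub>R (E x y + e) \<in> \<Omega>"
    by (rule inw')
       (use small \<tau> \<epsilon> \<epsilon>b m xy(2) B(2) in \<open>auto simp: dist_norm norm_minus_commute\<close>)
  then have "x \<in> \<Omega>" by (simp only: xyE[symmetric])
  have nearx: "dist x z0 < 1" and neary: "dist y z0 < 1"
    using dxy small(2) m(3) \<tau>(3) dist_triangle[of x z0 y] by (auto simp: dist_norm)
  define \<phi>1 where "\<phi>1 w = E w y \<bullet> E w y" for w
  define g1 where "g1 w = (2/\<epsilon>) *\<^sub>R E w y" for w
  define \<phi>2 where "\<phi>2 w = - (E x w \<bullet> E x w) - (w - z0) \<bullet> (w - z0)" for w
  define g2 where "g2 w = (2/\<epsilon>) *\<^sub>R E x w - 2 *\<^sub>R (w - z0)" for w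
  have C1: "C1_with_gradient \<phi>1 g1" unfolding C1_with_gradient_def
  proof (intro conjI allI)
    show "continuous_on UNIV g1" unfolding g1_def E_def by (intro continuous_intros)
    fix w
    have "((\<lambda>w. E w y) has_derivative (\<lambda>h. (1/\<epsilon>) *\<^sub>R h)) (at w)"
      unfolding E_def by (auto intro!: derivative_eq_intros)
    then have "(\<phi>1 has_derivative (\<lambda>h. E w y \<bullet> ((1/\<epsilon>) *\<^sub>R h) + ((1/\<epsilon>) *\<^sub>R h) \<bullet> E w y)) (at w)"
      unfolding \<phi>1_def by (intro has_derivative_inner)
    then show "(\<phi>1 has_derivative (\<bullet>) (g1 w)) (at w)"
      by (rule has_derivative_eq_rhs) (auto simp: fun_eq_iff g1_def inner_commute)
  qed
  have C2: "C1_with_gradient \<phi>2 g2" unfolding C1_with_gradient_def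
  proof (intro conjI allI)
    show "continuous_on UNIV g2" unfolding g2_def E_def by (intro continuous_intros)
    fix w
    have 1: "((\<lambda>w. E x w) has_derivative (\<lambda>h. - (1/\<epsilon>) *\<^sub>R h)) (at w)"
      unfolding E_def by (auto intro!: derivative_eq_intros simp: algebra_simps)
    have 2: "((\<lambda>w. w - z0) has_derivative (\<lambda>h. h)) (at w)" by (auto intro!: derivative_eq_intros)
    have "(\<phi>2 has_derivative (\<lambda>h. - (E x w \<bullet> (- (1/\<epsilon>) *\<^sub>R h) + (- (1/\<epsilon>) *\<^sub>R h) \<bullet> E x w)
       - ((w - z0) \<bullet> h + h \<bullet> (w - z0)))) (at w)"
      unfolding \<phi>2_def by (intro has_derivative_inner has_derivative_diff has_derivative_minus 1 2)
    then show "(\<phi>2 has_derivative (\<bullet>) (g2 w)) (at w)"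
      by (rule has_derivative_eq_rhs) (auto simp: fun_eq_iff g2_def inner_commute inner_diff_left inner_diff_right algebra_simps)
  qed
  have "local_max_rel \<Omega> (\<lambda>w. v1 w - \<phi>1 w) x"
  proof (rule interior_local_max[of "\<Omega> \<inter> ball z0 1"])
    fix w assume "w \<in> \<Omega> \<inter> ball z0 1"
    then have "w \<in> B" using closure_subset by (auto simp: B_def dist_commute)
    from maxxy[OF this xy(2)] show "v1 w - \<phi>1 w \<le> v1 x - \<phi>1 x" by (simp add: \<phi>1_def)
  qed (use \<Omega> \<open>x \<in> \<Omega>\<close> nearx in \<open>auto simp: dist_commute\<close>)
  with sub C1 have Fx: "F x (g1 x) \<le> c1" unfolding visc_subsolution_def by blast
  have "local_min_rel (closure \<Omega>) (\<lambda>w. v2 w - \<phi>2 w) y"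
  proof (rule interior_local_min_rel[of "ball z0 1"])
    fix w assume "w \<in> ball z0 1 \<inter> closure \<Omega>"
    then have "w \<in> B" by (auto simp: B_def dist_commute)
    from maxxy[OF xy(1) this] show "v2 y - \<phi>2 y \<le> v2 w - \<phi>2 w" by (simp add: \<phi>2_def)
  qed (use neary xy(2) B(2) in \<open>auto simp: dist_commute\<close>)
  with super C2 have Fy: "c2 \<le> F y (g2 y)" unfolding visc_supersolution_def by blast
  \<comment> \<open>The factor \<open>1 / \<epsilon>\<close> in the gradients is harmless: the
    subsolution inequality with coercivity bounds \<open>g1 x\<close> by \<open>L\<close>, and
    \<open>g2 y\<close> differs from it by a small vector.\<close>
  have gL: "norm (g1 x) \<le> L" using L[OF Fx] .
  have gg: "dist (g1 x) (g2 y) = 2 * norm (y - z0)" by (simp add: g1_def g2_def dist_norm)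
  have "norm (g2 y) \<le> L + 1"
    using gL gg small(2) \<tau>(3) norm_triangle_ineq2[of "g2 y" "g1 x"] by (simp add: dist_norm norm_minus_commute)
  then have "\<bar>F x (g1 x) - F y (g2 y)\<bar> < \<kappa>"
    using nearx neary gL gg small(2) \<tau>(4) dxy m(4) by (intro \<delta>F(2)) (auto simp: dist_commute)
  with Fx Fy show "c2 \<le> c1 + \<kappa>" by simp
qed

end

section \<open>Periodicity and Lipschitz bounds up to the boundary\<close>

lemma int_lattice_0 [simp]: "0 \<in> int_lattice"
  and int_lattice_diff: "m \<in> int_lattice \<Longrightarrow> k \<in> int_lattice \<Longrightarrow> m - k \<in> int_lattice"
  and int_lattice_minus: "m \<in> int_lattice \<Longrightarrow> - m \<in> int_lattice"
  by (auto simp: int_lattice_def)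

abbreviation unit_cell :: "(real^'n) set"
  where "unit_cell \<equiv> cbox (\<chi> i. - 1 / 2) (\<chi> i. 1 / 2)"

abbreviation open_cell :: "(real^'n) set"
  where "open_cell \<equiv> box (\<chi> i. - 1 / 2) (\<chi> i. 1 / 2)"

definition cell_rep :: "real^'n \<Rightarrow> real^'n"
  where "cell_rep y = (\<chi> i. y $ i - of_int \<lfloor>y $ i + 1 / 2\<rfloor>)"

lemma cell_rep_bounds: "- 1 / 2 \<le> cell_rep y $ i" "cell_rep y $ i < 1 / 2"
  unfolding cell_rep_def by (simp_all, linarith+)

lemma cell_rep_in_cell: "cell_rep y \<in> unit_cell"
  using cell_rep_bounds[of y] less_imp_le by (auto simp: mem_box_cart)

lemma cell_rep_lattice: "y - cell_rep y \<in> int_lattice"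
  unfolding cell_rep_def int_lattice_def by simp

lemma cell_rep_add:
  assumes "m \<in> int_lattice"
  shows "cell_rep (y + m) = cell_rep y"
proof -
  have "(y + m) $ i - of_int \<lfloor>(y + m) $ i + 1 / 2\<rfloor> = y $ i - of_int \<lfloor>y $ i + 1 / 2\<rfloor>" for i
  proof -
    obtain k where "m $ i = of_int k" using assms unfolding int_lattice_def by (auto elim: Ints_cases)
    moreover have "\<lfloor>y $ i + of_int k + 1 / 2\<rfloor> = \<lfloor>y $ i + 1 / 2\<rfloor> + k"
      by (metis add.assoc add.commute floor_add_int)
    ultimately show ?thesis by simp
  qed
  then show ?thesis unfolding cell_rep_def by (simp only:)
qed

lemma cell_rep_box:
  assumes "z \<in> open_cell"
  shows "cell_rep z = z"
proof -
  have "\<lfloor>z $ i + 1 / 2\<rfloor> = 0" for i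
    using assms by (auto simp: mem_box_cart floor_eq_iff field_simps dest!: spec[of _ i])
  then show ?thesis by (simp add: cell_rep_def vec_eq_iff)
qed

lemma ball_half_subset_box: "ball 0 (1/2) \<subseteq> open_cell"
proof
  fix z :: "real^'n" assume "z \<in> ball 0 (1/2)"
  then have "norm z < 1 / 2" by simp
  then have "- 1 / 2 < z $ i" "z $ i < 1 / 2" for i using component_le_norm_cart[of z i] by linarith+
  then show "z \<in> open_cell" by (simp add: mem_box_cart)
qed

lemma cell_rep_eq:
  assumes "m \<in> int_lattice" "y - m \<in> open_cell"
  shows "cell_rep y = y - m"
  using cell_rep_add[OF assms(1), of "y - m"] cell_rep_box[OF assms(2)] by simp

text \<open>\<open>cell_rep\<close> jumps across the faces of cells; over an open subset of the open
  cell it is locally a fixed lattice translation, so functions given on one cell can be tested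
  locally.\<close>

lemma cell_rep_local:
  assumes "cell_rep y0 \<in> U" "open U" "U \<subseteq> open_cell"
  obtains d where "d > 0" "\<And>y. y \<in> ball y0 d \<Longrightarrow> cell_rep y = y - (y0 - cell_rep y0)"
    "\<And>y. y \<in> ball y0 d \<Longrightarrow> cell_rep y \<in> U"
proof -
  obtain d where d: "d > 0" "ball (cell_rep y0) d \<subseteq> U"
    using assms open_contains_ball by blast
  have *: "y - (y0 - cell_rep y0) \<in> U" if "y \<in> ball y0 d" for y
    using that d(2) by (auto simp: dist_norm algebra_simps intro!: subsetD[OF d(2)])
  have "cell_rep y = y - (y0 - cell_rep y0)" if "y \<in> ball y0 d" for y
    using *[OF that] assms(3) by (intro cell_rep_eq cell_rep_lattice) auto
  with * d(1) that show ?thesis by metis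
qed

text \<open>Both points are lifted along \<open>e\<close> by a height \<open>s\<close> proportional
  to their distance \<open>d\<close>, and the lifted points are joined directly. With
  \<open>s = 2 * d / \<delta>\<close> the directions from \<open>y\<close> to the joining segment
  deviate from \<open>e\<close> by at most \<open>\<delta> / 2\<close>, so it stays in the cone at
  \<open>y\<close>; the two lifts contribute \<open>4 * norm e / \<delta>\<close> to
  \<open>C\<close>.\<close>

lemma inward_path:
  fixes \<Omega> :: "'a::euclidean_space set"
  assumes "inward \<Omega> z e \<delta>"
  obtains r C where "r > 0" "C \<ge> 0"
    "\<And>y y'. \<lbrakk>y \<in> \<Omega> \<inter> ball z r; y' \<in> \<Omega> \<inter> ball z r\<rbrakk> \<Longrightarrow>
      \<exists>a b. closed_segment y a \<subseteq> \<Omega> \<and> closed_segment a b \<subseteq> \<Omega> \<and> closed_segment b y' \<subseteq> \<Omega> \<and>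
        dist y a + dist a b + dist b y' \<le> C * dist y y'"
proof -
  have \<delta>: "\<delta> > 0" and inw: "\<And>y e' s. \<lbrakk>y \<in> \<Omega>; y \<in> ball z \<delta>; e' \<in> ball e \<delta>; 0 < s; s < \<delta>\<rbrakk> \<Longrightarrow> y + s *\<^sub>R e' \<in> \<Omega>"
    using assms closure_subset[of \<Omega>] unfolding inward_def by (auto simp: subset_iff)
  define r where "r = min \<delta> (\<delta>\<^sup>2 / 8)"
  define C where "C = 4 * norm e / \<delta> + 1"
  have r: "r > 0" "r \<le> \<delta>" "r \<le> \<delta>\<^sup>2 / 8" using \<delta> by (auto simp: r_def)
  show ?thesis
  proof (rule that[of r C])
    show "r > 0" "C \<ge> 0" using r \<delta> by (auto simp: C_def)
    fix y y' assume y: "y \<in> \<Omega> \<inter> ball z r" and y': "y' \<in> \<Omega> \<inter> ball z r"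
    define d where "d = dist y y'"
    show "\<exists>a b. closed_segment y a \<subseteq> \<Omega> \<and> closed_segment a b \<subseteq> \<Omega> \<and> closed_segment b y' \<subseteq> \<Omega> \<and>
        dist y a + dist a b + dist b y' \<le> C * dist y y'"
    proof (cases "y = y'")
      case True
      then show ?thesis using y by (intro exI[of _ y]) auto
    next
      case False
      then have d: "d > 0" by (simp add: d_def)
      define s where "s = 2 * d / \<delta>"
      have "d < 2 * r" using y y' dist_triangle2[of y y' z] by (auto simp: d_def dist_commute)
      then have "d < \<delta>\<^sup>2 / 4" using r(3) by simp
      then have s: "0 < s" "s < \<delta>" using d \<delta> by (simp_all add: s_def pos_divide_less_eq power2_eq_square)
      have up: "closed_segment w (w + s *\<^sub>R e) \<subseteq> \<Omega>" if w: "w \<in> \<Omega> \<inter> ball z r" for w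
      proof
        fix x assume "x \<in> closed_segment w (w + s *\<^sub>R e)"
        then obtain t where t: "0 \<le> t" "t \<le> 1" "x = (1 - t) *\<^sub>R w + t *\<^sub>R (w + s *\<^sub>R e)"
          unfolding in_segment by blast
        then have x: "x = w + (t * s) *\<^sub>R e" by (simp add: algebra_simps)
        show "x \<in> \<Omega>"
        proof (cases "t = 0")
          case True
          then show ?thesis using x w by simp
        next
          case False
          have "t * s \<le> 1 * s" using t s by (intro mult_right_mono) auto
          with s have "t * s < \<delta>" by linarith
          then show ?thesis unfolding x using w r \<delta> s t False by (intro inw) auto
        qed
      qed
      have across: "closed_segment (y + s *\<^sub>R e) (y' + s *\<^sub>R e) \<subseteq> \<Omega>"
      proof
        fix x assume "x \<in> closed_segment (y + s *\<^sub>R e) (y' + s *\<^sub>R e)"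
        then obtain t where t: "0 \<le> t" "t \<le> 1" "x = (1 - t) *\<^sub>R (y + s *\<^sub>R e) + t *\<^sub>R (y' + s *\<^sub>R e)"
          unfolding in_segment by blast
        define e' where "e' = e + (t / s) *\<^sub>R (y' - y)"
        have x: "x = y + s *\<^sub>R e'" using t s by (simp add: e'_def algebra_simps)
        have "dist e e' = t / s * d" using t s by (simp add: e'_def d_def dist_norm norm_minus_commute)
        also have "\<dots> \<le> 1 / s * d" using t s d by (intro mult_right_mono divide_right_mono) auto
        also have "\<dots> = \<delta> / 2" using d \<delta> by (simp add: s_def)
        finally have "e' \<in> ball e \<delta>" using \<delta> by simp
        then show "x \<in> \<Omega>" unfolding x using y r s by (intro inw) auto
      qed
      have "dist y (y + s *\<^sub>R e) + dist (y + s *\<^sub>R e) (y' + s *\<^sub>R e) + dist (y' + s *\<^sub>R e) y' = s * norm e + d + s * norm e"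
        using s by (simp add: d_def dist_norm)
      also have "\<dots> = C * d" using \<delta> by (simp add: s_def C_def ring_distribs)
      finally show ?thesis using up[OF y] up[OF y'] across
        by (intro exI[of _ "y + s *\<^sub>R e"] exI[of _ "y' + s *\<^sub>R e"]) (auto simp: d_def closed_segment_commute)
    qed
  qed
qed

lemma inward_lip:
  fixes \<Omega> :: "'a::euclidean_space set"
  assumes "inward \<Omega> z e \<delta>"
  obtains r C where "r > 0" "C \<ge> 0"
    "\<And>L u y y'. \<lbrakk>L \<ge> 0; seg_lip L \<Omega> u; y \<in> \<Omega> \<inter> ball z r; y' \<in> \<Omega> \<inter> ball z r\<rbrakk> \<Longrightarrow>
      \<bar>u y - u y'\<bar> \<le> L * (C * dist y y')"
proof -
  obtain r C where rC: "r > 0" "C \<ge> 0"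
    "\<And>y y'. \<lbrakk>y \<in> \<Omega> \<inter> ball z r; y' \<in> \<Omega> \<inter> ball z r\<rbrakk> \<Longrightarrow>
      \<exists>a b. closed_segment y a \<subseteq> \<Omega> \<and> closed_segment a b \<subseteq> \<Omega> \<and> closed_segment b y' \<subseteq> \<Omega> \<and>
        dist y a + dist a b + dist b y' \<le> C * dist y y'"
    using inward_path[OF assms] by blast
  show ?thesis
  proof (rule that[OF rC(1,2)])
    fix L :: real and u y y' assume L: "L \<ge> 0" "seg_lip L \<Omega> u" and y: "y \<in> \<Omega> \<inter> ball z r" "y' \<in> \<Omega> \<inter> ball z r"
    then obtain a b where ab: "closed_segment y a \<subseteq> \<Omega>" "closed_segment a b \<subseteq> \<Omega>" "closed_segment b y' \<subseteq> \<Omega>"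
        "dist y a + dist a b + dist b y' \<le> C * dist y y'"
      using rC(3) by blast
    have "\<bar>u y - u y'\<bar> \<le> \<bar>u y - u a\<bar> + \<bar>u a - u b\<bar> + \<bar>u b - u y'\<bar>" by linarith
    also have "\<dots> \<le> L * dist y a + L * dist a b + L * dist b y'"
      using L(2) ab(1-3) unfolding seg_lip_def by (intro add_mono) blast+
    also have "\<dots> = L * (dist y a + dist a b + dist b y')" by (simp add: algebra_simps)
    also have "\<dots> \<le> L * (C * dist y y')" using ab(4) L(1) by (rule mult_left_mono)
    finally show "\<bar>u y - u y'\<bar> \<le> L * (C * dist y y')" .
  qed
qed

text \<open>Having a difference bounded uniformly over the family is an equivalence relation on
  \<open>\<Omega>\<close> with open classes, hence has one class by connectedness; a finite cover of
  \<open>K\<close> makes the bound uniform. The local hypothesis is also placed on \<open>K\<close>,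
  which may contain boundary points of \<open>\<Omega>\<close>.\<close>

lemma osc_bound:
  fixes \<Omega> :: "'a::metric_space set" and \<F> :: "('a \<Rightarrow> real) set"
  assumes \<Omega>: "connected \<Omega>" and K: "compact K"
    and loc: "\<And>z. z \<in> \<Omega> \<union> K \<Longrightarrow> \<exists>r>0. \<exists>M. \<forall>f\<in>\<F>. \<forall>y\<in>\<Omega> \<inter> ball z r. \<forall>y'\<in>\<Omega> \<inter> ball z r. \<bar>f y - f y'\<bar> \<le> M"
  obtains M where "\<And>f y y'. \<lbrakk>f \<in> \<F>; y \<in> \<Omega> \<inter> K; y' \<in> \<Omega> \<inter> K\<rbrakk> \<Longrightarrow> \<bar>f y - f y'\<bar> \<le> M"
proof (cases "\<Omega> = {}")
  case True
  then show ?thesis using that by blast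
next
  case False
  then obtain a where a: "a \<in> \<Omega>" by blast
  have conn: "\<exists>M. \<forall>f\<in>\<F>. \<bar>f a - f b\<bar> \<le> M" if "b \<in> \<Omega>" for b
  proof (rule connected_equivalence_relation[OF \<Omega> a that, where R = "\<lambda>a b. \<exists>M. \<forall>f\<in>\<F>. \<bar>f a - f b\<bar> \<le> M"])
    fix x y z
    show "\<exists>M. \<forall>f\<in>\<F>. \<bar>f y - f x\<bar> \<le> M" if "\<exists>M. \<forall>f\<in>\<F>. \<bar>f x - f y\<bar> \<le> M"
      using that by (simp add: abs_minus_commute)
    show "\<exists>M. \<forall>f\<in>\<F>. \<bar>f x - f z\<bar> \<le> M" if xy: "\<exists>M. \<forall>f\<in>\<F>. \<bar>f x - f y\<bar> \<le> M" and yz: "\<exists>M. \<forall>f\<in>\<F>. \<bar>f y - f z\<bar> \<le> M"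
    proof -
      obtain M N where "\<forall>f\<in>\<F>. \<bar>f x - f y\<bar> \<le> M" "\<forall>f\<in>\<F>. \<bar>f y - f z\<bar> \<le> N" using xy yz by blast
      then have "\<forall>f\<in>\<F>. \<bar>f x - f z\<bar> \<le> M + N" by fastforce
      then show ?thesis ..
    qed
  next
    fix x assume x: "x \<in> \<Omega>"
    then obtain r M where rM: "r > 0" "\<forall>f\<in>\<F>. \<forall>y\<in>\<Omega> \<inter> ball x r. \<forall>y'\<in>\<Omega> \<inter> ball x r. \<bar>f y - f y'\<bar> \<le> M"
      using loc by blast
    show "\<exists>T. openin (top_of_set \<Omega>) T \<and> x \<in> T \<and> (\<forall>y\<in>T. \<exists>M. \<forall>f\<in>\<F>. \<bar>f x - f y\<bar> \<le> M)"
    proof (intro exI[of _ "\<Omega> \<inter> ball x r"] conjI ballI)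
      show "\<exists>M. \<forall>f\<in>\<F>. \<bar>f x - f y\<bar> \<le> M" if "y \<in> \<Omega> \<inter> ball x r" for y
        using rM x that by (intro exI[of _ M]) auto
    qed (use x rM in auto)
  qed
  have "\<exists>r>0. \<exists>M. \<forall>f\<in>\<F>. \<forall>y\<in>\<Omega> \<inter> ball z r. \<bar>f a - f y\<bar> \<le> M" if "z \<in> K" for z
  proof -
    obtain r M where rM: "r > 0" "\<forall>f\<in>\<F>. \<forall>y\<in>\<Omega> \<inter> ball z r. \<forall>y'\<in>\<Omega> \<inter> ball z r. \<bar>f y - f y'\<bar> \<le> M"
      using loc[of z] \<open>z \<in> K\<close> by blast
    show ?thesis
    proof (cases "\<Omega> \<inter> ball z r = {}")
      case True
      with rM(1) show ?thesis by blast
    next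
      case False
      then obtain b where b: "b \<in> \<Omega> \<inter> ball z r" by blast
      then obtain N where N: "\<forall>f\<in>\<F>. \<bar>f a - f b\<bar> \<le> N" using conn by blast
      have "\<forall>f\<in>\<F>. \<forall>y\<in>\<Omega> \<inter> ball z r. \<bar>f a - f y\<bar> \<le> N + M"
      proof (intro ballI)
        fix f y assume "f \<in> \<F>" "y \<in> \<Omega> \<inter> ball z r"
        then have "\<bar>f a - f b\<bar> \<le> N" "\<bar>f b - f y\<bar> \<le> M" using N rM(2) b by blast+
        then show "\<bar>f a - f y\<bar> \<le> N + M" by linarith
      qed
      with rM(1) show ?thesis by blast
    qed
  qed
  then obtain r M where rM: "\<And>z. z \<in> K \<Longrightarrow> r z > 0"
    "\<And>z f y. \<lbrakk>z \<in> K; f \<in> \<F>; y \<in> \<Omega> \<inter> ball z (r z)\<rbrakk> \<Longrightarrow> \<bar>f a - f y\<bar> \<le> M z"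
    by metis
  have "K \<subseteq> (\<Union>z\<in>K. ball z (r z))" using rM(1) by force
  then obtain C where C: "C \<subseteq> K" "finite C" "K \<subseteq> (\<Union>z\<in>C. ball z (r z))"
    using compactE_image[OF K, of K "\<lambda>z. ball z (r z)"] by auto
  have "\<bar>f a - f y\<bar> \<le> (\<Sum>z\<in>C. \<bar>M z\<bar>)" if fy: "f \<in> \<F>" "y \<in> \<Omega> \<inter> K" for f y
  proof -
    obtain z where z: "z \<in> C" "y \<in> ball z (r z)" using C(3) fy by blast
    then have "\<bar>f a - f y\<bar> \<le> M z" using C(1) fy by (intro rM) auto
    also have "\<dots> \<le> \<bar>M z\<bar>" by simp
    also have "\<dots> \<le> (\<Sum>z\<in>C. \<bar>M z\<bar>)" using C(2) z(1) by (intro member_le_sum) auto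
    finally show ?thesis .
  qed
  then have "\<bar>f y - f y'\<bar> \<le> 2 * (\<Sum>z\<in>C. \<bar>M z\<bar>)" if "f \<in> \<F>" "y \<in> \<Omega> \<inter> K" "y' \<in> \<Omega> \<inter> K" for f y y'
    using that by (smt (verit, best))
  then show ?thesis using that by blast
qed

lemma local_lip_continuous_on:
  fixes f :: "'a::metric_space \<Rightarrow> real"
  assumes "\<And>z. z \<in> S \<Longrightarrow> \<exists>r>0. \<exists>C. \<forall>y\<in>S \<inter> ball z r. \<forall>y'\<in>S \<inter> ball z r. \<bar>f y - f y'\<bar> \<le> C * dist y y'"
  shows "continuous_on S f"
  unfolding continuous_on_def
proof
  fix z assume z: "z \<in> S"
  then obtain r C where rC: "r > 0" "\<And>y y'. y \<in> S \<inter> ball z r \<Longrightarrow> y' \<in> S \<inter> ball z r \<Longrightarrow> \<bar>f y - f y'\<bar> \<le> C * dist y y'"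
    using assms by blast
  have "((\<lambda>y. C * dist y z) \<longlongrightarrow> C * dist z z) (at z within S)"
    by (intro tendsto_intros)
  then have "((\<lambda>y. C * dist y z) \<longlongrightarrow> 0) (at z within S)" by simp
  moreover have "\<forall>\<^sub>F y in at z within S. norm (f y - f z) \<le> C * dist y z"
    unfolding eventually_at using rC(1) z
    by (intro exI[of _ r]) (auto simp: dist_commute intro!: rC(2)[of _ z, simplified dist_commute])
  ultimately have "((\<lambda>y. f y - f z) \<longlongrightarrow> 0) (at z within S)"
    by (rule Lim_null_comparison[rotated])
  then show "(f \<longlongrightarrow> f z) (at z within S)" using LIM_zero_iff by blast
qed

lemma closure_pair_bound:
  fixes f :: "'a::euclidean_space \<Rightarrow> real"
  assumes f: "continuous_on (closure \<Omega>) f" and U: "open U"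
    and bd: "\<And>y y'. \<lbrakk>y \<in> \<Omega> \<inter> U; y' \<in> \<Omega> \<inter> U\<rbrakk> \<Longrightarrow> \<bar>f y - f y'\<bar> \<le> M + C * dist y y'"
    and y: "y \<in> closure \<Omega> \<inter> U" "y' \<in> closure \<Omega> \<inter> U"
  shows "\<bar>f y - f y'\<bar> \<le> M + C * dist y y'"
proof -
  have "closure \<Omega> \<inter> U \<subseteq> closure (\<Omega> \<inter> U)"
    using open_Int_closure_subset[OF U, of \<Omega>] by (simp add: Int_commute)
  with y have "y \<in> closure (\<Omega> \<inter> U)" "y' \<in> closure (\<Omega> \<inter> U)" by blast+
  then obtain a b where a: "\<And>n. a n \<in> \<Omega> \<inter> U" "a \<longlonglongrightarrow> y" and b: "\<And>n. b n \<in> \<Omega> \<inter> U" "b \<longlonglongrightarrow> y'"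
    unfolding closure_sequential by blast
  have fa: "(\<lambda>n. f (a n)) \<longlonglongrightarrow> f y" and fb: "(\<lambda>n. f (b n)) \<longlonglongrightarrow> f y'"
    using continuous_on_tendsto_compose[OF f a(2)] continuous_on_tendsto_compose[OF f b(2)] y a(1) b(1)
      closure_subset[of \<Omega>] by (auto intro!: always_eventually)
  show ?thesis
  proof (rule LIMSEQ_le)
    show "(\<lambda>n. \<bar>f (a n) - f (b n)\<bar>) \<longlonglongrightarrow> \<bar>f y - f y'\<bar>" by (intro tendsto_intros fa fb)
    show "(\<lambda>n. M + C * dist (a n) (b n)) \<longlonglongrightarrow> M + C * dist y y'" by (intro tendsto_intros a b)
    show "\<exists>N. \<forall>n\<ge>N. \<bar>f (a n) - f (b n)\<bar> \<le> M + C * dist (a n) (b n)" using bd a(1) b(1) by blast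
  qed
qed

lemma inward_open:
  fixes \<Omega> :: "'a::euclidean_space set"
  assumes "open \<Omega>" "z \<in> \<Omega>"
  obtains \<delta> where "inward \<Omega> z 0 \<delta>"
proof -
  obtain r where r: "r > 0" "ball z r \<subseteq> \<Omega>" using assms open_contains_ball by blast
  have "inward \<Omega> z 0 (min (r/2) 1)"
    unfolding inward_def
  proof (intro conjI ballI)
    fix y e' :: 'a and s :: real assume *: "y \<in> closure \<Omega> \<inter> ball z (min (r/2) 1)" "e' \<in> ball 0 (min (r/2) 1)" "s \<in> {0<..<min (r/2) 1}"
    have "norm (s *\<^sub>R e') \<le> 1 * norm e'" unfolding norm_scaleR using * by (intro mult_right_mono) auto
    then have "dist z (y + s *\<^sub>R e') < r" using * norm_triangle_ineq4[of "z - y" "s *\<^sub>R e'"]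
      by (auto simp: dist_norm algebra_simps)
    then show "y + s *\<^sub>R e' \<in> \<Omega>" using r(2) by auto
  qed (use r in auto)
  then show ?thesis by (rule that)
qed

text \<open>The constant depends on the domain, \<open>K\<close> and \<open>L\<close> only and not
  on \<open>u\<close>. This yields compactness in Perron's method and, for a fixed dilated cell, an
  oscillation bound common to all hole sizes.\<close>

lemma seg_lip_osc:
  fixes \<Omega> :: "'a::euclidean_space set"
  assumes \<Omega>: "open \<Omega>" "connected \<Omega>" and K: "compact K" and L: "L \<ge> 0"
    and inw: "\<And>z. z \<in> closure \<Omega> \<inter> K \<Longrightarrow> \<exists>e \<delta>. inward \<Omega> z e \<delta>"
  obtains M where "\<And>u y y'. \<lbrakk>seg_lip L \<Omega> u; y \<in> \<Omega> \<inter> K; y' \<in> \<Omega> \<inter> K\<rbrakk> \<Longrightarrow> \<bar>u y - u y'\<bar> \<le> M"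
proof -
  have "\<exists>r>0. \<exists>M. \<forall>f\<in>{u. seg_lip L \<Omega> u}. \<forall>y\<in>\<Omega> \<inter> ball z r. \<forall>y'\<in>\<Omega> \<inter> ball z r. \<bar>f y - f y'\<bar> \<le> M"
    if z: "z \<in> \<Omega> \<union> K" for z
  proof (cases "z \<in> closure \<Omega>")
    case True
    obtain e \<delta> where "inward \<Omega> z e \<delta>"
    proof (cases "z \<in> \<Omega>")
      case True
      with inward_open[OF \<Omega>(1)] that show ?thesis by blast
    next
      case False
      with z True inw that show ?thesis by blast
    qed
    then obtain r C where rC: "r > 0" "C \<ge> 0"
        "\<And>L u y y'. \<lbrakk>L \<ge> 0; seg_lip L \<Omega> u; y \<in> \<Omega> \<inter> ball z r; y' \<in> \<Omega> \<inter> ball z r\<rbrakk> \<Longrightarrow> \<bar>u y - u y'\<bar> \<le> L * (C * dist y y')"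
      using inward_lip by blast
    have "\<bar>u y - u y'\<bar> \<le> L * (C * (2 * r))"
      if u: "seg_lip L \<Omega> u" and y: "y \<in> \<Omega> \<inter> ball z r" "y' \<in> \<Omega> \<inter> ball z r" for u y y'
    proof -
      have "dist y y' \<le> 2 * r" using y dist_triangle2[of y y' z] by (auto simp: dist_commute)
      then have "L * (C * dist y y') \<le> L * (C * (2 * r))" using rC L by (intro mult_left_mono) auto
      with rC(3)[OF L u y] show ?thesis by linarith
    qed
    with rC(1) show ?thesis by blast
  next
    case False
    then obtain r where "r > 0" "ball z r \<inter> closure \<Omega> = {}"
      using open_contains_ball_eq[of "- closure \<Omega>" z] by (auto simp: open_Compl disjoint_eq_subset_Compl)
    then have "r > 0" "\<Omega> \<inter> ball z r = {}" using closure_subset[of \<Omega>] by blast+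
    then show ?thesis by blast
  qed
  from osc_bound[OF \<Omega>(2) K this] obtain M where "\<And>f y y'. \<lbrakk>f \<in> {u. seg_lip L \<Omega> u}; y \<in> \<Omega> \<inter> K; y' \<in> \<Omega> \<inter> K\<rbrakk> \<Longrightarrow> \<bar>f y - f y'\<bar> \<le> M"
    by blast
  then show ?thesis using that by blast
qed

section \<open>Locality of subsolutions, and suprema, infima and averages\<close>

lemma local_max_rel_open_iff:
  fixes S :: "'a::metric_space set" and f :: "'a \<Rightarrow> real"
  assumes "open S"
  shows "local_max_rel S f x \<longleftrightarrow> x \<in> S \<and> (\<exists>d>0. \<forall>y\<in>ball x d. f y \<le> f x)"
proof (cases "x \<in> S")
  case True
  have "(\<forall>\<^sub>F y in at x. f y \<le> f x) \<longleftrightarrow> (\<exists>d>0. \<forall>y\<in>ball x d. f y \<le> f x)"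
  proof
    assume "\<forall>\<^sub>F y in at x. f y \<le> f x"
    then obtain d where "d > 0" "\<And>y. y \<noteq> x \<Longrightarrow> dist y x < d \<Longrightarrow> f y \<le> f x"
      unfolding eventually_at by auto
    then have "f y \<le> f x" if "y \<in> ball x d" for y
      using that by (cases "y = x") (auto simp: dist_commute)
    with \<open>d > 0\<close> show "\<exists>d>0. \<forall>y\<in>ball x d. f y \<le> f x" by blast
  qed (auto simp: eventually_at dist_commute)
  then show ?thesis using True at_within_open[OF True assms] by (simp add: local_max_rel_def)
qed (simp add: local_max_rel_def)

lemma visc_subsolutionD:
  fixes S :: "'a::euclidean_space set"
  assumes "visc_subsolution F c S u" "open S" "C1_with_gradient \<phi> g" "x \<in> S" "d > 0"
    "\<And>y. y \<in> ball x d \<Longrightarrow> u y - \<phi> y \<le> u x - \<phi> x"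
  shows "F x (g x) \<le> c"
proof -
  have "local_max_rel S (\<lambda>y. u y - \<phi> y) x"
    unfolding local_max_rel_open_iff[OF assms(2)] using assms by blast
  with assms(1,3) show ?thesis unfolding visc_subsolution_def by blast
qed

lemma visc_subsolution_openI:
  fixes S :: "'a::euclidean_space set"
  assumes "open S"
    "\<And>\<phi> g x d. \<lbrakk>C1_with_gradient \<phi> g; x \<in> S; d > 0; ball x d \<subseteq> S;
        \<And>y. y \<in> ball x d \<Longrightarrow> u y - \<phi> y \<le> u x - \<phi> x\<rbrakk> \<Longrightarrow> F x (g x) \<le> c"
  shows "visc_subsolution F c S u"
  unfolding visc_subsolution_def local_max_rel_open_iff[OF assms(1)]
proof (intro allI impI, elim conjE exE)
  fix \<phi> g x d assume *: "C1_with_gradient \<phi> g" "x \<in> S" "0 < d" "\<forall>y\<in>ball x d. u y - \<phi> y \<le> u x - \<phi> x"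
  obtain r where "r > 0" "ball x r \<subseteq> S" using assms(1) *(2) open_contains_ball by blast
  with * show "F x (g x) \<le> c" by (intro assms(2)[of \<phi> g x "min d r"]) auto
qed

lemma visc_subsolution_mono:
  assumes "visc_subsolution F c S u" "c \<le> c'"
  shows "visc_subsolution F c' S u"
  unfolding visc_subsolution_def
proof (intro allI impI)
  fix \<phi> g y0 assume "C1_with_gradient \<phi> g" "local_max_rel S (\<lambda>y. u y - \<phi> y) y0"
  with assms(1) have "F y0 (g y0) \<le> c" unfolding visc_subsolution_def by blast
  with assms(2) show "F y0 (g y0) \<le> c'" by simp
qed

lemma visc_subsolution_open_subset:
  fixes S :: "'a::euclidean_space set"
  assumes "visc_subsolution F c S u" "open S" "open T" "T \<subseteq> S"
  shows "visc_subsolution F c T u"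
  using assms(4) by (intro visc_subsolution_openI[OF assms(3)] visc_subsolutionD[OF assms(1,2)]) auto

lemma visc_subsolution_Un:
  fixes S :: "'a::euclidean_space set"
  assumes "visc_subsolution F c S u" "visc_subsolution F c T u" "open S" "open T"
  shows "visc_subsolution F c (S \<union> T) u"
proof (rule visc_subsolution_openI)
  fix \<phi> g x d assume *: "C1_with_gradient \<phi> g" "x \<in> S \<union> T" "d > 0"
    "\<And>y. y \<in> ball x d \<Longrightarrow> u y - \<phi> y \<le> u x - \<phi> x"
  then show "F x (g x) \<le> c"
    using visc_subsolutionD[OF assms(1,3), of \<phi> g x d] visc_subsolutionD[OF assms(2,4), of \<phi> g x d] by auto
qed (use assms in auto)

lemma C1_translate:
  assumes "C1_with_gradient \<phi> g"
  shows "C1_with_gradient (\<lambda>x. \<phi> (x + m)) (\<lambda>x. g (x + m))"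
  unfolding C1_with_gradient_def
proof (intro conjI allI)
  fix x
  have "((\<lambda>x. x + m) has_derivative (\<lambda>h. h)) (at x)" by (auto intro!: derivative_eq_intros)
  moreover have "(\<phi> has_derivative (\<lambda>h. g (x + m) \<bullet> h)) (at (x + m))"
    using assms by (simp add: C1_with_gradient_def)
  ultimately show "((\<lambda>x. \<phi> (x + m)) has_derivative (\<lambda>h. g (x + m) \<bullet> h)) (at x)"
    by (rule has_derivative_compose)
next
  show "continuous_on UNIV (\<lambda>x. g (x + m))"
    using assms unfolding C1_with_gradient_def
    by (intro continuous_on_compose2[of UNIV g UNIV "\<lambda>x. x + m"] continuous_on_add continuous_on_id continuous_on_const) auto
qed

text \<open>The vector realising the support function in direction \<open>y - z\<close> depends on
  the two points only, so it serves all members of the family at once.\<close>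

lemma set_lip_SUP:
  fixes \<F> :: "('a::euclidean_space \<Rightarrow> real) set"
  assumes K: "compact K" and lip: "\<And>v. v \<in> \<F> \<Longrightarrow> set_lip K S v" and ne: "\<F> \<noteq> {}"
    and bdd: "\<And>y. y \<in> S \<Longrightarrow> bdd_above ((\<lambda>v. v y) ` \<F>)"
  shows "set_lip K S (\<lambda>y. SUP v\<in>\<F>. v y)"
  unfolding set_lip_def
proof (intro ballI)
  fix y z assume yz: "y \<in> S" "z \<in> S"
  have "K \<noteq> {}" using ne lip yz unfolding set_lip_def by fastforce
  then obtain q where q: "q \<in> K" "\<And>p. p \<in> K \<Longrightarrow> p \<bullet> (y - z) \<le> q \<bullet> (y - z)"
    using support_attained[OF K] by blast
  have "(SUP v\<in>\<F>. v y) \<le> (SUP v\<in>\<F>. v z) + q \<bullet> (y - z)"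
  proof (rule cSUP_least[OF ne])
    fix v assume v: "v \<in> \<F>"
    then obtain p where "p \<in> K" "v y - v z \<le> p \<bullet> (y - z)" using lip yz unfolding set_lip_def by blast
    with q(2) have "v y \<le> v z + q \<bullet> (y - z)" by fastforce
    moreover have "v z \<le> (SUP v\<in>\<F>. v z)" using cSUP_upper[OF v bdd[OF yz(2)]] .
    ultimately show "v y \<le> (SUP v\<in>\<F>. v z) + q \<bullet> (y - z)" by linarith
  qed
  with q(1) show "\<exists>q\<in>K. (SUP v\<in>\<F>. v y) - (SUP v\<in>\<F>. v z) \<le> q \<bullet> (y - z)" by (intro bexI[of _ q]) auto
qed

lemma set_lip_INF:
  fixes V :: "'b \<Rightarrow> 'a::euclidean_space \<Rightarrow> real"
  assumes K: "compact K" and lip: "\<And>i. i \<in> I \<Longrightarrow> set_lip K S (V i)" and ne: "I \<noteq> {}"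
    and bdd: "\<And>y. y \<in> S \<Longrightarrow> bdd_below ((\<lambda>i. V i y) ` I)"
  shows "set_lip K S (\<lambda>y. INF i\<in>I. V i y)"
  unfolding set_lip_def
proof (intro ballI)
  fix y z assume yz: "y \<in> S" "z \<in> S"
  have "K \<noteq> {}" using ne lip yz unfolding set_lip_def by fastforce
  then obtain q where q: "q \<in> K" "\<And>p. p \<in> K \<Longrightarrow> p \<bullet> (y - z) \<le> q \<bullet> (y - z)"
    using support_attained[OF K] by blast
  have "(INF i\<in>I. V i y) - q \<bullet> (y - z) \<le> (INF i\<in>I. V i z)"
  proof (rule cINF_greatest[OF ne])
    fix i assume v: "i \<in> I"
    then obtain p where "p \<in> K" "V i y - V i z \<le> p \<bullet> (y - z)" using lip yz unfolding set_lip_def by blast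
    with q(2) have "V i y \<le> V i z + q \<bullet> (y - z)" by fastforce
    moreover have "(INF i\<in>I. V i y) \<le> V i y" using cINF_lower[OF bdd[OF yz(1)] v] .
    ultimately show "(INF i\<in>I. V i y) - q \<bullet> (y - z) \<le> V i z" by linarith
  qed
  with q(1) show "\<exists>q\<in>K. (INF i\<in>I. V i y) - (INF i\<in>I. V i z) \<le> q \<bullet> (y - z)" by (intro bexI[of _ q]) auto
qed

lemma (in coercive_hamiltonian) F_convex2:
  fixes s t :: real
  assumes "0 \<le> s" "0 \<le> t" "s + t = 1"
  shows "F y (s *\<^sub>R a + t *\<^sub>R b) \<le> s * F y a + t * F y b"
  using F_convex[of y] assms unfolding convex_on_def by blast

text \<open>Increments of the average are controlled by \<open>(A + B) / 2\<close>, on which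
  convexity averages the levels. Averaging a subsolution with a strict one thus stays strict, the
  mechanism behind the existence proof. The vector \<open>q0\<close> makes all sublevel sets
  involved nonempty.\<close>

lemma (in coercive_hamiltonian) visc_sub_average:
  assumes S: "open S" and u: "continuous_on S u" "visc_subsolution F \<alpha> S u"
    and v: "continuous_on S v" "visc_subsolution F \<beta> S v"
    and q0: "\<And>x. F x q0 \<le> \<alpha>" "\<And>x. F x q0 \<le> \<beta>"
  shows "visc_subsolution F ((\<alpha> + \<beta>) / 2) S (\<lambda>y. (u y + v y) / 2)"
proof (rule visc_subI[OF S])
  fix x0 c' assume x0: "x0 \<in> S" and c': "(\<alpha> + \<beta>) / 2 < c'"
  define \<epsilon> where "\<epsilon> = c' - (\<alpha> + \<beta>) / 2"
  have \<epsilon>: "\<epsilon> > 0" using c' by (simp add: \<epsilon>_def)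
  define A where "A = {q. F x0 q \<le> \<alpha> + \<epsilon>}"
  define B where "B = {q. F x0 q \<le> \<beta> + \<epsilon>}"
  obtain r0 where r0: "r0 > 0" "ball x0 r0 \<subseteq> S" using S x0 open_contains_ball by blast
  obtain r1 where r1: "r1 > 0"
    "\<And>T w. \<lbrakk>open T; convex T; T \<subseteq> ball x0 r1; continuous_on T w; visc_subsolution F \<alpha> T w\<rbrakk> \<Longrightarrow> set_lip A T w"
    using visc_sub_set_lip_local[of \<alpha> "\<alpha> + \<epsilon>" x0 q0] \<epsilon> q0(1)[of x0] unfolding A_def by (auto intro: order_trans)
  obtain r2 where r2: "r2 > 0"
    "\<And>T w. \<lbrakk>open T; convex T; T \<subseteq> ball x0 r2; continuous_on T w; visc_subsolution F \<beta> T w\<rbrakk> \<Longrightarrow> set_lip B T w"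
    using visc_sub_set_lip_local[of \<beta> "\<beta> + \<epsilon>" x0 q0] \<epsilon> q0(2)[of x0] unfolding B_def by (auto intro: order_trans)
  define r where "r = min r0 (min r1 r2)"
  have r: "r > 0" "ball x0 r \<subseteq> S" using r0 r1 r2 by (auto simp: r_def)
  have lu: "set_lip A (ball x0 r) u"
    using r u S by (intro r1(2)) (auto simp: r_def intro: continuous_on_subset visc_subsolution_open_subset)
  have lv: "set_lip B (ball x0 r) v"
    using r v S by (intro r2(2)) (auto simp: r_def intro: continuous_on_subset visc_subsolution_open_subset)
  define K where "K = (\<lambda>z. (1/2) *\<^sub>R z) ` (\<Union>a\<in>A. \<Union>b\<in>B. {a + b})"
  show "\<exists>r>0. \<exists>K. compact K \<and> convex K \<and> set_lip K (ball x0 r) (\<lambda>y. (u y + v y) / 2) \<and> (\<forall>q\<in>K. F x0 q \<le> c')"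
  proof (intro exI[of _ r] exI[of _ K] conjI r(1) ballI)
    have "(\<Union>a\<in>A. \<Union>b\<in>B. {a + b}) = {a + b | a b. a \<in> A \<and> b \<in> B}" by blast
    then show "compact K" unfolding K_def A_def B_def
      using compact_sums[OF level_compact level_compact] by (intro compact_scaling) simp
    show "convex K" unfolding K_def A_def B_def by (intro convex_scaling convex_sums level_convex)
    show "set_lip K (ball x0 r) (\<lambda>y. (u y + v y) / 2)"
      unfolding set_lip_def
    proof (intro ballI)
      fix y z assume yz: "y \<in> ball x0 r" "z \<in> ball x0 r"
      obtain a b where "a \<in> A" "u y - u z \<le> a \<bullet> (y - z)" "b \<in> B" "v y - v z \<le> b \<bullet> (y - z)"
        using lu lv yz unfolding set_lip_def by blast
      then show "\<exists>q\<in>K. (u y + v y) / 2 - (u z + v z) / 2 \<le> q \<bullet> (y - z)"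
        unfolding K_def by (intro bexI[of _ "(1/2) *\<^sub>R (a + b)"] imageI)
          (auto simp: inner_add_left field_simps simp del: scaleR_add_right)
    qed
    fix q assume "q \<in> K"
    then obtain a b where ab: "a \<in> A" "b \<in> B" "q = (1/2) *\<^sub>R a + (1/2) *\<^sub>R b"
      unfolding K_def scaleR_add_right[symmetric] by blast
    have "F x0 ((1/2) *\<^sub>R a + (1/2) *\<^sub>R b) \<le> (1/2) * F x0 a + (1/2) * F x0 b"
      by (rule F_convex2) auto
    then show "F x0 q \<le> c'" using ab by (simp add: A_def B_def \<epsilon>_def field_simps)
  qed
qed

section \<open>Periodic domains with inward cones\<close>

locale periodic_domain =
  fixes \<Omega> :: "(real^'n) set"
  assumes open_dom: "open \<Omega>" and connected_dom: "connected \<Omega>" and nonempty_dom: "\<Omega> \<noteq> {}"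
    and periodic_dom: "x \<in> \<Omega> \<Longrightarrow> m \<in> int_lattice \<Longrightarrow> x + m \<in> \<Omega>"
    and inward_dom: "z \<in> closure \<Omega> \<Longrightarrow> \<exists>e \<delta>. inward \<Omega> z e \<delta>"
begin

lemma periodic_closure:
  assumes "x \<in> closure \<Omega>" "m \<in> int_lattice"
  shows "x + m \<in> closure \<Omega>"
proof -
  have "(\<lambda>x. m + x) ` \<Omega> \<subseteq> \<Omega>" using periodic_dom[OF _ assms(2)] by (auto simp: add.commute)
  then have "(\<lambda>x. m + x) ` closure \<Omega> \<subseteq> closure \<Omega>"
    unfolding closure_translation[symmetric] by (rule closure_mono)
  with assms(1) show ?thesis by (auto simp: add.commute)
qed

lemma cell_rep_closure: "x \<in> closure \<Omega> \<Longrightarrow> cell_rep x \<in> closure \<Omega>"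
  using periodic_closure[of x "- (x - cell_rep x)"] int_lattice_minus[OF cell_rep_lattice[of x]] by simp

lemma cell_rep_dom: "x \<in> \<Omega> \<Longrightarrow> cell_rep x \<in> \<Omega>"
  using periodic_dom[of x "- (x - cell_rep x)"] int_lattice_minus[OF cell_rep_lattice[of x]] by simp

lemma periodic_on_rep:
  assumes "periodic_on (closure \<Omega>) f" "x \<in> closure \<Omega>"
  shows "f (cell_rep x) = f x"
proof -
  have "f (cell_rep x + (x - cell_rep x)) = f (cell_rep x)"
    using assms(1)[unfolded periodic_on_def, rule_format, OF cell_rep_closure[OF assms(2)] cell_rep_lattice[of x]]
      assms(2) by simp
  then show ?thesis by simp
qed

end

locale hamiltonian_domain = coercive_hamiltonian F + periodic_domain \<Omega>
  for F :: "real^'n \<Rightarrow> real^'n \<Rightarrow> real" and \<Omega> :: "(real^'n) set"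
begin

lemma comparison:
  assumes v1: "continuous_on (closure \<Omega>) v1" "periodic_on (closure \<Omega>) v1" "visc_subsolution F c1 \<Omega> v1"
    and v2: "continuous_on (closure \<Omega>) v2" "periodic_on (closure \<Omega>) v2" "visc_supersolution F c2 (closure \<Omega>) v2"
  shows "c2 \<le> c1"
proof -
  let ?K = "closure \<Omega> \<inter> unit_cell"
  have "compact ?K" by (simp add: closed_Int_compact)
  moreover have "?K \<noteq> {}" using nonempty_dom closure_subset[of \<Omega>] cell_rep_closure cell_rep_in_cell by blast
  moreover have "continuous_on ?K (\<lambda>y. v1 y - v2 y)"
    using v1(1) v2(1) by (intro continuous_intros) (auto intro: continuous_on_subset)
  ultimately obtain z where z: "z \<in> ?K" "\<And>y. y \<in> ?K \<Longrightarrow> v1 y - v2 y \<le> v1 z - v2 z"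
    using continuous_attains_sup[of ?K] by blast
  have "v1 y - v2 y \<le> v1 z - v2 z" if "y \<in> closure \<Omega>" for y
    using z(2)[of "cell_rep y"] cell_rep_closure[OF that] cell_rep_in_cell periodic_on_rep[OF v1(2) that]
      periodic_on_rep[OF v2(2) that] by auto
  moreover obtain e \<delta> where "inward \<Omega> z e \<delta>" using inward_dom z(1) by blast
  ultimately show ?thesis
    using comparison_local[OF open_dom _ _ v1(1) v2(1) v1(3) v2(3), of z e \<delta>] z(1) by simp
qed

end

section \<open>Perron's method for the cell problem\<close>

lemma continuous_on_locally:
  fixes f :: "'a::metric_space \<Rightarrow> 'b::topological_space"
  assumes "\<And>x. x \<in> S \<Longrightarrow> \<exists>d>0. continuous_on (S \<inter> ball x d) f"
  shows "continuous_on S f"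
  unfolding continuous_on_def
proof
  fix x assume x: "x \<in> S"
  then obtain d where d: "d > 0" "continuous_on (S \<inter> ball x d) f" using assms by blast
  have "at x within S = at x within (S \<inter> ball x d)"
    using d(1) by (intro at_within_nhd[of _ "ball x d"]) auto
  then show "(f \<longlongrightarrow> f x) (at x within S)" using d x unfolding continuous_on_def by auto
qed

lemma C1_quadratic:
  assumes "C1_with_gradient \<phi> g"
  shows "C1_with_gradient (\<lambda>y. \<phi> y - (y - y0) \<bullet> (y - y0) + k) (\<lambda>y. g y - 2 *\<^sub>R (y - y0))"
  unfolding C1_with_gradient_def
proof (intro conjI allI)
  show "continuous_on UNIV (\<lambda>y. g y - 2 *\<^sub>R (y - y0))"
    using assms unfolding C1_with_gradient_def by (auto intro!: continuous_intros)
  fix y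
  have 1: "(\<phi> has_derivative (\<lambda>h. g y \<bullet> h)) (at y)" using assms by (simp add: C1_with_gradient_def)
  have 2: "((\<lambda>y. y - y0) has_derivative (\<lambda>h. h)) (at y)" by (auto intro!: derivative_eq_intros)
  have "((\<lambda>y. \<phi> y - (y - y0) \<bullet> (y - y0) + k) has_derivative
      (\<lambda>h. g y \<bullet> h - ((y - y0) \<bullet> h + h \<bullet> (y - y0)))) (at y)"
    by (intro has_derivative_diff has_derivative_inner has_derivative_add_const 1 2)
  then show "((\<lambda>y. \<phi> y - (y - y0) \<bullet> (y - y0) + k) has_derivative (\<bullet>) (g y - 2 *\<^sub>R (y - y0))) (at y)"
    by (rule has_derivative_eq_rhs) (auto simp: fun_eq_iff inner_commute inner_diff_right algebra_simps)
qed

lemma (in periodic_domain) visc_subsolution_translate: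
  assumes v: "periodic_on (closure \<Omega>) v" "visc_subsolution F c S v" and S: "open S" "S \<subseteq> \<Omega>"
    and m: "m \<in> int_lattice" and F: "\<And>y q. F (y + m) q = F y q"
  shows "visc_subsolution F c ((\<lambda>x. x + m) ` S) v"
proof (rule visc_subsolution_openI)
  have im: "(\<lambda>x. x + m) ` S = (\<lambda>x. m + x) ` S" by (simp add: add.commute)
  show "open ((\<lambda>x. x + m) ` S)" unfolding im by (rule open_translation[OF S(1)])
  fix \<phi> g x d assume *: "C1_with_gradient \<phi> g" "x \<in> (\<lambda>x. x + m) ` S" "d > 0" "ball x d \<subseteq> (\<lambda>x. x + m) ` S"
    "\<And>y. y \<in> ball x d \<Longrightarrow> v y - \<phi> y \<le> v x - \<phi> x"
  then obtain x' where x': "x' \<in> S" "x = x' + m" by blast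
  have per: "v (y + m) = v y" if "y \<in> S" for y
    using v(1) that S(2) closure_subset[of \<Omega>] periodic_closure[of y m] m unfolding periodic_on_def by blast
  have "F x' (g (x' + m)) \<le> c"
  proof (rule visc_subsolutionD[OF v(2) S(1) C1_translate[OF *(1), of m] x'(1) *(3)])
    fix y assume "y \<in> ball x' d"
    then have y: "y + m \<in> ball x d" using x' by (simp add: dist_norm)
    then have "y \<in> S" using *(4) by force
    with *(5)[OF y] per x' show "v y - \<phi> (y + m) \<le> v x' - \<phi> (x' + m)" by simp
  qed
  then show "F x (g x) \<le> c" using x' F by simp
qed

text \<open>In the application \<open>F y q = H y (p + q)\<close>, so \<open>q0 = - p\<close> is the
  common minimiser and every sublevel set of level at least \<open>0\<close> contains it.\<close>

locale cell_problem = hamiltonian_domain F \<Omega>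
  for F :: "real^'n \<Rightarrow> real^'n \<Rightarrow> real" and \<Omega> :: "(real^'n) set" +
  fixes q0 :: "real^'n"
  assumes F_periodic: "m \<in> int_lattice \<Longrightarrow> F (y + m) q = F y q"
    and F_nonneg: "0 \<le> F y q" and F_zero: "F y q0 = 0"
begin

definition Sub :: "real \<Rightarrow> (real^'n \<Rightarrow> real) set"
  where "Sub c = {v. continuous_on (closure \<Omega>) v \<and> periodic_on (closure \<Omega>) v \<and> visc_subsolution F c \<Omega> v}"

lemma Sub_mono: "c \<le> c' \<Longrightarrow> Sub c \<subseteq> Sub c'"
  unfolding Sub_def using visc_subsolution_mono by blast

lemma Sub_seg_lip:
  obtains L where "L \<ge> 0" "\<And>v. v \<in> Sub c \<Longrightarrow> seg_lip L \<Omega> v"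
proof -
  obtain L where L: "\<And>y q. F y q \<le> c \<Longrightarrow> norm q \<le> L" using F_coercive by blast
  show ?thesis
  proof (rule that[of "max L 0"])
    fix v assume "v \<in> Sub c"
    then have "continuous_on \<Omega> v" "visc_subsolution F c \<Omega> v"
      unfolding Sub_def using continuous_on_subset[OF _ closure_subset] by auto
    then have "seg_lip (max L 0) \<Omega> (\<lambda>y. v y - 0 \<bullet> y)"
      by (intro visc_sub_seg_lip[OF open_dom, where c=c]) (auto dest: L)
    then show "seg_lip (max L 0) \<Omega> v" by simp
  qed simp
qed

text \<open>Two boundary-close points are joined by three segments inside the domain and the bound
  passes to the closure by continuity; \<open>r\<close> and \<open>C\<close> serve the whole class
  \<open>Sub c\<close>.\<close>

lemma Sub_lip:
  assumes "z \<in> closure \<Omega>"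
  obtains r C where "r > 0"
    "\<And>v y y'. \<lbrakk>v \<in> Sub c; y \<in> closure \<Omega> \<inter> ball z r; y' \<in> closure \<Omega> \<inter> ball z r\<rbrakk> \<Longrightarrow> \<bar>v y - v y'\<bar> \<le> C * dist y y'"
proof -
  obtain L where L: "L \<ge> 0" "\<And>v. v \<in> Sub c \<Longrightarrow> seg_lip L \<Omega> v" using Sub_seg_lip by blast
  obtain e \<delta> where "inward \<Omega> z e \<delta>" using inward_dom[OF assms] by blast
  then obtain r C where rC: "r > 0" "C \<ge> 0"
    "\<And>L u y y'. \<lbrakk>L \<ge> 0; seg_lip L \<Omega> u; y \<in> \<Omega> \<inter> ball z r; y' \<in> \<Omega> \<inter> ball z r\<rbrakk> \<Longrightarrow> \<bar>u y - u y'\<bar> \<le> L * (C * dist y y')"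
    using inward_lip by blast
  show ?thesis
  proof (rule that[OF rC(1), of "L * C"])
    fix v y y' assume *: "v \<in> Sub c" "y \<in> closure \<Omega> \<inter> ball z r" "y' \<in> closure \<Omega> \<inter> ball z r"
    have "\<bar>v y - v y'\<bar> \<le> 0 + (L * C) * dist y y'"
    proof (rule closure_pair_bound[where \<Omega>=\<Omega> and U="ball z r"])
      show "continuous_on (closure \<Omega>) v" using *(1) by (simp add: Sub_def)
      fix y y' assume "y \<in> \<Omega> \<inter> ball z r" "y' \<in> \<Omega> \<inter> ball z r"
      from rC(3)[OF L(1) L(2)[OF *(1)] this] show "\<bar>v y - v y'\<bar> \<le> 0 + (L * C) * dist y y'"
        by (simp only: mult.assoc add_0)
    qed (use * in simp_all)
    then show "\<bar>v y - v y'\<bar> \<le> (L * C) * dist y y'" by simp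
  qed
qed

lemma Sub_osc:
  obtains M where "\<And>v y y'. \<lbrakk>v \<in> Sub c; y \<in> closure \<Omega>; y' \<in> closure \<Omega>\<rbrakk> \<Longrightarrow> \<bar>v y - v y'\<bar> \<le> M"
proof -
  obtain L where L: "L \<ge> 0" "\<And>v. v \<in> Sub c \<Longrightarrow> seg_lip L \<Omega> v" using Sub_seg_lip by blast
  obtain M where M: "\<And>u y y'. \<lbrakk>seg_lip L \<Omega> u; y \<in> \<Omega> \<inter> unit_cell; y' \<in> \<Omega> \<inter> unit_cell\<rbrakk> \<Longrightarrow> \<bar>u y - u y'\<bar> \<le> M"
    using seg_lip_osc[OF open_dom connected_dom compact_cbox L(1)] inward_dom by blast
  have "\<bar>v y - v y'\<bar> \<le> M + 0 * dist y y'" if *: "v \<in> Sub c" "y \<in> closure \<Omega>" "y' \<in> closure \<Omega>" for v y y'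
  proof (rule closure_pair_bound[where \<Omega>=\<Omega> and U=UNIV])
    fix y y' assume y: "y \<in> \<Omega> \<inter> UNIV" "y' \<in> \<Omega> \<inter> UNIV"
    have per: "periodic_on (closure \<Omega>) v" using *(1) by (simp add: Sub_def)
    have "\<bar>v (cell_rep y) - v (cell_rep y')\<bar> \<le> M"
      using y cell_rep_dom cell_rep_in_cell by (intro M L(2)[OF *(1)]) auto
    then show "\<bar>v y - v y'\<bar> \<le> M + 0 * dist y y'"
      using y periodic_on_rep[OF per] closure_subset[of \<Omega>] by (auto simp: subset_iff)
  qed (use * in \<open>auto simp: Sub_def\<close>)
  then have "\<bar>v y - v y'\<bar> \<le> M" if "v \<in> Sub c" "y \<in> closure \<Omega>" "y' \<in> closure \<Omega>" for v y y'
    using that by simp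
  then show ?thesis by (rule that)
qed

lemma Sub_set_lip_local:
  assumes "x0 \<in> \<Omega>" "c < c'" "0 \<le> c'"
  obtains r where "r > 0" "\<And>v. v \<in> Sub c \<Longrightarrow> set_lip {q. F x0 q \<le> c'} (ball x0 r) v"
proof -
  obtain r where r: "r > 0" "ball x0 r \<subseteq> \<Omega>" using open_dom assms(1) open_contains_ball by blast
  obtain r' where r': "r' > 0"
    "\<And>S u. \<lbrakk>open S; convex S; S \<subseteq> ball x0 r'; continuous_on S u; visc_subsolution F c S u\<rbrakk> \<Longrightarrow> set_lip {q. F x0 q \<le> c'} S u"
    using visc_sub_set_lip_local[of c c' x0 q0] assms F_zero by auto
  show ?thesis
  proof (rule that[of "min r r'"])
    fix v assume v: "v \<in> Sub c"
    have sub: "ball x0 (min r r') \<subseteq> \<Omega>" using r by auto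
    show "set_lip {q. F x0 q \<le> c'} (ball x0 (min r r')) v"
    proof (rule r'(2))
      show "continuous_on (ball x0 (min r r')) v"
        using v sub closure_subset[of \<Omega>] unfolding Sub_def by (auto intro: continuous_on_subset)
      show "visc_subsolution F c (ball x0 (min r r')) v"
        using v sub open_dom by (auto simp: Sub_def intro: visc_subsolution_open_subset)
    qed auto
  qed (use r r' in auto)
qed

lemma Sub_add_const:
  assumes "v \<in> Sub c"
  shows "(\<lambda>y. v y - k) \<in> Sub c"
proof -
  have "visc_subsolution F c \<Omega> (\<lambda>y. v y - k)"
  proof (rule visc_subsolution_openI[OF open_dom])
    fix \<phi> g x d assume *: "C1_with_gradient \<phi> g" "x \<in> \<Omega>" "d > 0"
      "\<And>y. y \<in> ball x d \<Longrightarrow> v y - k - \<phi> y \<le> v x - k - \<phi> x"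
    have "visc_subsolution F c \<Omega> v" using assms by (simp add: Sub_def)
    from visc_subsolutionD[OF this open_dom *(1-3)] show "F x (g x) \<le> c" using *(4) by force
  qed
  then show ?thesis using assms by (auto simp: Sub_def periodic_on_def intro!: continuous_intros)
qed

lemma SubI:
  assumes per: "periodic_on (closure \<Omega>) w"
    and lip: "\<And>z. z \<in> closure \<Omega> \<Longrightarrow> \<exists>r>0. \<exists>C. \<forall>y\<in>closure \<Omega> \<inter> ball z r. \<forall>y'\<in>closure \<Omega> \<inter> ball z r. w y \<le> w y' + C * dist y y'"
    and loc: "\<And>x0 c'. x0 \<in> \<Omega> \<Longrightarrow> c < c' \<Longrightarrow> \<exists>r>0. set_lip {q. F x0 q \<le> c'} (ball x0 r) w"
  shows "w \<in> Sub c"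
  unfolding Sub_def
proof (intro CollectI conjI per)
  show "continuous_on (closure \<Omega>) w"
  proof (rule local_lip_continuous_on)
    fix z assume "z \<in> closure \<Omega>"
    then obtain r C where rC: "r > 0"
      "\<forall>y\<in>closure \<Omega> \<inter> ball z r. \<forall>y'\<in>closure \<Omega> \<inter> ball z r. w y \<le> w y' + C * dist y y'"
      using lip by blast
    have "\<bar>w y - w y'\<bar> \<le> C * dist y y'" if y: "y \<in> closure \<Omega> \<inter> ball z r" "y' \<in> closure \<Omega> \<inter> ball z r" for y y'
      using bspec[OF bspec[OF rC(2) y(1)] y(2)] bspec[OF bspec[OF rC(2) y(2)] y(1)]
      unfolding dist_commute[of y'] by linarith
    with rC(1) show "\<exists>r>0. \<exists>C. \<forall>y\<in>closure \<Omega> \<inter> ball z r. \<forall>y'\<in>closure \<Omega> \<inter> ball z r. \<bar>w y - w y'\<bar> \<le> C * dist y y'"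
      by blast
  qed
  show "visc_subsolution F c \<Omega> w"
  proof (rule visc_subI[OF open_dom])
    fix x0 c' assume "x0 \<in> \<Omega>" "c < c'"
    then obtain r where "r > 0" "set_lip {q. F x0 q \<le> c'} (ball x0 r) w" using loc by blast
    then show "\<exists>r>0. \<exists>K. compact K \<and> convex K \<and> set_lip K (ball x0 r) w \<and> (\<forall>q\<in>K. F x0 q \<le> c')"
      by (intro exI[of _ r] conjI exI[of _ "{q. F x0 q \<le> c'}"] level_compact level_convex) auto
  qed
qed

text \<open>The equi-Lipschitz bounds make the supremum continuous up to the boundary, so it lies in
  the class itself without passing to a semicontinuous envelope.\<close>

lemma Sub_SUP:
  assumes c: "0 \<le> c" and \<F>: "\<F> \<subseteq> Sub c" "\<F> \<noteq> {}"
    and bdd: "\<And>y. y \<in> closure \<Omega> \<Longrightarrow> bdd_above ((\<lambda>v. v y) ` \<F>)"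
  shows "(\<lambda>y. SUP v\<in>\<F>. v y) \<in> Sub c"
proof (rule SubI)
  show "periodic_on (closure \<Omega>) (\<lambda>y. SUP v\<in>\<F>. v y)"
    unfolding periodic_on_def
  proof (intro allI impI)
    fix x m :: "real^'n" assume x: "x \<in> closure \<Omega>" "m \<in> int_lattice" "x + m \<in> closure \<Omega>"
    have "v (x + m) = v x" if "v \<in> \<F>" for v
      using that \<F>(1) x unfolding Sub_def periodic_on_def by blast
    then show "(SUP v\<in>\<F>. v (x + m)) = (SUP v\<in>\<F>. v x)" by (rule SUP_cong[OF refl])
  qed
next
  fix z assume "z \<in> closure \<Omega>"
  then obtain r C where rC: "r > 0"
    "\<And>v y y'. \<lbrakk>v \<in> Sub c; y \<in> closure \<Omega> \<inter> ball z r; y' \<in> closure \<Omega> \<inter> ball z r\<rbrakk> \<Longrightarrow> \<bar>v y - v y'\<bar> \<le> C * dist y y'"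
    using Sub_lip by blast
  have "(SUP v\<in>\<F>. v y) \<le> (SUP v\<in>\<F>. v y') + C * dist y y'"
    if y: "y \<in> closure \<Omega> \<inter> ball z r" "y' \<in> closure \<Omega> \<inter> ball z r" for y y'
  proof (rule cSUP_least[OF \<F>(2)])
    fix v assume v: "v \<in> \<F>"
    have "v y' \<le> (SUP v\<in>\<F>. v y')" using y by (intro cSUP_upper[OF v] bdd) auto
    moreover have "\<bar>v y - v y'\<bar> \<le> C * dist y y'" using v \<F>(1) y by (intro rC) auto
    ultimately show "v y \<le> (SUP v\<in>\<F>. v y') + C * dist y y'" by linarith
  qed
  with rC(1) show "\<exists>r>0. \<exists>C. \<forall>y\<in>closure \<Omega> \<inter> ball z r. \<forall>y'\<in>closure \<Omega> \<inter> ball z r.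
      (SUP v\<in>\<F>. v y) \<le> (SUP v\<in>\<F>. v y') + C * dist y y'" by blast
next
  fix x0 c' assume x0: "x0 \<in> \<Omega>" "c < c'"
  then obtain r where r: "r > 0" "\<And>v. v \<in> Sub c \<Longrightarrow> set_lip {q. F x0 q \<le> c'} (ball x0 r) v"
    using Sub_set_lip_local[of x0 c c'] c by auto
  obtain r' where r': "r' > 0" "ball x0 r' \<subseteq> \<Omega>" using open_dom x0(1) open_contains_ball by blast
  have "set_lip {q. F x0 q \<le> c'} (ball x0 (min r r')) (\<lambda>y. SUP v\<in>\<F>. v y)"
  proof (rule set_lip_SUP[OF level_compact _ \<F>(2)])
    show "set_lip {q. F x0 q \<le> c'} (ball x0 (min r r')) v" if "v \<in> \<F>" for v
      using that \<F>(1) by (intro set_lip_subset[OF r(2)]) auto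
    show "bdd_above ((\<lambda>v. v y) ` \<F>)" if "y \<in> ball x0 (min r r')" for y
      using that r'(2) closure_subset[of \<Omega>] by (intro bdd) auto
  qed
  with r(1) r'(1) show "\<exists>r>0. set_lip {q. F x0 q \<le> c'} (ball x0 r) (\<lambda>y. SUP v\<in>\<F>. v y)"
    by (intro exI[of _ "min r r'"]) auto
qed

text \<open>Infima of viscosity subsolutions are subsolutions here because support function bounds
  are stable under infima, an effect of convexity. Letting the levels decrease to \<open>c\<close>
  along with the functions gives the limit at level \<open>c\<close>.\<close>

lemma Sub_INF:
  assumes c: "0 \<le> c" and V: "\<And>n::nat. V n \<in> Sub (c + 1 / real (Suc n))"
    and dec: "\<And>n y. y \<in> closure \<Omega> \<Longrightarrow> V (Suc n) y \<le> V n y"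
    and bdd: "\<And>y. y \<in> closure \<Omega> \<Longrightarrow> bdd_below (range (\<lambda>n. V n y))"
  shows "(\<lambda>y. INF n. V n y) \<in> Sub c"
proof (rule SubI)
  show "periodic_on (closure \<Omega>) (\<lambda>y. INF n. V n y)"
    unfolding periodic_on_def
  proof (intro allI impI)
    fix x m :: "real^'n" assume x: "x \<in> closure \<Omega>" "m \<in> int_lattice" "x + m \<in> closure \<Omega>"
    have "V n (x + m) = V n x" for n
      using V[of n] x unfolding Sub_def periodic_on_def by blast
    then show "(INF n. V n (x + m)) = (INF n. V n x)" by simp
  qed
next
  have V1: "V n \<in> Sub (c + 1)" for n
    using V[of n] Sub_mono[of "c + 1 / real (Suc n)" "c + 1"] by auto
  fix z assume "z \<in> closure \<Omega>"
  then obtain r C where rC: "r > 0"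
    "\<And>v y y'. \<lbrakk>v \<in> Sub (c + 1); y \<in> closure \<Omega> \<inter> ball z r; y' \<in> closure \<Omega> \<inter> ball z r\<rbrakk> \<Longrightarrow> \<bar>v y - v y'\<bar> \<le> C * dist y y'"
    using Sub_lip by blast
  have "(INF n. V n y) \<le> (INF n. V n y') + C * dist y y'"
    if y: "y \<in> closure \<Omega> \<inter> ball z r" "y' \<in> closure \<Omega> \<inter> ball z r" for y y'
  proof -
    have "(INF n. V n y) - C * dist y y' \<le> (INF n. V n y')"
    proof (rule cINF_greatest)
      fix n
      have "(INF n. V n y) \<le> V n y" using y by (intro cINF_lower bdd) auto
      moreover have "\<bar>V n y - V n y'\<bar> \<le> C * dist y y'" using V1 y by (intro rC) auto
      ultimately show "(INF n. V n y) - C * dist y y' \<le> V n y'" by linarith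
    qed simp
    then show ?thesis by simp
  qed
  with rC(1) show "\<exists>r>0. \<exists>C. \<forall>y\<in>closure \<Omega> \<inter> ball z r. \<forall>y'\<in>closure \<Omega> \<inter> ball z r.
      (INF n. V n y) \<le> (INF n. V n y') + C * dist y y'" by blast
next
  fix x0 c' assume x0: "x0 \<in> \<Omega>" "c < c'"
  then obtain N where N: "1 / real (Suc N) < c' - c"
    using nat_approx_posE[of "c' - c"] by auto
  then obtain r where r: "r > 0" "\<And>v. v \<in> Sub (c + 1 / real (Suc N)) \<Longrightarrow> set_lip {q. F x0 q \<le> c'} (ball x0 r) v"
    using Sub_set_lip_local[of x0 "c + 1 / real (Suc N)" c'] c x0 by auto
  obtain r' where r': "r' > 0" "ball x0 r' \<subseteq> \<Omega>" using open_dom x0(1) open_contains_ball by blast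
  \<comment> \<open>The first \<open>N\<close> functions have too high a level for the set below
    \<open>c'\<close>; monotonicity allows them to be dropped without changing the infimum.\<close>
  have tail: "(INF n. V n y) = (INF n\<in>{N..}. V n y)" if y: "y \<in> closure \<Omega>" for y
  proof (rule antisym)
    show "(INF n. V n y) \<le> (INF n\<in>{N..}. V n y)"
      by (rule cINF_superset_mono) (use bdd[OF y] in auto)
    show "(INF n\<in>{N..}. V n y) \<le> (INF n. V n y)"
    proof (rule cINF_greatest)
      fix n
      have "(INF n\<in>{N..}. V n y) \<le> V (max n N) y"
        by (rule cINF_lower) (auto intro: bdd_below_mono[OF bdd[OF y]])
      also have "\<dots> \<le> V n y" by (rule lift_Suc_antimono_le[of "\<lambda>n. V n y", OF dec[OF y]]) simp
      finally show "(INF n\<in>{N..}. V n y) \<le> V n y" .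
    qed simp
  qed
  have "set_lip {q. F x0 q \<le> c'} (ball x0 (min r r')) (\<lambda>y. INF n\<in>{N..}. V n y)"
  proof (rule set_lip_INF[OF level_compact])
    show "set_lip {q. F x0 q \<le> c'} (ball x0 (min r r')) (V n)" if "n \<in> {N..}" for n
    proof -
      have "c + 1 / real (Suc n) \<le> c + 1 / real (Suc N)" using that by (auto intro!: divide_left_mono)
      then have "V n \<in> Sub (c + 1 / real (Suc N))" using V[of n] Sub_mono by blast
      then show ?thesis by (intro set_lip_subset[OF r(2)]) auto
    qed
    show "bdd_below ((\<lambda>n. V n y) ` {N..})" if "y \<in> ball x0 (min r r')" for y
    proof -
      have "y \<in> ball x0 r'" using that by simp
      then have "y \<in> closure \<Omega>" using r'(2) closure_subset[of \<Omega>] by blast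
      from bdd[OF this] show ?thesis by (rule bdd_below_mono) auto
    qed
  qed auto
  then have "set_lip {q. F x0 q \<le> c'} (ball x0 (min r r')) (\<lambda>y. INF n. V n y)"
  proof (rule set_lip_cong)
    fix y assume "y \<in> ball x0 (min r r')"
    then have "y \<in> ball x0 r'" by simp
    then show "(INF n. V n y) = (INF n\<in>{N..}. V n y)"
      using r'(2) closure_subset[of \<Omega>] by (intro tail) blast
  qed
  with r(1) r'(1) show "\<exists>r>0. set_lip {q. F x0 q \<le> c'} (ball x0 r) (\<lambda>y. INF n. V n y)"
    by (intro exI[of _ "min r r'"]) auto
qed

text \<open>For levels with subsolutions this is the intrinsic semidistance from \<open>a\<close>,
  also known as the Mane potential: the largest subsolution that vanishes at
  \<open>a\<close>.\<close>

definition top_sub :: "real \<Rightarrow> real^'n \<Rightarrow> real^'n \<Rightarrow> real"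
  where "top_sub c a y = (SUP v\<in>{v \<in> Sub c. v a = 0}. v y)"

lemma top_sub_bdd:
  assumes "a \<in> closure \<Omega>" "y \<in> closure \<Omega>"
  shows "bdd_above ((\<lambda>v. v y) ` {v \<in> Sub c. v a = 0})"
proof -
  obtain M where M: "\<And>v y y'. \<lbrakk>v \<in> Sub c; y \<in> closure \<Omega>; y' \<in> closure \<Omega>\<rbrakk> \<Longrightarrow> \<bar>v y - v y'\<bar> \<le> M"
    using Sub_osc by blast
  have "v y \<le> M" if "v \<in> Sub c" "v a = 0" for v
    using M[OF that(1) assms(2,1)] that(2) by simp
  then show ?thesis by (auto simp: bdd_above_def)
qed

lemma top_sub_family_nonempty: "Sub c \<noteq> {} \<Longrightarrow> {v \<in> Sub c. v a = 0} \<noteq> {}"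
proof -
  assume "Sub c \<noteq> {}"
  then obtain v where "v \<in> Sub c" by blast
  from Sub_add_const[OF this, of "v a"] have "(\<lambda>y. v y - v a) \<in> {v \<in> Sub c. v a = 0}" by simp
  then show ?thesis by blast
qed

lemma top_sub_in_Sub:
  assumes "0 \<le> c" "Sub c \<noteq> {}" "a \<in> closure \<Omega>"
  shows "top_sub c a \<in> Sub c"
  unfolding top_sub_def[abs_def]
  using assms top_sub_bdd top_sub_family_nonempty by (intro Sub_SUP) auto

lemma top_sub_self:
  assumes "Sub c \<noteq> {}"
  shows "top_sub c a a = 0"
proof -
  have "(\<lambda>v. v a) ` {v \<in> Sub c. v a = 0} = {0}" using top_sub_family_nonempty[OF assms, of a] by auto
  then show ?thesis by (simp add: top_sub_def)
qed

lemma top_sub_upper: "\<lbrakk>v \<in> Sub c; v a = 0; a \<in> closure \<Omega>; y \<in> closure \<Omega>\<rbrakk> \<Longrightarrow> v y \<le> top_sub c a y"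
  unfolding top_sub_def by (rule cSUP_upper[OF _ top_sub_bdd]) auto

lemma F_bounded_at: obtains B where "B \<ge> 0" "\<And>y. F y q \<le> B"
proof -
  have "continuous_on unit_cell (\<lambda>y. F y q)" by (intro continuous_intros)
  from compact_imp_bounded[OF compact_continuous_image[OF this compact_cbox]]
  obtain B where B: "B > 0" "\<And>y. y \<in> unit_cell \<Longrightarrow> \<bar>F y q\<bar> \<le> B"
    unfolding bounded_pos by auto
  have "F y q \<le> B" for y
    using B(2)[OF cell_rep_in_cell[of y]] F_periodic[OF cell_rep_lattice, of "cell_rep y" y q] by simp
  with B(1) show ?thesis using that[of B] by simp
qed

lemma const_visc_sub:
  assumes "open S" "\<And>y. F y 0 \<le> B"
  shows "visc_subsolution F B S (\<lambda>_. 0)"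
proof (rule visc_subI[OF assms(1)])
  fix x0 c' assume "B < c'"
  with assms(2)[of x0] show "\<exists>r>0. \<exists>K. compact K \<and> convex K \<and> set_lip K (ball x0 r) (\<lambda>_. 0) \<and> (\<forall>q\<in>K. F x0 q \<le> c')"
    by (intro exI[of _ 1] conjI exI[of _ "{0}"]) (auto simp: set_lip_def)
qed

text \<open>Mane's critical value. Requiring \<open>0 \<le> c\<close> keeps \<open>q0\<close> inside
  every sublevel set that occurs.\<close>

definition crit :: real where "crit = Inf {c. 0 \<le> c \<and> Sub c \<noteq> {}}"

lemma crit_set: "{c. 0 \<le> c \<and> Sub c \<noteq> {}} \<noteq> {}" "bdd_below {c. 0 \<le> c \<and> Sub c \<noteq> {}}"
proof -
  obtain B where B: "B \<ge> 0" "\<And>y. F y 0 \<le> B" using F_bounded_at by blast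
  have "(\<lambda>_. 0) \<in> Sub B" unfolding Sub_def using const_visc_sub[OF open_dom B(2)] by (simp add: periodic_on_def)
  with B show "{c. 0 \<le> c \<and> Sub c \<noteq> {}} \<noteq> {}" by blast
qed (auto simp: bdd_below_def)

lemma crit_nonneg: "0 \<le> crit"
  unfolding crit_def using crit_set(1) by (rule cInf_greatest) auto

lemma crit_le: "0 \<le> c \<Longrightarrow> Sub c \<noteq> {} \<Longrightarrow> crit \<le> c"
  unfolding crit_def using crit_set(2) by (intro cInf_lower) auto

text \<open>Maximal subsolutions at a common base point decrease with the level, since the class
  shrinks, and the oscillation bound keeps them bounded below; their limit is a subsolution at the
  critical level.\<close>

lemma Sub_crit_nonempty: "Sub crit \<noteq> {}"
proof -
  obtain a where a: "a \<in> closure \<Omega>" using nonempty_dom closure_subset[of \<Omega>] by blast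
  define c where "c n = crit + 1 / real (Suc n)" for n
  have cpos: "0 \<le> c n" for n using crit_nonneg by (simp add: c_def)
  have ne: "Sub (c n) \<noteq> {}" for n
  proof -
    have "crit < c n" by (simp add: c_def)
    then obtain b where "b \<in> {c. 0 \<le> c \<and> Sub c \<noteq> {}}" "b < c n"
      unfolding crit_def using cInf_lessD[OF crit_set(1)] by blast
    then show ?thesis using Sub_mono[of b "c n"] by auto
  qed
  have c1: "Sub (c n) \<subseteq> Sub (c 0)" for n by (rule Sub_mono) (simp add: c_def)
  obtain M where M: "\<And>v y y'. \<lbrakk>v \<in> Sub (c 0); y \<in> closure \<Omega>; y' \<in> closure \<Omega>\<rbrakk> \<Longrightarrow> \<bar>v y - v y'\<bar> \<le> M"
    using Sub_osc by blast
  have in_Sub: "top_sub (c n) a \<in> Sub (c n)" for n by (rule top_sub_in_Sub[OF cpos ne a])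
  have "(\<lambda>y. INF n. top_sub (c n) a y) \<in> Sub crit"
  proof (rule Sub_INF[OF crit_nonneg])
    show "top_sub (c n) a \<in> Sub (crit + 1 / real (Suc n))" for n using in_Sub[of n] by (simp add: c_def)
    show "top_sub (c (Suc n)) a y \<le> top_sub (c n) a y" if y: "y \<in> closure \<Omega>" for n y
    proof (rule top_sub_upper[OF _ top_sub_self[OF ne] a y])
      have "c (Suc n) \<le> c n" by (simp add: c_def frac_le)
      then show "top_sub (c (Suc n)) a \<in> Sub (c n)" using in_Sub[of "Suc n"] Sub_mono by blast
    qed
    show "bdd_below (range (\<lambda>n. top_sub (c n) a y))" if y: "y \<in> closure \<Omega>" for y
    proof (rule bdd_belowI2)
      fix n
      have "\<bar>top_sub (c n) a y - top_sub (c n) a a\<bar> \<le> M" using in_Sub[of n] c1 a y by (intro M) auto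
      then show "- M \<le> top_sub (c n) a y" using top_sub_self[OF ne[of n], of a] by simp
    qed
  qed
  then show ?thesis by blast
qed

end

section \<open>The bump construction and existence at the critical level\<close>

context cell_problem
begin

text \<open>Perron's bump construction. A failure of the supersolution property relative to the
  closure gives a larger subsolution which is strict near the point of failure; no condition
  has to be checked at boundary points, since subsolutions are only tested in the open set.\<close>

lemma bump:
  assumes w: "w \<in> Sub c" and C1: "C1_with_gradient \<phi> g"
    and min: "local_min_rel (closure \<Omega>) (\<lambda>y. w y - \<phi> y) y0"
    and F1: "F y0 (g y0) < c1" and c1: "c1 \<le> c" and R: "R > 0"
  obtains w' \<rho>' where "w' \<in> Sub c" "w' y0 > w y0"
    "\<And>y. (\<And>m. m \<in> int_lattice \<Longrightarrow> y - m \<notin> ball y0 R) \<Longrightarrow> w' y = w y"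
    "\<rho>' > 0" "visc_subsolution F c1 (\<Omega> \<inter> ball y0 \<rho>') w'"
proof -
  have y0: "y0 \<in> closure \<Omega>" using min by (simp add: local_min_rel_def)
  have wcont: "continuous_on (closure \<Omega>) w" and wper: "periodic_on (closure \<Omega>) w"
    and wsub: "visc_subsolution F c \<Omega> w" using w by (auto simp: Sub_def)
  obtain \<rho>0 where \<rho>0: "\<rho>0 > 0" "\<And>y. y \<in> closure \<Omega> \<Longrightarrow> dist y y0 < \<rho>0 \<Longrightarrow> w y0 - \<phi> y0 \<le> w y - \<phi> y"
  proof -
    obtain d where d: "d > 0" "\<And>y. y \<in> closure \<Omega> \<Longrightarrow> y \<noteq> y0 \<Longrightarrow> dist y y0 < d \<Longrightarrow> w y0 - \<phi> y0 \<le> w y - \<phi> y"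
      using min unfolding local_min_rel_def eventually_at by blast
    have "w y0 - \<phi> y0 \<le> w y - \<phi> y" if "y \<in> closure \<Omega>" "dist y y0 < d" for y
      using d(2) that by (cases "y = y0") auto
    with d(1) show ?thesis by (rule that)
  qed
  define g2 where "g2 y = g y - 2 *\<^sub>R (y - y0)" for y
  have g2cont: "continuous_on UNIV g2"
    using C1 unfolding g2_def C1_with_gradient_def by (auto intro!: continuous_intros)
  have "open {y. F y (g2 y) < c1}"
    by (intro open_Collect_less continuous_intros g2cont)
  moreover have "y0 \<in> {y. F y (g2 y) < c1}" using F1 by (simp add: g2_def)
  ultimately obtain \<rho>1 where "\<rho>1 > 0" "ball y0 \<rho>1 \<subseteq> {y. F y (g2 y) < c1}" by (rule openE)
  then have \<rho>1: "\<rho>1 > 0" "\<And>y. y \<in> ball y0 \<rho>1 \<Longrightarrow> F y (g2 y) < c1" by auto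
  \<comment> \<open>Besides the local conditions, \<open>\<rho> < 1/2\<close> puts the ball of
    radius \<rho> inside the open cell, so its lattice translates are disjoint and the bump can be
    repeated periodically.\<close>
  define \<rho> where "\<rho> = Min {\<rho>0, \<rho>1, R, 1/2} / 2"
  have "Min {\<rho>0, \<rho>1, R, 1/2} > 0" using \<rho>0(1) \<rho>1(1) R by simp
  moreover have "Min {\<rho>0, \<rho>1, R, 1/2} \<le> \<rho>0" "Min {\<rho>0, \<rho>1, R, 1/2} \<le> \<rho>1"
    "Min {\<rho>0, \<rho>1, R, 1/2} \<le> R" "Min {\<rho>0, \<rho>1, R, 1/2} \<le> 1/2" by simp_all
  ultimately have \<rho>: "\<rho> > 0" "\<rho> < \<rho>0" "\<rho> < \<rho>1" "\<rho> < R" "\<rho> < 1/2" unfolding \<rho>_def by linarith+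
  \<comment> \<open>The bump is raised by \<open>\<rho>\<^sup>2 / 8\<close> at \<open>y0\<close>,
    whereas the quadratic term has lowered it by at least \<open>\<rho>\<^sup>2 / 4\<close> from
    radius \<open>\<rho> / 2\<close> on: it is above \<open>w\<close> at the centre and below it on
    the rim.\<close>
  define \<kappa> where "\<kappa> = \<rho>\<^sup>2 / 8"
  have \<kappa>: "\<kappa> > 0" using \<rho> by (simp add: \<kappa>_def)
  define \<phi>2 where "\<phi>2 y = \<phi> y - (y - y0) \<bullet> (y - y0) + (w y0 - \<phi> y0 + \<kappa>)" for y
  have C2: "C1_with_gradient \<phi>2 g2" unfolding \<phi>2_def g2_def by (rule C1_quadratic[OF C1])
  have \<phi>2y0: "\<phi>2 y0 = w y0 + \<kappa>" by (simp add: \<phi>2_def)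
  have \<phi>2cont: "continuous_on UNIV \<phi>2"
  proof (rule has_derivative_continuous_on)
    show "(\<phi>2 has_derivative (\<bullet>) (g2 x)) (at x within UNIV)" for x
      using C2 unfolding C1_with_gradient_def by simp
  qed
  have rim: "\<phi>2 y < w y" if y: "y \<in> closure \<Omega>" "\<rho>/2 \<le> dist y y0" "dist y y0 < \<rho>" for y
  proof -
    have "(\<rho>/2)\<^sup>2 \<le> (dist y y0)\<^sup>2" using y \<rho> by (intro power_mono) auto
    then have "\<rho>\<^sup>2 / 4 \<le> (y - y0) \<bullet> (y - y0)" by (simp add: dist_norm power2_norm_eq_inner power_divide)
    moreover have "w y0 - \<phi> y0 \<le> w y - \<phi> y" using y \<rho> by (intro \<rho>0) auto
    moreover have "\<rho>\<^sup>2 > 0" using \<rho> by simp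
    ultimately show ?thesis unfolding \<phi>2_def \<kappa>_def by linarith
  qed
  \<comment> \<open>Displacement from the lattice translate of \<open>y0\<close> attached to
    \<open>y\<close>; using it in place of \<open>y - y0\<close> makes the modified function
    periodic.\<close>
  define T where "T y = cell_rep (y - y0)" for y
  define w' where "w' y = (if norm (T y) < \<rho> then max (w y) (\<phi>2 (y0 + T y)) else w y)" for y
  have w'_ge: "w y \<le> w' y" for y by (simp add: w'_def)
  have Tlat: "y - y0 - T y \<in> int_lattice" for y unfolding T_def by (rule cell_rep_lattice)
  have ballbox: "ball 0 \<rho> \<subseteq> open_cell"
    using \<rho>(5) by (intro order_trans[OF subset_ball ball_half_subset_box]) simp
  have Teq: "T y = y - y0 - m" if "m \<in> int_lattice" "norm (y - y0 - m) < \<rho>" for y m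
    unfolding T_def by (rule cell_rep_eq[OF that(1) subsetD[OF ballbox]]) (use that(2) in simp)
  have local_in: "\<exists>d>0. \<forall>y\<in>ball y1 d. norm (T y) < \<rho> \<and> y0 + T y = y - (y1 - y0 - T y1)" if y1: "norm (T y1) < \<rho>" for y1
  proof -
    obtain d where d: "d > 0" "\<And>y. y \<in> ball (y1 - y0) d \<Longrightarrow> cell_rep y = y - ((y1 - y0) - cell_rep (y1 - y0))"
      "\<And>y. y \<in> ball (y1 - y0) d \<Longrightarrow> cell_rep y \<in> ball 0 \<rho>"
    proof (rule cell_rep_local[OF _ open_ball ballbox])
      show "cell_rep (y1 - y0) \<in> ball 0 \<rho>" using y1 by (simp add: T_def)
    qed blast
    have "norm (T y) < \<rho> \<and> y0 + T y = y - (y1 - y0 - T y1)" if "y \<in> ball y1 d" for y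
    proof -
      have "y - y0 \<in> ball (y1 - y0) d" using that by (simp add: dist_norm)
      then show ?thesis using d(2)[of "y - y0"] d(3)[of "y - y0"] by (simp add: T_def algebra_simps)
    qed
    with d(1) show ?thesis by blast
  qed
  \<comment> \<open>A point close to the outside of all balls can enter a ball only through its rim,
    where the maximum still equals \<open>w\<close>; this gives continuity across the
    spheres.\<close>
  have local_out: "w' y = w y" if y1: "\<not> norm (T y1) < \<rho>" and y: "y \<in> closure \<Omega>" "y \<in> ball y1 (\<rho>/2)" for y y1
  proof (cases "norm (T y) < \<rho>")
    case True
    define m where "m = y - y0 - T y"
    have m: "m \<in> int_lattice" using Tlat by (simp add: m_def)
    have "\<rho>/2 \<le> norm (T y)"
    proof (rule ccontr)
      assume small: "\<not> ?thesis"
      have eq: "y1 - y0 - m = T y + (y1 - y)" by (simp add: m_def)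
      have lt: "norm (y1 - y0 - m) < \<rho>"
        unfolding eq using norm_triangle_ineq[of "T y" "y1 - y"] small y(2) by (simp add: dist_norm)
      with Teq[OF m lt] y1 show False by simp
    qed
    have ym: "y0 + T y = y + (- m)" by (simp add: m_def)
    have "\<phi>2 (y0 + T y) < w (y0 + T y)"
    proof (rule rim)
      show "y0 + T y \<in> closure \<Omega>" unfolding ym by (rule periodic_closure[OF y(1) int_lattice_minus[OF m]])
      show "\<rho>/2 \<le> dist (y0 + T y) y0" "dist (y0 + T y) y0 < \<rho>"
        unfolding dist_norm add_diff_cancel_left' by fact+
    qed
    also have "w (y0 + T y) = w y"
      using wper y(1) periodic_closure[OF y(1) int_lattice_minus[OF m]] int_lattice_minus[OF m]
      unfolding ym periodic_on_def by blast
    finally show ?thesis using True by (simp add: w'_def)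
  qed (simp add: w'_def)
  have w'cont: "continuous_on (closure \<Omega>) w'"
  proof (rule continuous_on_locally)
    fix y1 assume "y1 \<in> closure \<Omega>"
    show "\<exists>d>0. continuous_on (closure \<Omega> \<inter> ball y1 d) w'"
    proof (cases "norm (T y1) < \<rho>")
      case True
      then obtain d where d: "d > 0" "\<And>y. y \<in> ball y1 d \<Longrightarrow> norm (T y) < \<rho> \<and> y0 + T y = y - (y1 - y0 - T y1)"
        using local_in by blast
      have "continuous_on (closure \<Omega> \<inter> ball y1 d) (\<lambda>y. max (w y) (\<phi>2 (y - (y1 - y0 - T y1))))"
        by (rule continuous_on_max)
           (auto intro: continuous_on_subset[OF wcont] intro!: continuous_on_compose2[OF \<phi>2cont] continuous_on_diff continuous_on_id continuous_on_const)
      then have "continuous_on (closure \<Omega> \<inter> ball y1 d) w'"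
      proof (rule continuous_on_eq)
        fix y assume "y \<in> closure \<Omega> \<inter> ball y1 d"
        then have "norm (T y) < \<rho>" and eq: "y0 + T y = y - (y1 - y0 - T y1)" using d(2)[of y] by blast+
        then show "max (w y) (\<phi>2 (y - (y1 - y0 - T y1))) = w' y" unfolding w'_def eq by simp
      qed
      with d(1) show ?thesis by blast
    next
      case False
      have "continuous_on (closure \<Omega> \<inter> ball y1 (\<rho>/2)) w"
        by (rule continuous_on_subset[OF wcont]) auto
      then have "continuous_on (closure \<Omega> \<inter> ball y1 (\<rho>/2)) w'"
        by (rule continuous_on_eq) (use local_out[OF False] in auto)
      with \<rho>(1) show ?thesis by (intro exI[of _ "\<rho>/2"]) auto
    qed
  qed
  have w'per: "periodic_on (closure \<Omega>) w'"
    unfolding periodic_on_def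
  proof (intro allI impI)
    fix x m :: "real^'n" assume x: "x \<in> closure \<Omega>" "m \<in> int_lattice" "x + m \<in> closure \<Omega>"
    have "T (x + m) = T x" unfolding T_def using cell_rep_add[OF x(2), of "x - y0"] by (simp add: algebra_simps)
    moreover have "w (x + m) = w x" using wper x unfolding periodic_on_def by blast
    ultimately show "w' (x + m) = w' x" by (simp add: w'_def)
  qed
  \<comment> \<open>Where the bump is active, \<open>w'\<close> lies above a translate of \<phi>2
    nearby and agrees with it at \<open>y1\<close>. A test function touching \<open>w'\<close> from
    above therefore touches this smooth function too and must have gradient \<open>g2\<close>, for
    which \<open>F\<close> is below \<open>c1\<close>.\<close>
  have strict: "F y1 (h y1) < c1"
    if y1: "w' y1 > w y1" and h: "C1_with_gradient \<psi> h" "d > 0"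
      "\<And>y. y \<in> ball y1 d \<Longrightarrow> w' y - \<psi> y \<le> w' y1 - \<psi> y1" for y1 \<psi> h d
  proof -
    have in\<rho>: "norm (T y1) < \<rho>" and w'y1: "w' y1 = \<phi>2 (y0 + T y1)"
      using y1 by (auto simp: w'_def split: if_splits)
    define m where "m = y1 - y0 - T y1"
    have m: "m \<in> int_lattice" using Tlat by (simp add: m_def)
    have y1m: "y0 + T y1 = y1 - m" by (simp add: m_def)
    obtain d' where d': "d' > 0" "\<And>y. y \<in> ball y1 d' \<Longrightarrow> norm (T y) < \<rho> \<and> y0 + T y = y - m"
      using local_in[OF in\<rho>] unfolding m_def by blast
    have le: "\<phi>2 (y + (-m)) - \<psi> y \<le> \<phi>2 (y1 + (-m)) - \<psi> y1" if y: "y \<in> ball y1 (min d d')" for y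
    proof -
      have "\<phi>2 (y - m) \<le> w' y" using d'(2)[of y] y by (simp add: w'_def)
      moreover have "w' y - \<psi> y \<le> w' y1 - \<psi> y1" using h(3) y by simp
      ultimately show ?thesis using w'y1 y1m by simp
    qed
    have "((\<lambda>y. \<phi>2 (y + (-m)) - \<psi> y) has_derivative (\<lambda>v. g2 (y1 + (-m)) \<bullet> v - h y1 \<bullet> v)) (at y1)"
      using C1_translate[OF C2, of "-m"] h(1) unfolding C1_with_gradient_def
      by (intro has_derivative_diff) auto
    then have "(\<lambda>v. g2 (y1 + (-m)) \<bullet> v - h y1 \<bullet> v) = (\<lambda>v. 0)"
      by (intro differential_zero_maxmin[of y1 "ball y1 (min d d')"]) (use le h(2) d'(1) in auto)
    then have "(g2 (y1 + (-m)) - h y1) \<bullet> (g2 (y1 + (-m)) - h y1) = 0"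
      by (metis inner_diff_left)
    then have "g2 (y1 - m) = h y1" by simp
    moreover have "F (y1 - m) (g2 (y1 - m)) < c1"
      using in\<rho> \<rho>(3) by (intro \<rho>1) (auto simp: y1m[symmetric] dist_norm)
    moreover have "F y1 (h y1) = F (y1 - m) (h y1)" using F_periodic[OF m, of "y1 - m"] by simp
    ultimately show ?thesis by simp
  qed
  have w'sub: "visc_subsolution F c \<Omega> w'"
  proof (rule visc_subsolution_openI[OF open_dom])
    fix \<psi> h x d assume *: "C1_with_gradient \<psi> h" "x \<in> \<Omega>" "d > 0" "\<And>y. y \<in> ball x d \<Longrightarrow> w' y - \<psi> y \<le> w' x - \<psi> x"
    show "F x (h x) \<le> c"
    proof (cases "w' x = w x")
      case True
      show ?thesis
      proof (rule visc_subsolutionD[OF wsub open_dom *(1-3)])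
        fix y assume "y \<in> ball x d"
        from *(4)[OF this] w'_ge[of y] True show "w y - \<psi> y \<le> w x - \<psi> x" by linarith
      qed
    next
      case False
      then have "F x (h x) < c1" using w'_ge[of x] by (intro strict[OF _ *(1,3,4)]) auto
      then show ?thesis using c1 by simp
    qed
  qed
  obtain \<rho>' where \<rho>': "\<rho>' > 0" "\<rho>' \<le> \<rho>" "\<And>y. y \<in> closure \<Omega> \<Longrightarrow> y \<in> ball y0 \<rho>' \<Longrightarrow> w y < \<phi>2 y"
  proof -
    have "continuous_on (closure \<Omega>) (\<lambda>y. w y - \<phi>2 y)"
      by (intro continuous_on_diff wcont continuous_on_subset[OF \<phi>2cont]) auto
    then have "((\<lambda>y. w y - \<phi>2 y) \<longlongrightarrow> - \<kappa>) (at y0 within closure \<Omega>)"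
      using y0 \<phi>2y0 unfolding continuous_on_def by fastforce
    then have "\<forall>\<^sub>F y in at y0 within closure \<Omega>. w y - \<phi>2 y < 0"
      using \<kappa> by (intro order_tendstoD) auto
    then obtain d where d: "d > 0" "\<And>y. y \<in> closure \<Omega> \<Longrightarrow> y \<noteq> y0 \<Longrightarrow> dist y y0 < d \<Longrightarrow> w y - \<phi>2 y < 0"
      unfolding eventually_at by blast
    have "w y < \<phi>2 y" if "y \<in> closure \<Omega>" "y \<in> ball y0 (min d \<rho>)" for y
      using d(2)[of y] that \<phi>2y0 \<kappa> by (cases "y = y0") (auto simp: dist_commute)
    with d(1) \<rho>(1) show ?thesis by (intro that[of "min d \<rho>"]) auto
  qed
  have above: "w' y > w y" if "y \<in> closure \<Omega>" "y \<in> ball y0 \<rho>'" for y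
  proof -
    have "norm (y - y0 - 0) < \<rho>" using that \<rho>' by (simp add: dist_norm norm_minus_commute)
    from Teq[OF int_lattice_0 this] this have "norm (T y) < \<rho>" "y0 + T y = y" by simp_all
    with \<rho>'(3)[OF that] show ?thesis by (simp add: w'_def)
  qed
  show ?thesis
  proof (rule that[of w' \<rho>'])
    show "w' \<in> Sub c" using w'cont w'per w'sub by (simp add: Sub_def)
    show "w' y0 > w y0" using above y0 \<rho>'(1) by simp
    show "\<rho>' > 0" by fact
    show "visc_subsolution F c1 (\<Omega> \<inter> ball y0 \<rho>') w'"
    proof (rule visc_subsolution_openI)
      fix \<psi> h x d assume *: "C1_with_gradient \<psi> h" "x \<in> \<Omega> \<inter> ball y0 \<rho>'" "d > 0"
        "\<And>y. y \<in> ball x d \<Longrightarrow> w' y - \<psi> y \<le> w' x - \<psi> x"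
      have "w' x > w x" using above *(2) closure_subset[of \<Omega>] by auto
      from strict[OF this *(1,3,4)] show "F x (h x) \<le> c1" by simp
    qed (use open_dom in auto)
    fix y assume far: "\<And>m. m \<in> int_lattice \<Longrightarrow> y - m \<notin> ball y0 R"
    have "\<not> norm (T y) < \<rho>"
    proof
      assume "norm (T y) < \<rho>"
      then have "y - (y - y0 - T y) \<in> ball y0 R" using \<rho> by (simp add: dist_norm)
      with far[OF Tlat[of y]] show False by blast
    qed
    then show "w' y = w y" by (simp add: w'_def)
  qed
qed

text \<open>A failure can only occur at a lattice translate of \<open>a\<close>: elsewhere the bump
  leaves the value at \<open>a\<close> unchanged and so contradicts maximality of
  \<open>top_sub\<close>. By periodicity the strictness gained there is moved to
  \<open>a\<close>.\<close>

lemma strict_near_or_solution: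
  assumes a: "a \<in> closure \<Omega>" and not_super: "\<not> visc_supersolution F crit (closure \<Omega>) (top_sub crit a)"
  shows "\<exists>\<rho>>0. \<exists>c1 w. 0 \<le> c1 \<and> c1 < crit \<and> w \<in> Sub crit \<and> visc_subsolution F c1 (\<Omega> \<inter> ball a \<rho>) w"
proof -
  let ?w = "top_sub crit a"
  have w: "?w \<in> Sub crit" by (rule top_sub_in_Sub[OF crit_nonneg Sub_crit_nonempty a])
  obtain \<phi> g y0 where C1: "C1_with_gradient \<phi> g" and min: "local_min_rel (closure \<Omega>) (\<lambda>y. ?w y - \<phi> y) y0"
    and F: "F y0 (g y0) < crit"
    using not_super unfolding visc_supersolution_def by force
  have y0: "y0 \<in> closure \<Omega>" using min by (simp add: local_min_rel_def)
  define c1 where "c1 = (F y0 (g y0) + crit) / 2"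
  have c1: "F y0 (g y0) < c1" "c1 \<le> crit" "c1 < crit" "0 \<le> c1"
    using F F_nonneg[of y0 "g y0"] crit_nonneg by (auto simp: c1_def)
  define t where "t = cell_rep (a - y0)"
  have t0: "t = 0"
  proof (rule ccontr)
    assume "t \<noteq> 0"
    \<comment> \<open>Small enough that no lattice translate of the ball around \<open>y0\<close>
      contains \<open>a\<close>; the bound \<open>1/2\<close> lets the nearest translate be
      identified through \<open>cell_rep\<close>.\<close>
    define R where "R = min (norm t) (1/2)"
    have R: "R > 0" using \<open>t \<noteq> 0\<close> by (simp add: R_def)
    obtain w' \<rho>' where w': "w' \<in> Sub crit" "w' y0 > ?w y0"
      "\<And>y. (\<And>m. m \<in> int_lattice \<Longrightarrow> y - m \<notin> ball y0 R) \<Longrightarrow> w' y = ?w y"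
      using bump[OF w C1 min c1(1,2) R] by blast
    have "w' a = ?w a"
    proof (rule w'(3))
      fix m :: "real^'n" assume m: "m \<in> int_lattice"
      show "a - m \<notin> ball y0 R"
      proof
        assume "a - m \<in> ball y0 R"
        then have n: "norm (a - y0 - m) < R" by (simp add: dist_norm norm_minus_commute algebra_simps)
        then have "a - y0 - m \<in> ball 0 (1/2)" by (simp add: R_def)
        then have "t = a - y0 - m" unfolding t_def using m ball_half_subset_box by (intro cell_rep_eq) blast+
        with n show False by (simp add: R_def)
      qed
    qed
    then have "w' a = 0" using top_sub_self[OF Sub_crit_nonempty] by simp
    from top_sub_upper[OF w'(1) this a y0] w'(2) show False by simp
  qed
  define m where "m = a - y0"
  have m: "m \<in> int_lattice" using cell_rep_lattice[of "a - y0"] t0 by (simp add: m_def t_def)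
  obtain w' \<rho>' where w': "w' \<in> Sub crit" "\<rho>' > 0" "visc_subsolution F c1 (\<Omega> \<inter> ball y0 \<rho>') w'"
    using bump[OF w C1 min c1(1,2) zero_less_one] by blast
  have "visc_subsolution F c1 ((\<lambda>x. x + m) ` (\<Omega> \<inter> ball y0 \<rho>')) w'"
    using w' open_dom m F_periodic by (intro visc_subsolution_translate) (auto simp: Sub_def)
  moreover have "\<Omega> \<inter> ball a \<rho>' \<subseteq> (\<lambda>x. x + m) ` (\<Omega> \<inter> ball y0 \<rho>')"
  proof
    fix x assume x: "x \<in> \<Omega> \<inter> ball a \<rho>'"
    then have "x + (-m) \<in> \<Omega>" using m periodic_dom int_lattice_minus by blast
    moreover have "x - m \<in> ball y0 \<rho>'" using x by (simp add: m_def dist_norm algebra_simps)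
    ultimately show "x \<in> (\<lambda>x. x + m) ` (\<Omega> \<inter> ball y0 \<rho>')" by (intro image_eqI[of _ _ "x - m"]) auto
  qed
  moreover have "open ((\<lambda>x. x + m) ` (\<Omega> \<inter> ball y0 \<rho>'))"
    using open_translation[of "\<Omega> \<inter> ball y0 \<rho>'" m] open_dom by (simp add: add.commute open_Int)
  ultimately have "visc_subsolution F c1 (\<Omega> \<inter> ball a \<rho>') w'"
    using open_dom by (intro visc_subsolution_open_subset[of F c1 _ w' "\<Omega> \<inter> ball a \<rho>'"]) auto
  with w' c1 show ?thesis by blast
qed

text \<open>On \<open>N1\<close> the average has level at most \<open>(c1 + c) / 2\<close> and on
  \<open>N2\<close> at most \<open>(c + c2) / 2\<close>, both below \<open>c\<close>, so strictness
  in either place survives.\<close>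

lemma strict_union:
  assumes N: "open N1" "open N2"
    and 1: "0 \<le> c1" "c1 < c" "u \<in> Sub c" "visc_subsolution F c1 (\<Omega> \<inter> N1) u"
    and 2: "0 \<le> c2" "c2 < c" "v \<in> Sub c" "visc_subsolution F c2 (\<Omega> \<inter> N2) v"
  shows "\<exists>c3 w. 0 \<le> c3 \<and> c3 < c \<and> w \<in> Sub c \<and> visc_subsolution F c3 (\<Omega> \<inter> (N1 \<union> N2)) w"
proof -
  define w where "w y = (u y + v y) / 2" for y
  define c3 where "c3 = max ((c1 + c) / 2) ((c + c2) / 2)"
  have cont: "continuous_on (closure \<Omega>) u" "continuous_on (closure \<Omega>) v" using 1 2 by (auto simp: Sub_def)
  then have contO: "continuous_on S u" "continuous_on S v" if "S \<subseteq> \<Omega>" for S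
    using that closure_subset[of \<Omega>] by (blast intro: continuous_on_subset)+
  have sub: "visc_subsolution F c S u" "visc_subsolution F c S v" if "open S" "S \<subseteq> \<Omega>" for S
    using 1(3) 2(3) that open_dom by (auto simp: Sub_def intro: visc_subsolution_open_subset)
  have z: "F x q0 \<le> b" if "0 \<le> b" for x b using F_zero that by simp
  have o: "open (\<Omega> \<inter> N1)" "open (\<Omega> \<inter> N2)" using open_dom N by auto
  have "visc_subsolution F ((c1 + c) / 2) (\<Omega> \<inter> N1) w"
    unfolding w_def by (rule visc_sub_average[OF o(1) contO(1) 1(4) contO(2) sub(2)[OF o(1)] z z]) (use 1 in auto)
  moreover have "visc_subsolution F ((c + c2) / 2) (\<Omega> \<inter> N2) w"
    unfolding w_def by (rule visc_sub_average[OF o(2) contO(1) sub(1)[OF o(2)] contO(2) 2(4) z z]) (use 2 in auto)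
  ultimately have "visc_subsolution F c3 (\<Omega> \<inter> N1 \<union> \<Omega> \<inter> N2) w"
    using o by (intro visc_subsolution_Un) (auto simp: c3_def elim!: visc_subsolution_mono)
  moreover have "visc_subsolution F ((c + c) / 2) \<Omega> w"
    unfolding w_def by (rule visc_sub_average[OF open_dom contO(1) sub(1)[OF open_dom] contO(2) sub(2)[OF open_dom] z z]) (use 1 in auto)
  then have "w \<in> Sub c"
    using 1(3) 2(3) cont unfolding Sub_def periodic_on_def w_def by (auto intro!: continuous_intros)
  moreover have "0 \<le> c3" "c3 < c" using 1(1,2) 2(1,2) by (auto simp: c3_def max_def)
  ultimately show ?thesis unfolding Int_Un_distrib by blast
qed

text \<open>If no base point gives a solution, finitely many regions of strictness cover the part of
  the closure in one cell. Merging them yields a subsolution strictly below the critical level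
  there, and by periodicity on the whole domain, against minimality.\<close>

theorem cell_solution_exists:
  obtains c v where "0 \<le> c" "v \<in> Sub c" "visc_supersolution F c (closure \<Omega>) v"
proof (cases "\<exists>a\<in>closure \<Omega>. visc_supersolution F crit (closure \<Omega>) (top_sub crit a)")
  case True
  then show ?thesis using that crit_nonneg top_sub_in_Sub[OF crit_nonneg Sub_crit_nonempty] by blast
next
  case False
  let ?K = "closure \<Omega> \<inter> unit_cell"
  have "\<exists>\<rho>>0. \<exists>c1 w. 0 \<le> c1 \<and> c1 < crit \<and> w \<in> Sub crit \<and> visc_subsolution F c1 (\<Omega> \<inter> ball a \<rho>) w"
    if "a \<in> ?K" for a
    using strict_near_or_solution[of a] False that by blast
  then obtain \<rho> where \<rho>: "\<And>a. a \<in> ?K \<Longrightarrow> \<rho> a > 0"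
    "\<And>a. a \<in> ?K \<Longrightarrow> \<exists>c1 w. 0 \<le> c1 \<and> c1 < crit \<and> w \<in> Sub crit \<and> visc_subsolution F c1 (\<Omega> \<inter> ball a (\<rho> a)) w"
    by metis
  have "compact ?K" by (simp add: closed_Int_compact)
  moreover have "?K \<subseteq> (\<Union>a\<in>?K. ball a (\<rho> a))" using \<rho>(1) by force
  ultimately obtain C where C: "C \<subseteq> ?K" "finite C" "?K \<subseteq> (\<Union>a\<in>C. ball a (\<rho> a))"
    using compactE_image[of ?K ?K "\<lambda>a. ball a (\<rho> a)"] by auto
  have Kne: "?K \<noteq> {}" using nonempty_dom closure_subset[of \<Omega>] cell_rep_closure cell_rep_in_cell by blast
  then have "C \<noteq> {}" using C(3) by auto
  from C(2) this C(1) have "\<exists>c1 w. 0 \<le> c1 \<and> c1 < crit \<and> w \<in> Sub crit \<and> visc_subsolution F c1 (\<Omega> \<inter> (\<Union>a\<in>C. ball a (\<rho> a))) w"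
  proof (induction C rule: finite_ne_induct)
    case (singleton a)
    then show ?case using \<rho>(2)[of a] by simp
  next
    case (insert a C)
    obtain c1 u where 1: "0 \<le> c1" "c1 < crit" "u \<in> Sub crit" "visc_subsolution F c1 (\<Omega> \<inter> ball a (\<rho> a)) u"
      using \<rho>(2)[of a] insert.prems by blast
    obtain c2 v where 2: "0 \<le> c2" "c2 < crit" "v \<in> Sub crit" "visc_subsolution F c2 (\<Omega> \<inter> (\<Union>a\<in>C. ball a (\<rho> a))) v"
      using insert by blast
    show ?case using strict_union[OF open_ball _ 1 2] by auto
  qed
  then obtain c1 w where cw: "0 \<le> c1" "c1 < crit" "w \<in> Sub crit" "visc_subsolution F c1 (\<Omega> \<inter> (\<Union>a\<in>C. ball a (\<rho> a))) w"
    by blast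
  define N where "N = \<Omega> \<inter> (\<Union>a\<in>C. ball a (\<rho> a))"
  have N: "open N" "N \<subseteq> \<Omega>" using open_dom by (auto simp: N_def)
  have wper: "periodic_on (closure \<Omega>) w" using cw(3) by (simp add: Sub_def)
  have "visc_subsolution F c1 \<Omega> w"
  proof (rule visc_subsolution_openI[OF open_dom])
    fix \<phi> g x d assume *: "C1_with_gradient \<phi> g" "x \<in> \<Omega>" "d > 0" "\<And>y. y \<in> ball x d \<Longrightarrow> w y - \<phi> y \<le> w x - \<phi> x"
    define m where "m = x - cell_rep x"
    have m: "m \<in> int_lattice" unfolding m_def by (rule cell_rep_lattice)
    have "cell_rep x \<in> N"
      using C(3) cell_rep_dom[OF *(2)] cell_rep_in_cell[of x] closure_subset[of \<Omega>] unfolding N_def by blast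
    then have xin: "x \<in> (\<lambda>x. x + m) ` N" by (intro image_eqI[of _ _ "cell_rep x"]) (auto simp: m_def)
    have "visc_subsolution F c1 ((\<lambda>x. x + m) ` N) w"
      using visc_subsolution_translate[OF wper cw(4)[folded N_def] N m F_periodic[OF m]] .
    moreover have "open ((\<lambda>x. x + m) ` N)"
      using open_translation[OF N(1), of m] by (simp add: add.commute)
    ultimately show "F x (g x) \<le> c1" using visc_subsolutionD *(1,3,4) xin by blast
  qed
  then have "w \<in> Sub c1" using cw(3) by (simp add: Sub_def)
  then have "crit \<le> c1" using crit_le[OF cw(1)] by blast
  with cw(2) show ?thesis by simp
qed

end

section \<open>Geometry of the perforated space\<close>

text \<open>The graph function has a Lipschitz constant \<Lambda> near \<open>x0\<close>. Moving
  along the axis out of the region changes height at unit rate and leaves \<gamma> fixed; a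
  perturbation of the direction by \<eta> costs at most
  \<open>(\<Lambda> + 1) * norm \<eta>\<close>. Base points need only lie outside \<open>D\<close>,
  so frontier points are included.\<close>

lemma C1_boundary_exterior_cone:
  fixes D :: "(real^'n) set"
  assumes "C1_boundary D" "x0 \<in> frontier D"
  obtains e \<delta> where "\<delta> > 0"
    "\<And>y e' s. \<lbrakk>y \<in> ball x0 \<delta>; y \<notin> D; e' \<in> ball e \<delta>; 0 < s; s < \<delta>\<rbrakk> \<Longrightarrow> y + s *\<^sub>R e' \<notin> closure D"
proof -
  obtain r i \<sigma> \<gamma> g where r: "r > 0" and \<sigma>: "\<sigma> \<in> {-1, 1::real}" and C1: "C1_with_gradient \<gamma> g"
    and inv: "\<And>x t. \<gamma> (x + t *\<^sub>R axis i 1) = \<gamma> x"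
    and D: "D \<inter> ball x0 r = {x \<in> ball x0 r. \<gamma> x < \<sigma> * (x $ i)}"
    using assms unfolding C1_boundary_def by blast
  have \<sigma>2: "\<sigma> * \<sigma> = 1" "\<bar>\<sigma>\<bar> = 1" using \<sigma> by auto
  have "continuous_on (cball x0 r) g"
    using C1 unfolding C1_with_gradient_def by (auto intro: continuous_on_subset)
  from compact_imp_bounded[OF compact_continuous_image[OF this compact_cball]]
  obtain \<Lambda> where \<Lambda>: "\<Lambda> > 0" "\<And>x. x \<in> cball x0 r \<Longrightarrow> norm (g x) \<le> \<Lambda>"
    unfolding bounded_pos by auto
  have \<gamma>': "(\<gamma> has_derivative (\<lambda>h. g x \<bullet> h)) (at x)" for x
    using C1 by (simp add: C1_with_gradient_def)
  have \<gamma>cont: "continuous_on UNIV \<gamma>"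
  proof (rule has_derivative_continuous_on)
    show "(\<gamma> has_derivative (\<bullet>) (g x)) (at x within UNIV)" for x using \<gamma>' by simp
  qed
  have lip: "\<bar>\<gamma> a - \<gamma> b\<bar> \<le> \<Lambda> * norm (a - b)" if "a \<in> ball x0 r" "b \<in> ball x0 r" for a b
  proof -
    have "norm (\<gamma> a - \<gamma> b) \<le> \<Lambda> * norm (a - b)"
    proof (rule differentiable_bound[OF convex_ball])
      show "(\<gamma> has_derivative (\<lambda>h. g x \<bullet> h)) (at x within ball x0 r)" for x
        using \<gamma>' by (rule has_derivative_at_withinI)
      fix x assume x: "x \<in> ball x0 r"
      show "onorm (\<lambda>h. g x \<bullet> h) \<le> \<Lambda>"
      proof (rule onorm_le)
        fix h
        have "norm (g x \<bullet> h) \<le> norm (g x) * norm h" using Cauchy_Schwarz_ineq2 by simp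
        also have "\<dots> \<le> \<Lambda> * norm h" using \<Lambda>(2)[of x] x by (intro mult_right_mono) auto
        finally show "norm (g x \<bullet> h) \<le> \<Lambda> * norm h" .
      qed
    qed (use that in auto)
    then show ?thesis by simp
  qed
  define e :: "real^'n" where "e = - \<sigma> *\<^sub>R axis i 1"
  have ne: "norm e = 1" using \<sigma>2 by (simp add: e_def)
  \<comment> \<open>\<open>r / 4\<close> keeps the displaced points in the graph chart, and the last
    term gives \<open>(\<Lambda> + 1) * \<delta> < 1\<close>, a positive net rate of exit.\<close>
  define \<delta> where "\<delta> = min (min 1 (r/4)) (1 / (2 * (\<Lambda> + 1)))"
  have "1 / (2 * (\<Lambda> + 1)) > 0" using \<Lambda> by simp
  then have \<delta>: "\<delta> > 0" "\<delta> \<le> 1" "\<delta> \<le> r/4" "\<delta> \<le> 1 / (2 * (\<Lambda> + 1))" using r by (auto simp: \<delta>_def)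
  then have \<delta>\<Lambda>: "(\<Lambda> + 1) * \<delta> < 1" using \<Lambda> by (simp add: field_simps)
  show ?thesis
  proof (rule that[OF \<delta>(1), of e])
    fix y e' s assume y: "y \<in> ball x0 \<delta>" "y \<notin> D" and e': "e' \<in> ball e \<delta>" and s: "0 < s" "s < \<delta>"
    define \<eta> where "\<eta> = e' - e"
    have n\<eta>: "norm \<eta> < \<delta>" using e' by (simp add: \<eta>_def dist_norm norm_minus_commute)
    define y' where "y' = y + s *\<^sub>R e'"
    have sn: "s * norm v \<le> \<delta> * 2" if "norm v \<le> 2" for v :: "real^'n"
      using s that by (intro mult_mono) auto
    have "norm e' \<le> 2" using norm_triangle_ineq[of e \<eta>] ne n\<eta> \<delta>(2) by (simp add: \<eta>_def)
    then have "dist x0 y' \<le> dist x0 y + \<delta> * 2"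
      using sn[of e'] norm_triangle_ineq4[of "x0 - y" "s *\<^sub>R e'"] s by (simp add: y'_def dist_norm algebra_simps)
    then have y'r: "y' \<in> ball x0 r" using y(1) \<delta> by simp
    have "norm \<eta> \<le> 2" using n\<eta> \<delta> by simp
    then have "dist x0 (y + s *\<^sub>R \<eta>) \<le> dist x0 y + \<delta> * 2"
      using sn[of \<eta>] norm_triangle_ineq4[of "x0 - y" "s *\<^sub>R \<eta>"] s by (simp add: dist_norm algebra_simps)
    then have yr\<eta>: "y + s *\<^sub>R \<eta> \<in> ball x0 r" using y(1) \<delta> by simp
    have yr: "y \<in> ball x0 r" using y(1) \<delta> by simp
    have y0: "\<sigma> * (y $ i) \<le> \<gamma> y" using D yr y(2) by force
    have "y' = (y + s *\<^sub>R \<eta>) + (- (s * \<sigma>)) *\<^sub>R axis i 1"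
      by (simp add: y'_def \<eta>_def e_def algebra_simps)
    then have "\<gamma> y' = \<gamma> (y + s *\<^sub>R \<eta>)" using inv by metis
    moreover have "\<bar>\<gamma> (y + s *\<^sub>R \<eta>) - \<gamma> y\<bar> \<le> \<Lambda> * (s * norm \<eta>)"
      using lip[OF yr\<eta> yr] s by simp
    ultimately have g1: "\<gamma> y' \<ge> \<gamma> y - \<Lambda> * (s * norm \<eta>)" by linarith
    have y'i: "y' $ i = y $ i + s * (- \<sigma> + \<eta> $ i)" by (simp add: y'_def \<eta>_def e_def)
    have "\<sigma> * (y' $ i) = \<sigma> * (y $ i) + s * (\<sigma> * (- \<sigma> + \<eta> $ i))"
      unfolding y'i by (simp add: algebra_simps)
    also have "\<sigma> * (- \<sigma> + \<eta> $ i) = - 1 + \<sigma> * \<eta> $ i" using \<sigma>2 by (simp add: algebra_simps)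
    also have "s * (- 1 + \<sigma> * \<eta> $ i) \<le> s * (- 1 + norm \<eta>)"
    proof -
      have "\<sigma> * \<eta> $ i \<le> \<bar>\<sigma> * \<eta> $ i\<bar>" by simp
      also have "\<dots> \<le> norm \<eta>" using \<sigma>2 component_le_norm_cart[of \<eta> i] by (simp add: abs_mult)
      finally show ?thesis using s by simp
    qed
    finally have "\<sigma> * (y' $ i) \<le> \<sigma> * (y $ i) - s + s * norm \<eta>" by (simp add: algebra_simps)
    then have "\<sigma> * (y' $ i) - \<gamma> y' \<le> s * ((\<Lambda> + 1) * norm \<eta> - 1)"
      using y0 g1 by (simp add: algebra_simps)
    also have "\<dots> < 0"
    proof -
      have "(\<Lambda> + 1) * norm \<eta> \<le> (\<Lambda> + 1) * \<delta>" using n\<eta> \<Lambda> by (intro mult_left_mono) auto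
      then show ?thesis using \<delta>\<Lambda> s by (simp add: mult_less_0_iff)
    qed
    finally have below: "\<sigma> * (y' $ i) < \<gamma> y'" by simp
    define W where "W = ball x0 r \<inter> {x. \<sigma> * (x $ i) < \<gamma> x}"
    have "open {x. \<sigma> * (x $ i) < \<gamma> x}"
      by (intro open_Collect_less continuous_intros \<gamma>cont)
    then have "open W" unfolding W_def by (rule open_Int[OF open_ball])
    moreover have "W \<inter> D = {}" using D unfolding W_def by force
    ultimately have "W \<inter> closure D = {}" by (simp add: open_Int_closure_eq_empty)
    moreover have "y' \<in> W" using y'r below by (simp add: W_def)
    ultimately show "y + s *\<^sub>R e' \<notin> closure D" unfolding y'_def by blast
  qed
qed

lemma inward_diff:
  fixes D :: "(real^'n) set"
  assumes D: "open D" "C1_boundary D" and U: "open U" and z: "z \<in> frontier D" "z \<in> U"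
  shows "\<exists>e \<delta>. inward (U - closure D) z e \<delta>"
proof -
  obtain e \<delta> where \<delta>: "\<delta> > 0"
    and cone: "\<And>y e' s. \<lbrakk>y \<in> ball z \<delta>; y \<notin> D; e' \<in> ball e \<delta>; 0 < s; s < \<delta>\<rbrakk> \<Longrightarrow> y + s *\<^sub>R e' \<notin> closure D"
    by (rule C1_boundary_exterior_cone[OF D(2) z(1)]) blast
  obtain \<rho> where \<rho>: "\<rho> > 0" "ball z \<rho> \<subseteq> U" using U z(2) by (rule openE)
  define \<delta>' where "\<delta>' = min (min \<delta> 1) (\<rho> / (norm e + 2))"
  have "\<rho> / (norm e + 2) > 0" using \<rho> by (intro divide_pos_pos) (auto intro: add_nonneg_pos)
  then have \<delta>': "\<delta>' > 0" "\<delta>' \<le> \<delta>" "\<delta>' \<le> 1" "\<delta>' \<le> \<rho> / (norm e + 2)" using \<delta> by (auto simp: \<delta>'_def)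
  have "norm e + 2 > 0" by (simp add: add_nonneg_pos)
  then have \<delta>\<rho>: "\<delta>' * (norm e + 2) \<le> \<rho>" using \<delta>'(4) by (simp add: pos_le_divide_eq)
  have disj: "D \<inter> closure (U - closure D) = {}"
    using D(1) closure_subset[of D] by (subst open_Int_closure_eq_empty) auto
  have "inward (U - closure D) z e \<delta>'"
    unfolding inward_def
  proof (intro conjI ballI)
    fix y e' s assume y: "y \<in> closure (U - closure D) \<inter> ball z \<delta>'" and e': "e' \<in> ball e \<delta>'" and s: "s \<in> {0<..<\<delta>'}"
    have "y + s *\<^sub>R e' \<notin> closure D"
      using y e' s \<delta>' disj by (intro cone) auto
    moreover have "y + s *\<^sub>R e' \<in> U"
    proof -
      have "norm e' \<le> norm e + 1" using e' \<delta>'(3) norm_triangle_ineq[of e "e' - e"] by (simp add: dist_norm norm_minus_commute)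
      then have "s * norm e' \<le> \<delta>' * (norm e + 1)" using s by (intro mult_mono) auto
      moreover have "dist z (y + s *\<^sub>R e') \<le> dist z y + s * norm e'"
        using norm_triangle_ineq4[of "z - y" "s *\<^sub>R e'"] s by (simp add: dist_norm algebra_simps)
      ultimately have "dist z (y + s *\<^sub>R e') < \<delta>' + \<delta>' * (norm e + 1)" using y by simp
      also have "\<dots> = \<delta>' * (norm e + 2)" by (simp add: algebra_simps)
      finally have "dist z (y + s *\<^sub>R e') < \<rho>" using \<delta>\<rho> by linarith
      then show ?thesis using \<rho>(2) by auto
    qed
    ultimately show "y + s *\<^sub>R e' \<in> U - closure D" by blast
  qed (rule \<delta>'(1))
  then show ?thesis by blast
qed

text \<open>A separation of \<open>U - closure D\<close> would extend across the hole, because it assigns a side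
  locally constantly, hence constantly, to the points of the connected frontier.\<close>

lemma connected_diff:
  fixes D :: "(real^'n) set"
  assumes D: "open D" "C1_boundary D" "connected (frontier D)" and U: "open U" "connected U" and DU: "closure D \<subseteq> U"
  shows "connected (U - closure D)"
proof (rule ccontr)
  define \<Omega> where "\<Omega> = U - closure D"
  assume "\<not> connected (U - closure D)"
  then obtain A B where AB: "open A" "open B" "\<Omega> \<subseteq> A \<union> B" "A \<inter> B \<inter> \<Omega> = {}" "A \<inter> \<Omega> \<noteq> {}" "B \<inter> \<Omega> \<noteq> {}"
    unfolding connected_def \<Omega>_def by blast
  have o\<Omega>: "open \<Omega>" unfolding \<Omega>_def using U(1) by (simp add: open_Diff)
  have fr: "frontier D \<subseteq> U" using DU by (auto simp: frontier_def)
  \<comment> \<open>Short paths inside the domain join any two of its points near \<open>z\<close>,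
    so the domain near a frontier point lies on one side of the separation.\<close>
  have side: "\<exists>r>0. ball z r \<inter> \<Omega> \<subseteq> A \<or> ball z r \<inter> \<Omega> \<subseteq> B" if z: "z \<in> frontier D" for z
  proof -
    obtain e \<delta> where inw: "inward \<Omega> z e \<delta>"
      using inward_diff[OF D(1,2) U(1) z] fr z unfolding \<Omega>_def by blast
    obtain r C where r: "r > 0" and path: "\<And>y y'. \<lbrakk>y \<in> \<Omega> \<inter> ball z r; y' \<in> \<Omega> \<inter> ball z r\<rbrakk> \<Longrightarrow>
      \<exists>a b. closed_segment y a \<subseteq> \<Omega> \<and> closed_segment a b \<subseteq> \<Omega> \<and> closed_segment b y' \<subseteq> \<Omega> \<and>
        dist y a + dist a b + dist b y' \<le> C * dist y y'"
      by (rule inward_path[OF inw]) blast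
    have "False" if y: "y \<in> ball z r \<inter> \<Omega>" "y \<in> A" and y': "y' \<in> ball z r \<inter> \<Omega>" "y' \<in> B" for y y'
    proof -
      obtain a b where ab: "closed_segment y a \<subseteq> \<Omega>" "closed_segment a b \<subseteq> \<Omega>" "closed_segment b y' \<subseteq> \<Omega>"
        using path[of y y'] y y' by blast
      define P where "P = closed_segment y a \<union> closed_segment a b \<union> closed_segment b y'"
      have "connected (closed_segment y a \<union> closed_segment a b)"
        by (rule connected_Un) (use ends_in_segment in blast)+
      then have "connected P" unfolding P_def
        by (rule connected_Un) (use ends_in_segment in blast)+
      moreover have "P \<subseteq> \<Omega>" using ab by (simp add: P_def)
      moreover have "y \<in> P" "y' \<in> P" by (auto simp: P_def)
      ultimately show False using connectedD[of P A B] AB y(2) y'(2) by blast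
    qed
    then have "ball z r \<inter> \<Omega> \<subseteq> A \<or> ball z r \<inter> \<Omega> \<subseteq> B" using AB(3) by blast
    with r show ?thesis by blast
  qed
  \<comment> \<open>Each frontier point is approached from outside the hole; otherwise a side could
    be assigned vacuously and both sides at once.\<close>
  have near: "ball z r \<inter> \<Omega> \<noteq> {}" if z: "z \<in> frontier D" "r > 0" for z r
  proof -
    obtain e \<delta> where \<delta>: "\<delta> > 0"
      and cone: "\<And>y e' s. \<lbrakk>y \<in> ball z \<delta>; y \<notin> D; e' \<in> ball e \<delta>; 0 < s; s < \<delta>\<rbrakk> \<Longrightarrow> y + s *\<^sub>R e' \<notin> closure D"
      by (rule C1_boundary_exterior_cone[OF D(2) z(1)]) blast
    have zD: "z \<notin> D" using z(1) D(1) by (simp add: frontier_def interior_open)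
    have "((\<lambda>s. z + s *\<^sub>R e) \<longlongrightarrow> z + 0 *\<^sub>R e) (at_right 0)" by (intro tendsto_intros)
    then have "\<forall>\<^sub>F s in at_right 0. z + s *\<^sub>R e \<in> U \<inter> ball z r"
      by (rule topological_tendstoD) (use U(1) fr z in auto)
    moreover have "\<forall>\<^sub>F s in at_right 0. 0 < s \<and> s < \<delta>"
      using \<delta> by (auto simp: eventually_at_right_field)
    ultimately have "\<forall>\<^sub>F s in at_right 0. z + s *\<^sub>R e \<in> U \<inter> ball z r \<and> 0 < s \<and> s < \<delta>"
      by eventually_elim simp
    then obtain s where s: "z + s *\<^sub>R e \<in> U \<inter> ball z r" "0 < s" "s < \<delta>"
      using eventually_happens'[OF trivial_limit_at_right_real] by blast
    then have "z + s *\<^sub>R e \<notin> closure D" using zD \<delta> by (intro cone) auto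
    with s(1) show ?thesis unfolding \<Omega>_def by blast
  qed
  define OA where "OA X = \<Union>{ball z r | z r. ball z r \<inter> \<Omega> \<subseteq> X}" for X
  have OA: "open (OA X)" "OA X \<inter> \<Omega> \<subseteq> X" for X unfolding OA_def by (auto intro!: open_Union)
  have inOA: "z \<in> OA X" if "r > 0" "ball z r \<inter> \<Omega> \<subseteq> X" for z r X
    unfolding OA_def using that centre_in_ball by blast
  have cover: "frontier D \<subseteq> OA A \<union> OA B" using side inOA by blast
  have "OA A \<inter> OA B \<inter> frontier D = {}"
  proof (rule ccontr)
    assume "\<not> ?thesis"
    then obtain z where z: "z \<in> OA A \<inter> OA B" "z \<in> frontier D" by blast
    have "open (OA A \<inter> OA B)" using OA(1) by blast
    then obtain r where "r > 0" "ball z r \<subseteq> OA A \<inter> OA B" using z(1) by (rule openE)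
    then have "ball z r \<inter> \<Omega> \<subseteq> A \<inter> B \<inter> \<Omega>" using OA(2) by blast
    with near[OF z(2) \<open>r > 0\<close>] AB(4) show False by blast
  qed
  then have "OA A \<inter> frontier D = {} \<or> OA B \<inter> frontier D = {}"
    using connectedD[OF D(3) OA(1) OA(1) _ cover] by blast
  moreover have False if fX: "frontier D \<subseteq> OA X" and X: "open X" "open Y" "\<Omega> \<subseteq> X \<union> Y" "X \<inter> Y \<inter> \<Omega> = {}" "X \<inter> \<Omega> \<noteq> {}" "Y \<inter> \<Omega> \<noteq> {}"
    for X Y
  proof -
    \<comment> \<open>The side \<open>X\<close> that owns the frontier absorbs the hole and a
      neighbourhood of the frontier, giving a separation of the connected set
      \<open>U\<close>.\<close>
    define V where "V = X \<inter> \<Omega> \<union> D \<union> OA X"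
    have "open V" unfolding V_def using X(1) o\<Omega> D(1) OA(1) by blast
    moreover have "open (Y \<inter> \<Omega>)" using X(2) o\<Omega> by blast
    moreover have "U \<subseteq> V \<union> (Y \<inter> \<Omega>)"
    proof
      fix x assume "x \<in> U"
      then show "x \<in> V \<union> (Y \<inter> \<Omega>)"
        using X(3) fX D(1) unfolding V_def \<Omega>_def frontier_def by (auto simp: interior_open)
    qed
    moreover have "D \<inter> \<Omega> = {}" using closure_subset[of D] by (auto simp: \<Omega>_def)
    then have "V \<inter> (Y \<inter> \<Omega>) \<inter> U = {}"
      using X(4) OA(2)[of X] unfolding V_def by blast
    ultimately have "V \<inter> U = {} \<or> Y \<inter> \<Omega> \<inter> U = {}"
      using connectedD[OF U(2), of V "Y \<inter> \<Omega>"] by blast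
    moreover have "\<Omega> \<subseteq> U" by (auto simp: \<Omega>_def)
    ultimately show False using X(5,6) unfolding V_def by blast
  qed
  from this[of B A] this[of A B] have "\<not> frontier D \<subseteq> OA B" "\<not> frontier D \<subseteq> OA A" using AB by blast+
  ultimately show False using cover by blast
qed

section \<open>The lattice of holes and the dilated cell\<close>

lemma int_lattice_closed: "closed (int_lattice :: (real^'n) set)"
proof -
  have "closed {m :: real^'n. m $ i \<in> \<int>}" for i
  proof -
    have "continuous_on UNIV (\<lambda>m :: real^'n. m $ i)" by (intro continuous_intros)
    from closed_vimage[OF closed_Ints this] show ?thesis by (simp add: vimage_def)
  qed
  then show ?thesis unfolding int_lattice_def by (intro closed_Collect_all)
qed

lemma mem_perforated_space:
  "y \<in> perforated_space D t \<longleftrightarrow> (\<forall>m\<in>int_lattice. \<forall>x\<in>closure D. y \<noteq> m + t *\<^sub>R x)"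
  unfolding perforated_space_def by auto

lemma perforated_space_open:
  fixes D :: "(real^'n) set"
  assumes "compact (closure D)"
  shows "open (perforated_space D t)"
proof -
  have "compact ((\<lambda>x. t *\<^sub>R x) ` closure D)" by (rule compact_scaling[OF assms])
  from closed_compact_sums[OF int_lattice_closed this]
  have "closed (\<Union>m\<in>int_lattice. (\<lambda>x. m + t *\<^sub>R x) ` closure D)"
    by (rule back_subst[of closed]) auto
  then show ?thesis unfolding perforated_space_def by (simp add: open_Diff)
qed

lemma perforated_space_periodic:
  assumes "x \<in> perforated_space D t" "m \<in> int_lattice"
  shows "x + m \<in> perforated_space D t"
  unfolding mem_perforated_space
proof (intro ballI notI)
  fix k y assume "k \<in> int_lattice" "y \<in> closure D" "x + m = k + t *\<^sub>R y"
  then have "k - m \<in> int_lattice" "x = (k - m) + t *\<^sub>R y"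
    using assms(2) by (auto simp: int_lattice_diff algebra_simps)
  with assms(1) \<open>y \<in> closure D\<close> show False unfolding mem_perforated_space by blast
qed

lemma scaled_box:
  fixes x :: "real^'n"
  assumes "x \<in> open_cell" "0 \<le> t" "t \<le> 1"
  shows "t *\<^sub>R x \<in> open_cell"
proof -
  have "- 1/2 < t * x $ i \<and> t * x $ i < 1 / 2" for i
  proof -
    have "\<bar>x $ i\<bar> < 1/2" using assms(1) by (auto simp: mem_box_cart abs_less_iff dest!: spec[of _ i])
    moreover have "\<bar>t * x $ i\<bar> \<le> 1 * \<bar>x $ i\<bar>" unfolding abs_mult using assms by (intro mult_right_mono) auto
    ultimately have "\<bar>t * x $ i\<bar> < 1/2" by linarith
    then show ?thesis unfolding abs_less_iff by linarith
  qed
  then show ?thesis by (simp add: mem_box_cart)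
qed

lemma perforated_space_iff:
  fixes D :: "(real^'n) set"
  assumes D: "closure D \<subseteq> open_cell" and t: "0 < t" "t \<le> 1"
  shows "y \<in> perforated_space D t \<longleftrightarrow> (1/t) *\<^sub>R cell_rep y \<notin> closure D"
proof
  assume "y \<in> perforated_space D t"
  moreover have "y = (y - cell_rep y) + t *\<^sub>R ((1/t) *\<^sub>R cell_rep y)" using t by simp
  ultimately show "(1/t) *\<^sub>R cell_rep y \<notin> closure D"
    using cell_rep_lattice[of y] unfolding mem_perforated_space by blast
next
  assume *: "(1/t) *\<^sub>R cell_rep y \<notin> closure D"
  show "y \<in> perforated_space D t"
    unfolding mem_perforated_space
  proof (intro ballI notI)
    fix k x assume kx: "k \<in> int_lattice" "x \<in> closure D" "y = k + t *\<^sub>R x"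
    then have "y - k \<in> open_cell"
      using scaled_box[of x t] D t by auto
    then have "x = (1/t) *\<^sub>R cell_rep y" using cell_rep_eq[OF kx(1)] kx(3) t by simp
    with * kx(2) show False by simp
  qed
qed

lemma perforated_space_in_cell:
  fixes D :: "(real^'n) set"
  assumes "closure D \<subseteq> open_cell" "0 < t" "t \<le> 1"
    and "m \<in> int_lattice" "y - m \<in> open_cell"
  shows "y \<in> perforated_space D t \<longleftrightarrow> (1/t) *\<^sub>R (y - m) \<notin> closure D"
  using perforated_space_iff[OF assms(1-3)] cell_rep_eq[OF assms(4,5)] by simp

lemma perforated_space_nonempty:
  fixes D :: "(real^'n) set"
  assumes D: "closure D \<subseteq> open_cell" and t: "0 < t" "t \<le> 1"
  shows "(\<chi> i. - 1 / 2) \<in> perforated_space D t"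
proof -
  have "cell_rep (\<chi> i. - 1 / 2) = ((\<chi> i. - 1 / 2) :: real^'n)" by (simp add: cell_rep_def vec_eq_iff)
  moreover have "(1/t) *\<^sub>R ((\<chi> i. - 1 / 2) :: real^'n) \<notin> open_cell"
    using t by (auto simp: mem_box_cart field_simps)
  ultimately show ?thesis using D perforated_space_iff[OF D t] by (metis subsetD)
qed

text \<open>The open cell dilated by \<open>1 / t\<close> for positive \<open>t\<close>. In it the
  hole is \<open>D\<close> itself, so the facts about \<open>U - closure D\<close> apply and are
  carried back by scaling.\<close>

definition cell_preimage :: "real \<Rightarrow> (real^'n) set"
  where "cell_preimage t = {x. t *\<^sub>R x \<in> open_cell}"

lemma subset_cell_preimage:
  assumes "S \<subseteq> open_cell" "0 < t" "t \<le> 1"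
  shows "S \<subseteq> cell_preimage t"
proof
  fix x assume "x \<in> S"
  with assms(1) have "x \<in> open_cell" by blast
  from scaled_box[OF this less_imp_le[OF assms(2)] assms(3)] show "x \<in> cell_preimage t"
    unfolding cell_preimage_def by blast
qed

lemma cell_preimage_open: "open (cell_preimage t)"
proof -
  have "continuous_on UNIV (\<lambda>x :: real^'n. t *\<^sub>R x)" by (intro continuous_intros)
  from open_vimage[OF open_box this] show ?thesis unfolding cell_preimage_def vimage_def .
qed

lemma open_translated_box: "open {y :: real^'n. y - m \<in> box a b}"
proof -
  have "continuous_on UNIV (\<lambda>y. y - m)" by (intro continuous_intros)
  from open_vimage[OF open_box this] show ?thesis unfolding vimage_def .
qed

lemma cell_preimage_convex: "convex (cell_preimage t)"
  unfolding cell_preimage_def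
  using convex_linear_vimage[OF linear_scaleR convex_box(2)] by (simp add: vimage_def)

lemma perforated_space_cell_image:
  fixes D :: "(real^'n) set"
  assumes D: "closure D \<subseteq> open_cell" and t: "0 < t" "t \<le> 1" and m: "m \<in> int_lattice"
  shows "(\<lambda>x. m + t *\<^sub>R x) ` (cell_preimage t - closure D) =
    perforated_space D t \<inter> {y. y - m \<in> open_cell}"
proof (intro set_eqI iffI)
  fix y assume "y \<in> (\<lambda>x. m + t *\<^sub>R x) ` (cell_preimage t - closure D)"
  then obtain x where x: "y = m + t *\<^sub>R x" "x \<in> cell_preimage t" "x \<notin> closure D" by blast
  then have "y - m \<in> open_cell" by (simp add: cell_preimage_def)
  moreover have "(1/t) *\<^sub>R (y - m) \<notin> closure D" using x t by simp
  ultimately show "y \<in> perforated_space D t \<inter> {y. y - m \<in> open_cell}"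
    using perforated_space_in_cell[OF D t m] by blast
next
  fix y assume y: "y \<in> perforated_space D t \<inter> {y. y - m \<in> open_cell}"
  then have "(1/t) *\<^sub>R (y - m) \<notin> closure D" using perforated_space_in_cell[OF D t m] by blast
  moreover have "(1/t) *\<^sub>R (y - m) \<in> cell_preimage t" using y t by (simp add: cell_preimage_def)
  moreover have "y = m + t *\<^sub>R ((1/t) *\<^sub>R (y - m))" using t by simp
  ultimately show "y \<in> (\<lambda>x. m + t *\<^sub>R x) ` (cell_preimage t - closure D)" by blast
qed

text \<open>The gluing used for one hole, now for all cells simultaneously: every open cell minus
  its hole is connected and lies on one side, which is extended over the whole cell. Disjointness of
  the cells keeps the sides apart, and a separation of the full space results.\<close>

lemma perforated_space_connected:
  fixes D :: "(real^'n) set"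
  assumes D: "open D" "C1_boundary D" "connected (frontier D)"
    and DQ: "closure D \<subseteq> open_cell" and t: "0 < t" "t \<le> 1"
  shows "connected (perforated_space D t)"
proof (rule ccontr)
  define \<Omega> where "\<Omega> = perforated_space D t"
  define Q where "Q m = {y :: real^'n. y - m \<in> open_cell}" for m
  assume "\<not> connected (perforated_space D t)"
  then obtain A B where AB: "open A" "open B" "\<Omega> \<subseteq> A \<union> B" "A \<inter> B \<inter> \<Omega> = {}" "A \<inter> \<Omega> \<noteq> {}" "B \<inter> \<Omega> \<noteq> {}"
    unfolding connected_def \<Omega>_def by blast
  have DQt: "closure D \<subseteq> cell_preimage t"
    by (rule subset_cell_preimage[OF DQ t])
  have "bounded (closure D)" using DQ bounded_box bounded_subset by blast
  then have o\<Omega>: "open \<Omega>" unfolding \<Omega>_def by (intro perforated_space_open) (simp add: compact_eq_bounded_closed)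
  have "connected (cell_preimage t - closure D)"
    by (rule connected_diff[OF D cell_preimage_open convex_connected[OF cell_preimage_convex] DQt])
  then have "connected ((\<lambda>x. m + t *\<^sub>R x) ` (cell_preimage t - closure D))" for m
    by (rule connected_continuous_image[rotated]) (intro continuous_intros)
  then have connQ: "connected (\<Omega> \<inter> Q m)" if "m \<in> int_lattice" for m
    using perforated_space_cell_image[OF DQ t that] unfolding \<Omega>_def Q_def by metis
  have oQ: "open (Q m)" for m
    unfolding Q_def by (rule open_translated_box)
  \<comment> \<open>A cell entirely filled by its hole could belong to both sides; it would make
    \<open>closure D\<close> open and closed but neither empty nor everything.\<close>
  have Qne: "\<Omega> \<inter> Q m \<noteq> {}" if m: "m \<in> int_lattice" for m
  proof -
    have "cell_preimage t - closure D \<noteq> {}"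
    proof
      assume "cell_preimage t - closure D = {}"
      then have "closure D = cell_preimage t" using DQt by blast
      then have "cell_preimage t = (UNIV :: (real^'n) set) \<or> cell_preimage t = ({} :: (real^'n) set)"
        using cell_preimage_open closed_closure clopen by metis
      moreover have "cell_preimage t \<noteq> (UNIV :: (real^'n) set)"
      proof
        assume "cell_preimage t = (UNIV :: (real^'n) set)"
        then have "(1/t) *\<^sub>R (\<chi> i. 1 / 2) \<in> (cell_preimage t :: (real^'n) set)" by blast
        then show False using t by (simp add: cell_preimage_def mem_box_cart)
      qed
      moreover have "0 \<in> (cell_preimage t :: (real^'n) set)" by (simp add: cell_preimage_def mem_box_cart)
      ultimately show False by blast
    qed
    then show ?thesis using perforated_space_cell_image[OF DQ t m] unfolding \<Omega>_def Q_def by blast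
  qed
  define Ext where "Ext X = X \<inter> \<Omega> \<union> \<Union>{Q m | m. m \<in> int_lattice \<and> \<Omega> \<inter> Q m \<subseteq> X}" for X
  have "open (Ext A)" "open (Ext B)" unfolding Ext_def using AB(1,2) o\<Omega> oQ by (auto intro!: open_Union)
  moreover have "UNIV \<subseteq> Ext A \<union> Ext B"
  proof
    fix y :: "real^'n"
    show "y \<in> Ext A \<union> Ext B"
    proof (cases "y \<in> \<Omega>")
      case True
      then show ?thesis using AB(3) unfolding Ext_def by blast
    next
      case False
      define m where "m = y - cell_rep y"
      have m: "m \<in> int_lattice" unfolding m_def by (rule cell_rep_lattice)
      have "(1/t) *\<^sub>R cell_rep y \<in> closure D" using False perforated_space_iff[OF DQ t] unfolding \<Omega>_def by blast
      then have "t *\<^sub>R ((1/t) *\<^sub>R cell_rep y) \<in> open_cell"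
        by (intro scaled_box[OF subsetD[OF DQ]]) (use t in simp_all)
      then have "y \<in> Q m" using t by (simp add: Q_def m_def)
      moreover have "\<Omega> \<inter> Q m \<subseteq> A \<or> \<Omega> \<inter> Q m \<subseteq> B"
        using connectedD[OF connQ[OF m] AB(1,2)] AB(3,4) by blast
      ultimately show ?thesis using m unfolding Ext_def by blast
    qed
  qed
  moreover have "Ext A \<inter> Ext B \<inter> UNIV = {}"
  proof (rule ccontr)
    assume "\<not> ?thesis"
    then obtain y where y: "y \<in> Ext A" "y \<in> Ext B" by blast
    have AX: "y \<in> A" if "y \<in> Ext A" "y \<in> \<Omega>" using that unfolding Ext_def by blast
    have BX: "y \<in> B" if "y \<in> Ext B" "y \<in> \<Omega>" using that unfolding Ext_def by blast
    show False
    proof (cases "y \<in> \<Omega>")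
      case True
      then show ?thesis using AX BX y AB(4) by blast
    next
      case False
      then obtain m k where mk: "m \<in> int_lattice" "k \<in> int_lattice" "y \<in> Q m" "y \<in> Q k" "\<Omega> \<inter> Q m \<subseteq> A" "\<Omega> \<inter> Q k \<subseteq> B"
        using y unfolding Ext_def by blast
      then have "y - m = y - k"
        using cell_rep_eq[OF mk(1), of y] cell_rep_eq[OF mk(2), of y] unfolding Q_def by simp
      then have "m = k" by simp
      then show ?thesis using mk Qne[OF mk(1)] AB(4) by blast
    qed
  qed
  ultimately have "Ext A \<inter> UNIV = {} \<or> Ext B \<inter> UNIV = {}"
    using connectedD[OF connected_UNIV] by blast
  then show False using AB(5,6) unfolding Ext_def by blast
qed

lemma perforated_space_inward:
  fixes D :: "(real^'n) set"
  assumes D: "open D" "C1_boundary D"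
    and DQ: "closure D \<subseteq> open_cell" and t: "0 < t" "t \<le> 1"
    and z: "z \<in> closure (perforated_space D t)"
  shows "\<exists>e \<delta>. inward (perforated_space D t) z e \<delta>"
proof (cases "z \<in> perforated_space D t")
  case True
  have "bounded (closure D)" using DQ bounded_box bounded_subset by blast
  then have "open (perforated_space D t)" by (intro perforated_space_open) (simp add: compact_eq_bounded_closed)
  then show ?thesis using inward_open True by blast
next
  case False
  then obtain m x0 where mx: "m \<in> int_lattice" "x0 \<in> closure D" "z = m + t *\<^sub>R x0"
    unfolding mem_perforated_space by blast
  define Q where "Q = {y :: real^'n. y - m \<in> open_cell}"
  have oQ: "open Q"
    unfolding Q_def by (rule open_translated_box)
  have img: "(\<lambda>x. m + t *\<^sub>R x) ` (cell_preimage t - closure D) = perforated_space D t \<inter> Q"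
    using perforated_space_cell_image[OF DQ t mx(1)] unfolding Q_def .
  have DQt: "closure D \<subseteq> cell_preimage t"
    by (rule subset_cell_preimage[OF DQ t])
  have zQ: "z \<in> Q" using mx(2,3) DQt unfolding Q_def cell_preimage_def by auto
  have "x0 \<notin> D"
  proof
    assume "x0 \<in> D"
    define W where "W = (\<lambda>y. (1/t) *\<^sub>R (y - m)) -` D"
    have "open W" unfolding W_def by (rule open_vimage[OF D(1)]) (intro continuous_intros)
    moreover have "W \<inter> perforated_space D t = {}"
    proof -
      have "y \<notin> perforated_space D t" if "y \<in> W" for y
      proof -
        have "y = m + t *\<^sub>R ((1/t) *\<^sub>R (y - m))" using t by simp
        moreover have "(1/t) *\<^sub>R (y - m) \<in> closure D" using that closure_subset[of D] by (auto simp: W_def)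
        ultimately show ?thesis using mx(1) unfolding mem_perforated_space by blast
      qed
      then show ?thesis by blast
    qed
    ultimately have "W \<inter> closure (perforated_space D t) = {}" by (simp add: open_Int_closure_eq_empty)
    moreover have "z \<in> W" using mx(3) t \<open>x0 \<in> D\<close> by (simp add: W_def)
    ultimately show False using z by blast
  qed
  then have fr: "x0 \<in> frontier D" using mx(2) D(1) by (simp add: frontier_def interior_open)
  obtain e \<delta> where inw: "inward (cell_preimage t - closure D) x0 e \<delta>"
    using inward_diff[OF D cell_preimage_open fr] mx(2) DQt by blast
  obtain \<rho> where \<rho>: "\<rho> > 0" "ball z \<rho> \<subseteq> Q" using oQ zQ by (rule openE)
  have \<delta>: "\<delta> > 0" using inw by (simp add: inward_def)
  \<comment> \<open>Positions and step lengths are multiplied by \<open>1 / t\<close> under dilation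
    while directions are unchanged, which accounts for \<open>t * \<delta>\<close> and \<delta>;
    \<rho> keeps \<open>y\<close> in the cell of the hole.\<close>
  define \<delta>' where "\<delta>' = min (min (t * \<delta>) \<delta>) \<rho>"
  have \<delta>': "\<delta>' > 0" "\<delta>' \<le> t * \<delta>" "\<delta>' \<le> \<delta>" "\<delta>' \<le> \<rho>"
    using mult_pos_pos[OF t(1) \<delta>] \<delta> \<rho>(1) unfolding \<delta>'_def by linarith+
  have "inward (perforated_space D t) z e \<delta>'"
    unfolding inward_def
  proof (intro conjI ballI)
    fix y e' s assume y: "y \<in> closure (perforated_space D t) \<inter> ball z \<delta>'" and e': "e' \<in> ball e \<delta>'" and s: "s \<in> {0<..<\<delta>'}"
    define x where "x = (1/t) *\<^sub>R (y - m)"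
    have "y \<in> Q" using y \<delta>'(4) \<rho>(2) by auto
    then have "y \<in> closure (perforated_space D t \<inter> Q)"
      using y open_Int_closure_subset[OF oQ, of "perforated_space D t"] by (auto simp: Int_commute)
    moreover have "(\<lambda>y. (1/t) *\<^sub>R (y - m)) ` closure (perforated_space D t \<inter> Q) \<subseteq> closure (cell_preimage t - closure D)"
    proof (rule image_closure_subset)
      show "continuous_on (closure (perforated_space D t \<inter> Q)) (\<lambda>y. (1/t) *\<^sub>R (y - m))" by (intro continuous_intros)
      have "(\<lambda>y. (1/t) *\<^sub>R (y - m)) ` (perforated_space D t \<inter> Q) \<subseteq> cell_preimage t - closure D"
        unfolding img[symmetric] using t by auto
      then show "(\<lambda>y. (1/t) *\<^sub>R (y - m)) ` (perforated_space D t \<inter> Q) \<subseteq> closure (cell_preimage t - closure D)"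
        using closure_subset by blast
    qed simp
    ultimately have xc: "x \<in> closure (cell_preimage t - closure D)" unfolding x_def by blast
    have "x - x0 = (1/t) *\<^sub>R (y - z)" unfolding x_def mx(3) using t by (simp add: algebra_simps)
    then have "norm (x - x0) = norm (y - z) / t" using t by simp
    then have "dist x0 x = dist z y / t"
      by (simp only: dist_norm norm_minus_commute[of x0 x] norm_minus_commute[of z y])
    then have xb: "x \<in> ball x0 \<delta>" using y \<delta>'(2) t by (simp add: pos_divide_less_eq mult.commute)
    have "s / t < \<delta>" using s \<delta>'(2) t by (simp add: pos_divide_less_eq mult.commute)
    then have "x + (s/t) *\<^sub>R e' \<in> cell_preimage t - closure D"
      using inw xc xb e' s t \<delta>'(3) unfolding inward_def by auto
    then have "m + t *\<^sub>R (x + (s/t) *\<^sub>R e') \<in> perforated_space D t" using img by blast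
    moreover have "m + t *\<^sub>R (x + (s/t) *\<^sub>R e') = y + s *\<^sub>R e'" using t by (simp add: x_def scaleR_add_right)
    ultimately show "y + s *\<^sub>R e' \<in> perforated_space D t" by simp
  qed (rule \<delta>'(1))
  then show ?thesis by blast
qed

lemma periodic_domain_perforated_space:
  fixes D :: "(real^'n) set"
  assumes "open D" "C1_boundary D" "connected (frontier D)"
    and "closure D \<subseteq> open_cell" and "0 < t" "t \<le> 1"
  shows "periodic_domain (perforated_space D t)"
proof
  have "bounded (closure D)" using assms(4) bounded_box bounded_subset by blast
  then show "open (perforated_space D t)"
    by (intro perforated_space_open) (simp add: compact_eq_bounded_closed)
  show "connected (perforated_space D t)" by (rule perforated_space_connected[OF assms])
  show "perforated_space D t \<noteq> {}" using perforated_space_nonempty[OF assms(4-6)] by blast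
qed (use perforated_space_periodic perforated_space_inward[OF assms(1,2,4-6)] in blast)+

lemma periodic_domain_UNIV: "periodic_domain (UNIV :: (real^'n) set)"
proof
  show "\<exists>e \<delta>. inward UNIV z e \<delta>" for z :: "real^'n" using inward_open[OF open_UNIV UNIV_I[of z]] by blast
qed auto

section \<open>Extension of subsolutions into the holes\<close>

definition clip :: "real \<Rightarrow> real \<Rightarrow> real"
  where "clip M s = max (- M) (min M s)"

text \<open>Truncation acts on increments as multiplication by a factor in \<open>[0, 1]\<close>;
  this replaces a chain rule for the gradient.\<close>

lemma clip_diff:
  obtains \<mu> where "0 \<le> \<mu>" "\<mu> \<le> 1" "clip M a - clip M b = \<mu> * (a - b)"
proof (cases "a = b")
  case True
  then show ?thesis using that[of 0] by simp
next
  case False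
  define \<mu> where "\<mu> = (clip M a - clip M b) / (a - b)"
  have "0 \<le> \<mu> \<and> \<mu> \<le> 1"
  proof (cases "a < b")
    case True
    then have "clip M a - clip M b \<le> 0" "a - b \<le> clip M a - clip M b" unfolding clip_def by linarith+
    then show ?thesis using True unfolding \<mu>_def
      by (intro conjI divide_nonpos_nonpos) (simp_all add: neg_divide_le_eq)
  next
    case False
    then have "clip M b \<le> clip M a" "clip M a - clip M b \<le> a - b" unfolding clip_def by linarith+
    moreover have "a - b > 0" using False \<open>a \<noteq> b\<close> by simp
    ultimately show ?thesis unfolding \<mu>_def by (intro conjI divide_nonneg_nonneg) (simp_all add: pos_divide_le_eq)
  qed
  moreover have "clip M a - clip M b = \<mu> * (a - b)" unfolding \<mu>_def using False by simp
  ultimately show ?thesis using that by blast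
qed

lemma clip_bound: "0 \<le> M \<Longrightarrow> \<bar>clip M s\<bar> \<le> M"
  and clip_id: "\<bar>s\<bar> \<le> M \<Longrightarrow> clip M s = s"
  unfolding clip_def by linarith+

text \<open>Zero on the quarter box, which contains \<open>t\<close> times the unit cell for
  \<open>t \<le> 1/2\<close>, and one outside the \<open>3/8\<close> box. The slope \<open>8\<close>
  is the inverse of the gap \<open>1/8\<close> between the boxes, and a collar of the same width
  remains at the faces.\<close>

definition cutoff :: "real^'n \<Rightarrow> real"
  where "cutoff z = min 1 (8 * infdist z (cbox (\<chi> i. - 1 / 4) (\<chi> i. 1 / 4)))"

lemma cutoff_bounds: "0 \<le> cutoff z" "cutoff z \<le> 1"
  by (simp_all add: cutoff_def infdist_nonneg)

lemma cutoff_inner: "z \<in> cbox (\<chi> i. - 1 / 4) (\<chi> i. 1 / 4) \<Longrightarrow> cutoff z = 0"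
  unfolding cutoff_def by (simp add: infdist_zero)

lemma cutoff_outer:
  fixes z :: "real^'n"
  assumes "z \<notin> box (\<chi> i. - 3 / 8) (\<chi> i. 3 / 8)"
  shows "cutoff z = 1"
proof -
  obtain i where "\<not> (- 3 / 8 < z $ i \<and> z $ i < 3 / 8)" using assms by (auto simp: mem_box_cart)
  then have i: "3/8 \<le> \<bar>z $ i\<bar>" by linarith
  have ne: "cbox (\<chi> i. - 1 / 4) (\<chi> i. 1 / 4) \<noteq> ({} :: (real^'n) set)"
    by (simp add: interval_ne_empty_cart)
  have "1/8 \<le> infdist z (cbox (\<chi> i. - 1 / 4) (\<chi> i. 1 / 4))"
    unfolding infdist_notempty[OF ne]
  proof (rule cINF_greatest[OF ne])
    fix w :: "real^'n" assume "w \<in> cbox (\<chi> i. - 1 / 4) (\<chi> i. 1 / 4)"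
    then have "- 1 / 4 \<le> w $ i \<and> w $ i \<le> 1 / 4" by (simp add: mem_box_cart)
    then have "1/8 \<le> \<bar>z $ i - w $ i\<bar>" using i by linarith
    also have "\<dots> \<le> dist z w" using component_le_norm_cart[of "z - w" i] by (simp add: dist_norm)
    finally show "1/8 \<le> dist z w" .
  qed
  then show ?thesis by (simp add: cutoff_def)
qed

lemma cutoff_lipschitz:
  fixes y z :: "real^'n"
  shows "\<bar>cutoff y - cutoff z\<bar> \<le> 8 * norm (y - z)"
proof -
  have "\<bar>infdist y S - infdist z S\<bar> \<le> dist y z" for S :: "(real^'n) set"
    using infdist_triangle_abs .
  from this[of "cbox (\<chi> i. - 1 / 4) (\<chi> i. 1 / 4)"] show ?thesis
    unfolding cutoff_def dist_norm by linarith
qed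

lemma box_quarter:
  fixes x :: "real^'n"
  assumes "x \<in> unit_cell" "0 \<le> t" "t \<le> 1/2"
  shows "t *\<^sub>R x \<in> cbox (\<chi> i. - 1 / 4) (\<chi> i. 1 / 4)"
proof -
  have "- 1 / 4 \<le> t * x $ i \<and> t * x $ i \<le> 1 / 4" for i
  proof -
    have "- 1 / 2 \<le> x $ i \<and> x $ i \<le> 1 / 2" using assms(1) by (simp add: mem_box_cart)
    then have "\<bar>x $ i\<bar> \<le> 1/2" by linarith
    then have "\<bar>t * x $ i\<bar> \<le> 1/2 * (1/2)" unfolding abs_mult using assms by (intro mult_mono) auto
    then show ?thesis by linarith
  qed
  then show ?thesis by (simp add: mem_box_cart)
qed

text \<open>Near each hole the values of \<open>u = v - q\<^sub>0 \<bullet> y\<close> vary by \<open>O(t)\<close> only. Replacing \<open>u - k\<close>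
  there by \<open>(u - k) - clip M (u - k)\<close> only multiplies the gradient by a factor in \<open>[0, 1]\<close>, which is
  harmless since the Hamiltonian is minimal at gradient zero, and makes the function constant around
  the hole. Undoing the truncation with a fixed cutoff costs a gradient of order \<open>t\<close>.\<close>

lemma extend_subsolution:
  fixes F :: "real^'n \<Rightarrow> real^'n \<Rightarrow> real"
  assumes cell: "cell_problem F (perforated_space D t) q0"
    and DQ: "closure D \<subseteq> open_cell" and t: "0 < t" "t < 1/2"
    and v: "v \<in> cell_problem.Sub F (perforated_space D t) c" and c: "0 \<le> c"
    and L: "L \<ge> 0" "\<And>y q. F y q \<le> c + 1 \<Longrightarrow> norm (q - q0) \<le> L"
    and M0: "M0 \<ge> 0" "\<And>u y y'. \<lbrakk>seg_lip L (box (\<chi> i. - 1) (\<chi> i. 1) - closure D) u;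
        y \<in> unit_cell - closure D; y' \<in> unit_cell - closure D\<rbrakk> \<Longrightarrow> \<bar>u y - u y'\<bar> \<le> M0"
    and B: "\<And>y q. norm (q - q0) \<le> L + 8 * M0 \<Longrightarrow> F y q \<le> B"
  obtains w where "continuous_on UNIV w" "periodic_on UNIV w" "visc_subsolution F (c + t * B) UNIV w"
proof -
  define \<Omega> where "\<Omega> = perforated_space D t"
  interpret cell_problem F \<Omega> q0 using cell unfolding \<Omega>_def .
  define Q :: "(real^'n) set" where "Q = open_cell"
  have t1: "t \<le> 1" "0 \<le> t" using t by auto
  note \<Omega>_iff = perforated_space_iff[OF DQ t(1) t1(1), folded \<Omega>_def]
  note \<Omega>_cell = perforated_space_in_cell[OF DQ t(1) t1(1), folded \<Omega>_def Q_def]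
  have vS: "v \<in> Sub c" using v unfolding \<Omega>_def .
  have vcont: "continuous_on \<Omega> v" and vper: "periodic_on (closure \<Omega>) v" and vsub: "visc_subsolution F c \<Omega> v"
    using vS closure_subset[of \<Omega>] by (auto simp: Sub_def intro: continuous_on_subset)
  define u where "u z = v z - q0 \<bullet> z" for z
  have useg: "seg_lip L \<Omega> u"
    unfolding u_def using L(2) by (intro visc_sub_seg_lip[OF open_dom vcont vsub L(1)]) (metis add.commute add_increasing zero_le_one)
  \<comment> \<open>Scaling back the dilated function \<open>u (t *\<^sub>R x) / t\<close>, which
    has the same Lipschitz constant \<open>L\<close>, multiplies its oscillation bound by
    \<open>t\<close>.\<close>
  define M where "M = t * M0"
  have M: "M \<ge> 0" using t M0 by (simp add: M_def)
  have osc: "\<bar>u (t *\<^sub>R x) - u (t *\<^sub>R x')\<bar> \<le> M" if x: "x \<in> unit_cell - closure D" "x' \<in> unit_cell - closure D" for x x'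
  proof -
    have "seg_lip L (box (\<chi> i. - 1) (\<chi> i. 1) - closure D) (\<lambda>x. u (t *\<^sub>R x) / t)"
      unfolding seg_lip_def
    proof (intro allI impI)
      fix a b :: "real^'n" assume ab: "closed_segment a b \<subseteq> box (\<chi> i. - 1) (\<chi> i. 1) - closure D"
      have "closed_segment (t *\<^sub>R a) (t *\<^sub>R b) \<subseteq> \<Omega>"
      proof
        fix y assume "y \<in> closed_segment (t *\<^sub>R a) (t *\<^sub>R b)"
        then obtain s where s: "0 \<le> s" "s \<le> 1" "y = (1 - s) *\<^sub>R t *\<^sub>R a + s *\<^sub>R t *\<^sub>R b"
          unfolding in_segment by blast
        define x where "x = (1 - s) *\<^sub>R a + s *\<^sub>R b"
        have "x \<in> closed_segment a b" unfolding in_segment x_def using s by blast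
        then have x: "x \<in> box (\<chi> i. - 1) (\<chi> i. 1)" "x \<notin> closure D" using ab by auto
        have y: "y = t *\<^sub>R x" using s(3) by (simp add: x_def algebra_simps)
        \<comment> \<open>Here \<open>t < 1/2\<close> enters: it maps the fixed box
          \<open>(-1, 1)^n\<close> into the open cell, so that only one hole is seen.\<close>
        have "(1/2) *\<^sub>R x \<in> Q" using x(1) unfolding Q_def by (simp add: mem_box_cart field_simps)
        from scaled_box[OF this[unfolded Q_def], of "2 * t"] t have "y \<in> Q" unfolding y Q_def by simp
        moreover have "(1/t) *\<^sub>R (y - 0) \<notin> closure D" using x(2) t by (simp add: y)
        ultimately show "y \<in> \<Omega>" using \<Omega>_cell[OF int_lattice_0, of y] by simp
      qed
      then have "\<bar>u (t *\<^sub>R a) - u (t *\<^sub>R b)\<bar> \<le> L * dist (t *\<^sub>R a) (t *\<^sub>R b)"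
        using useg unfolding seg_lip_def by blast
      also have "\<dots> = t * (L * dist a b)" using t by (simp add: dist_norm flip: scaleR_diff_right)
      finally have "\<bar>u (t *\<^sub>R a) - u (t *\<^sub>R b)\<bar> / t \<le> L * dist a b"
        using t by (simp add: pos_divide_le_eq mult.commute)
      then show "\<bar>u (t *\<^sub>R a) / t - u (t *\<^sub>R b) / t\<bar> \<le> L * dist a b"
        using t by (simp flip: diff_divide_distrib)
    qed
    from M0(2)[OF this x] have "\<bar>u (t *\<^sub>R x) - u (t *\<^sub>R x')\<bar> / t \<le> M0"
      using t by (simp flip: diff_divide_distrib)
    then show ?thesis using t by (simp add: M_def pos_divide_le_eq mult.commute)
  qed
  \<comment> \<open>A corner of the cell is certainly outside the hole; the value of
    \<open>u\<close> at its scaled copy serves as the constant \<open>k\<close> inside.\<close>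
  define xs :: "real^'n" where "xs = (\<chi> i. - 1 / 2)"
  have "xs \<notin> open_cell" by (simp add: xs_def mem_box_cart)
  then have xs: "xs \<in> unit_cell - closure D" using DQ by (auto simp: xs_def mem_box_cart)
  define k where "k = u (t *\<^sub>R xs)"
  \<comment> \<open>In the hole the extension is affine with gradient \<open>q0\<close>, where
    \<open>F\<close> vanishes. Outside it, the truncation is active near the hole and faded out by
    the cutoff before the faces are reached.\<close>
  define G where "G z = (if (1/t) *\<^sub>R z \<in> closure D then k + q0 \<bullet> z
      else v z - (1 - cutoff z) * clip M (u z - k))" for z
  define w where "w y = G (cell_rep y)" for y
  \<comment> \<open>Both formulas agree on all of \<open>t\<close> times the open cell: there the
    cutoff is zero and the oscillation bound makes the clipping exact. Hence no interface appears at
    the boundary of the hole.\<close>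
  have G_near: "G z = k + q0 \<bullet> z" if z: "(1/t) *\<^sub>R z \<in> Q" for z
  proof (cases "(1/t) *\<^sub>R z \<in> closure D")
    case False
    have zc: "(1/t) *\<^sub>R z \<in> unit_cell" using z box_subset_cbox unfolding Q_def by blast
    have zt: "t *\<^sub>R ((1/t) *\<^sub>R z) = z" using t by simp
    have "cutoff z = 0" using cutoff_inner[OF box_quarter[OF zc t1(2)]] t zt by simp
    moreover have "\<bar>u z - k\<bar> \<le> M" using osc[of "(1/t) *\<^sub>R z" xs] False zc xs zt by (simp add: k_def)
    ultimately show ?thesis using False by (simp add: G_def clip_id u_def)
  qed (simp add: G_def)
  have per: "v (cell_rep y) = v y" if "y \<in> \<Omega>" for y
    using periodic_on_rep[OF vper] that closure_subset[of \<Omega>] by blast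
  have level_q0: "q0 \<in> {q. F y q \<le> c'}" if "0 \<le> c'" for y c' using that F_zero by simp
  have key: "\<exists>r>0. \<exists>K. compact K \<and> convex K \<and> set_lip K (ball y0 r) w \<and> (\<forall>q\<in>K. F y0 q \<le> c' + t * B)"
    if c': "c < c'" "c' \<le> c + 1" for y0 c'
  proof -
    define z0 where "z0 = cell_rep y0"
    define m where "m = y0 - z0"
    have m: "m \<in> int_lattice" unfolding m_def z0_def by (rule cell_rep_lattice)
    have c'0: "0 \<le> c'" using c c' by simp
    have B0: "0 \<le> B" using B[of q0 y0] L(1) M0(1) F_zero[of y0] by simp
    have tB: "0 \<le> t * B" using B0 t by simp
    define A where "A = {q. F y0 q \<le> c'}"
    have A: "compact A" "convex A" "q0 \<in> A" unfolding A_def using level_compact level_convex level_q0[OF c'0] by auto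
    \<comment> \<open>The first two cases may overlap around the hole. The faces are treated apart
      because \<open>cell_rep\<close> jumps there, but nearby \<open>w\<close> is just the periodic
      function \<open>v\<close>.\<close>
    consider (hole) "(1/t) *\<^sub>R z0 \<in> Q" | (mid) "z0 \<in> Q" "(1/t) *\<^sub>R z0 \<notin> closure D" | (edge) "z0 \<notin> Q"
      using DQ unfolding Q_def by blast
    then show ?thesis
    proof cases
      case hole
      define U where "U = {z. (1/t) *\<^sub>R z \<in> Q}"
      have "continuous_on UNIV (\<lambda>z :: real^'n. (1/t) *\<^sub>R z)" by (intro continuous_intros)
      from open_vimage[OF open_box this] have "open U" unfolding U_def Q_def vimage_def .
      moreover have UQ: "U \<subseteq> open_cell"
      proof
        fix z assume "z \<in> U"
        then have "(1/t) *\<^sub>R z \<in> open_cell" unfolding U_def Q_def by blast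
        from scaled_box[OF this t1(2) t1(1)] show "z \<in> open_cell" using t by simp
      qed
      moreover have "cell_rep y0 \<in> U" using hole by (simp add: U_def z0_def)
      ultimately obtain d where d: "d > 0" "\<And>y. y \<in> ball y0 d \<Longrightarrow> cell_rep y = y - (y0 - cell_rep y0)"
        "\<And>y. y \<in> ball y0 d \<Longrightarrow> cell_rep y \<in> U" using cell_rep_local by metis
      have weq: "w y = k + q0 \<bullet> (y - m)" if "y \<in> ball y0 d" for y
        using G_near[of "cell_rep y"] d(2)[OF that] d(3)[OF that] unfolding w_def U_def m_def z0_def by simp
      have "set_lip {q0} (ball y0 d) w"
        unfolding set_lip_def
      proof (intro ballI)
        fix y z assume "y \<in> ball y0 d" "z \<in> ball y0 d"
        then show "\<exists>q\<in>{q0}. w y - w z \<le> q \<bullet> (y - z)" using weq by (simp add: inner_diff_right)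
      qed
      with d(1) show ?thesis using F_zero c'0 tB by (intro exI[of _ d] conjI exI[of _ "{q0}"]) auto
    next
      case edge
      \<comment> \<open>\<open>1/8 = 1/2 - 3/8\<close>: within this distance of a face the cutoff is
        still one.\<close>
      define d :: real where "d = 1/8"
      have out: "cell_rep y \<notin> box (\<chi> i. - 3 / 8) (\<chi> i. 3 / 8)" if y: "y \<in> ball y0 d" for y
      proof
        assume z: "cell_rep y \<in> box (\<chi> i. - 3 / 8) (\<chi> i. 3 / 8)"
        define m' where "m' = y - cell_rep y"
        have "- 1 / 2 < (y0 - m') $ i \<and> (y0 - m') $ i < 1 / 2" for i
        proof -
          have "\<bar>(y0 - y) $ i\<bar> < 1/8" using component_le_norm_cart[of "y0 - y" i] y by (simp add: d_def dist_norm)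
          moreover have "- 3 / 8 < cell_rep y $ i \<and> cell_rep y $ i < 3 / 8" using z by (simp add: mem_box_cart)
          moreover have "(y0 - m') $ i = cell_rep y $ i + (y0 - y) $ i" by (simp add: m'_def)
          ultimately show ?thesis by linarith
        qed
        then have "y0 - m' \<in> open_cell" by (simp add: mem_box_cart)
        moreover from this have "cell_rep y0 = y0 - m'"
          using cell_rep_lattice[of y] by (intro cell_rep_eq) (auto simp: m'_def)
        ultimately show False using edge by (simp add: z0_def Q_def)
      qed
      have notD: "(1/t) *\<^sub>R cell_rep y \<notin> closure D" if y: "y \<in> ball y0 d" for y
      proof
        assume "(1/t) *\<^sub>R cell_rep y \<in> closure D"
        then have "(1/t) *\<^sub>R cell_rep y \<in> unit_cell" using DQ box_subset_cbox by blast
        from box_quarter[OF this t1(2)] t have "cell_rep y \<in> cbox (\<chi> i. - 1 / 4) (\<chi> i. 1 / 4)" by simp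
        then have "- 3 / 8 < cell_rep y $ i \<and> cell_rep y $ i < 3 / 8" for i
          by (auto simp: mem_box_cart dest!: spec[of _ i])
        then have "cell_rep y \<in> box (\<chi> i. - 3 / 8) (\<chi> i. 3 / 8)" by (simp add: mem_box_cart)
        with out[OF y] show False by blast
      qed
      have y\<Omega>: "y \<in> \<Omega>" if "y \<in> ball y0 d" for y using notD[OF that] \<Omega>_iff by blast
      have weq: "w y = v y" if "y \<in> ball y0 d" for y
        using notD[OF that] cutoff_outer[OF out[OF that]] per[OF y\<Omega>[OF that]] by (simp add: w_def G_def)
      have "y0 \<in> \<Omega>" by (rule y\<Omega>) (simp add: d_def)
      then obtain r where r: "r > 0" "\<And>v. v \<in> Sub c \<Longrightarrow> set_lip A (ball y0 r) v"
        using Sub_set_lip_local[OF _ c'(1) c'0] unfolding A_def by blast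
      have "set_lip A (ball y0 (min r d)) v" by (rule set_lip_subset[OF r(2)[OF vS]]) auto
      then have "set_lip A (ball y0 (min r d)) w" by (rule set_lip_cong) (simp add: weq)
      moreover have "0 < min r d" using r(1) by (simp add: d_def)
      ultimately show ?thesis using A tB
        by (intro exI[of _ "min r d"] conjI exI[of _ A]) (auto simp: A_def)
    next
      case mid
      define U where "U = Q - {z. (1/t) *\<^sub>R z \<in> closure D}"
      have "continuous_on UNIV (\<lambda>z :: real^'n. (1/t) *\<^sub>R z)" by (intro continuous_intros)
      from closed_vimage[OF closed_closure this, of D] have "closed {z. (1/t) *\<^sub>R z \<in> closure D}" unfolding vimage_def .
      then have "open U" unfolding U_def Q_def by (intro open_Diff open_box)
      moreover have "U \<subseteq> open_cell" unfolding U_def Q_def by blast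
      moreover have "cell_rep y0 \<in> U" using mid by (simp add: U_def z0_def)
      ultimately obtain d where d: "d > 0" "\<And>y. y \<in> ball y0 d \<Longrightarrow> cell_rep y = y - (y0 - cell_rep y0)"
        "\<And>y. y \<in> ball y0 d \<Longrightarrow> cell_rep y \<in> U" using cell_rep_local by metis
      have rep: "cell_rep y = y - m" if "y \<in> ball y0 d" for y using d(2)[OF that] by (simp add: m_def z0_def)
      have y\<Omega>: "y \<in> \<Omega>" if "y \<in> ball y0 d" for y
        using d(3)[OF that] unfolding \<Omega>_iff U_def by blast
      define \<theta> where "\<theta> y = cutoff (y - m)" for y
      define s where "s y = v y - q0 \<bullet> (y - m) - k" for y
      have weq: "w y = v y - (1 - \<theta> y) * clip M (s y)" if y: "y \<in> ball y0 d" for y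
      proof -
        have nD: "(1/t) *\<^sub>R (y - m) \<notin> closure D" using d(3)[OF y] unfolding U_def rep[OF y] by blast
        have vr: "v (y - m) = v y" using per[OF y\<Omega>[OF y]] unfolding rep[OF y] .
        show ?thesis unfolding w_def rep[OF y] G_def if_not_P[OF nD] u_def vr \<theta>_def s_def ..
      qed
      have "y0 \<in> \<Omega>" by (rule y\<Omega>) (simp add: d)
      then obtain r where r: "r > 0" "\<And>v. v \<in> Sub c \<Longrightarrow> set_lip A (ball y0 r) v"
        using Sub_set_lip_local[OF _ c'(1) c'0] unfolding A_def by blast
      \<comment> \<open>The first summand is the sublevel set at \<open>y0\<close>; the ball
        accounts for the gradient of the cutoff, at most \<open>8\<close>, times the truncated
        values, at most \<open>M\<close>.\<close>
      define K where "K = (\<Union>a\<in>A. \<Union>b\<in>cball 0 (8 * M). {a + b})"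
      have "compact K"
      proof -
        have "K = {a + b | a b. a \<in> A \<and> b \<in> cball 0 (8 * M)}" unfolding K_def by blast
        then show ?thesis using compact_sums[OF A(1) compact_cball, of 0 "8 * M"] by simp
      qed
      moreover have "convex K" unfolding K_def by (intro convex_sums A convex_cball)
      moreover have "set_lip K (ball y0 (min r d)) w"
        unfolding set_lip_def
      proof (intro ballI)
        fix y z assume yz: "y \<in> ball y0 (min r d)" "z \<in> ball y0 (min r d)"
        then have "y \<in> ball y0 r" "z \<in> ball y0 r" by auto
        then obtain a where a: "a \<in> A" "v y - v z \<le> a \<bullet> (y - z)"
          using r(2)[OF vS] unfolding set_lip_def by blast
        obtain \<mu> where \<mu>: "0 \<le> \<mu>" "\<mu> \<le> 1" "clip M (s y) - clip M (s z) = \<mu> * (s y - s z)"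
          using clip_diff by blast
        \<comment> \<open>The fraction of the gradient of \<open>u\<close> that the truncation
          removes; it moves \<open>a\<close> towards \<open>q0\<close>, and convexity keeps the
          result in \<open>A\<close>.\<close>
        define \<nu> where "\<nu> = (1 - \<theta> y) * \<mu>"
        have \<nu>: "0 \<le> \<nu>" "\<nu> \<le> 1"
          using \<mu> cutoff_bounds[of "y - m"] mult_le_one[of "1 - \<theta> y" \<mu>] by (auto simp: \<nu>_def \<theta>_def)
        \<comment> \<open>For \<open>y = z\<close> the division by zero gives \<open>b = 0\<close>,
          for which the identity for \<open>b \<bullet> (y - z)\<close> still holds.\<close>
        define b where "b = (8 * M / norm (y - z)) *\<^sub>R (y - z)"
        have nb: "norm b \<le> 8 * M" using M by (simp add: b_def)
        have b: "b \<bullet> (y - z) = 8 * M * norm (y - z)"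
          by (cases "y = z") (simp_all add: b_def power2_eq_square flip: power2_norm_eq_inner)
        have "(\<theta> y - \<theta> z) * clip M (s z) \<le> \<bar>\<theta> y - \<theta> z\<bar> * \<bar>clip M (s z)\<bar>"
          by (metis abs_ge_self abs_mult)
        also have "\<dots> \<le> (8 * norm (y - z)) * M"
          using cutoff_lipschitz[of "y - m" "z - m"] clip_bound[OF M] by (intro mult_mono) (auto simp: \<theta>_def)
        finally have th: "(\<theta> y - \<theta> z) * clip M (s z) \<le> b \<bullet> (y - z)" unfolding b by (simp add: mult_ac)
        have sd: "s y - s z = (v y - v z) - q0 \<bullet> (y - z)" by (simp add: s_def inner_diff_right)
        have wy: "w y = v y - (1 - \<theta> y) * clip M (s y)" and wz: "w z = v z - (1 - \<theta> z) * clip M (s z)"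
          using yz by (auto intro: weq)
        have "w y - w z = (v y - v z) - (1 - \<theta> y) * (clip M (s y) - clip M (s z)) + (\<theta> y - \<theta> z) * clip M (s z)"
          unfolding wy wz by (simp add: algebra_simps)
        also have "\<dots> = (1 - \<nu>) * (v y - v z) + \<nu> * (q0 \<bullet> (y - z)) + (\<theta> y - \<theta> z) * clip M (s z)"
          unfolding \<mu>(3) sd \<nu>_def by (simp add: algebra_simps)
        also have "\<dots> \<le> (1 - \<nu>) * (a \<bullet> (y - z)) + \<nu> * (q0 \<bullet> (y - z)) + b \<bullet> (y - z)"
          using \<nu> a(2) th by (intro add_mono mult_left_mono) auto
        also have "\<dots> = (((1 - \<nu>) *\<^sub>R a + \<nu> *\<^sub>R q0) + b) \<bullet> (y - z)" by (simp add: inner_add_left)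
        finally have "w y - w z \<le> (((1 - \<nu>) *\<^sub>R a + \<nu> *\<^sub>R q0) + b) \<bullet> (y - z)" .
        moreover have "(1 - \<nu>) *\<^sub>R a + \<nu> *\<^sub>R q0 \<in> A" using A a(1) \<nu> by (intro convexD) auto
        moreover have "b \<in> cball 0 (8 * M)" using nb by simp
        ultimately show "\<exists>q\<in>K. w y - w z \<le> q \<bullet> (y - z)" unfolding K_def by blast
      qed
      moreover have "F y0 q \<le> c' + t * B" if "q \<in> K" for q
      proof -
        obtain a b where ab: "a \<in> A" "norm b \<le> 8 * M" "q = a + b" using \<open>q \<in> K\<close> unfolding K_def by auto
        have Fa: "F y0 a \<le> c'" using ab(1) by (simp add: A_def)
        have na: "norm (a - q0) \<le> L" using Fa c'(2) by (intro L(2)[of y0]) simp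
        have "norm ((1/t) *\<^sub>R b) \<le> 8 * M0" using ab(2) t by (simp add: M_def pos_divide_le_eq mult_ac)
        then have "norm ((a + (1/t) *\<^sub>R b) - q0) \<le> L + 8 * M0"
          using na norm_triangle_ineq[of "a - q0" "(1/t) *\<^sub>R b"] by (simp add: algebra_simps)
        then have Fb: "F y0 (a + (1/t) *\<^sub>R b) \<le> B" by (rule B)
        \<comment> \<open>The perturbation is put at weight \<open>t\<close> as
          \<open>(1/t) *\<^sub>R b\<close>, whose norm is at most \<open>8 * M0\<close>, so
          convexity charges only \<open>t * B\<close> for it.\<close>
        have "q = (1 - t) *\<^sub>R a + t *\<^sub>R (a + (1/t) *\<^sub>R b)" using t ab(3) by (simp add: algebra_simps)
        then have "F y0 q \<le> (1 - t) * F y0 a + t * F y0 (a + (1/t) *\<^sub>R b)"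
          using F_convex2[of "1 - t" t y0 a "a + (1/t) *\<^sub>R b"] t by simp
        also have "\<dots> \<le> 1 * c' + t * B"
          using t Fa Fb F_nonneg[of y0 a] by (intro add_mono mult_mono mult_left_mono) auto
        finally show ?thesis by simp
      qed
      moreover have "0 < min r d" using r(1) d(1) by simp
      ultimately show ?thesis by blast
    qed
  qed
  show ?thesis
  proof (rule that[of w])
    show "continuous_on UNIV w"
    proof (rule continuous_on_locally)
      fix x :: "real^'n"
      obtain r K where "r > 0" "compact K" "set_lip K (ball x r) w" using key[of "c + 1" x] by auto
      then show "\<exists>d>0. continuous_on (UNIV \<inter> ball x d) w"
        using set_lip_continuous_on[OF compact_imp_bounded] by auto
    qed
    show "periodic_on UNIV w" unfolding periodic_on_def w_def using cell_rep_add by metis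
    show "visc_subsolution F (c + t * B) UNIV w"
    proof (rule visc_subI[OF open_UNIV])
      fix x0 c'' assume c'': "c + t * B < c''"
      define c' where "c' = min (c'' - t * B) (c + 1)"
      have "c < c'" "c' \<le> c + 1" "c' + t * B \<le> c''" using c'' by (auto simp: c'_def)
      then show "\<exists>r>0. \<exists>K. compact K \<and> convex K \<and> set_lip K (ball x0 r) w \<and> (\<forall>q\<in>K. F x0 q \<le> c'')"
        using key[of c' x0] by (meson order_trans)
    qed
  qed
qed

section \<open>Critical values and the punctured space\<close>

lemma (in cell_problem) critical_value_unique:
  assumes "v1 \<in> Sub c1" "visc_supersolution F c1 (closure \<Omega>) v1"
    and "v2 \<in> Sub c2" "visc_supersolution F c2 (closure \<Omega>) v2"
  shows "c1 = c2"
  using assms comparison[of v1 c1 v2 c2] comparison[of v2 c2 v1 c1] unfolding Sub_def by force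

lemma (in cell_problem) critical_value:
  obtains c v where "0 \<le> c" "v \<in> Sub c" "visc_supersolution F c (closure \<Omega>) v"
    "(THE c. \<exists>v. v \<in> Sub c \<and> visc_supersolution F c (closure \<Omega>) v) = c"
proof -
  obtain c v where cv: "0 \<le> c" "v \<in> Sub c" "visc_supersolution F c (closure \<Omega>) v"
    using cell_solution_exists by blast
  have "(THE c. \<exists>v. v \<in> Sub c \<and> visc_supersolution F c (closure \<Omega>) v) = c"
    using cv critical_value_unique by (intro the_equality) blast+
  with cv that show ?thesis by blast
qed

lemma state_constraint_cell_solution_iff:
  assumes "cell_problem (\<lambda>y q. H y (p + q)) \<Omega> q0"
  shows "state_constraint_cell_solution H \<Omega> p c v \<longleftrightarrow>
    v \<in> cell_problem.Sub (\<lambda>y q. H y (p + q)) \<Omega> c \<and> visc_supersolution (\<lambda>y q. H y (p + q)) c (closure \<Omega>) v"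
  unfolding state_constraint_cell_solution_def cell_problem.Sub_def[OF assms] by blast

lemma cell_solution_iff: "cell_solution H p c v \<longleftrightarrow> state_constraint_cell_solution H UNIV p c v"
  unfolding cell_solution_def state_constraint_cell_solution_def closure_UNIV ..

lemma effective_H_eq: "effective_H H p = effective_H_constraint H UNIV p"
  unfolding effective_H_def effective_H_constraint_def cell_solution_iff ..

text \<open>For size zero the holes are the lattice points: the subsolution property is tested off
  them, while the supersolution property is tested on the whole space.\<close>

lemma closure_perforated_space_0:
  fixes D :: "(real^'n) set"
  assumes "closure D \<noteq> {}"
  shows "closure (perforated_space D 0) = UNIV"
proof -
  have eq: "perforated_space D 0 = - int_lattice"
    using assms by (auto simp: mem_perforated_space)
  have "y \<in> closure (- int_lattice)" for y :: "real^'n"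
    unfolding closure_approachable
  proof (intro allI impI)
    fix e :: real assume e: "e > 0"
    show "\<exists>x\<in>- int_lattice. dist x y < e"
    proof (cases "y \<in> int_lattice")
      case False
      then show ?thesis using e by (intro bexI[of _ y]) auto
    next
      case True
      fix i :: 'n
      define s where "s = min (e/2) (1/2)"
      have s: "0 < s" "s < e" "s < 1" using e by (auto simp: s_def)
      have "y + s *\<^sub>R axis i 1 \<notin> int_lattice"
      proof
        assume "y + s *\<^sub>R axis i 1 \<in> int_lattice"
        from int_lattice_diff[OF this True] have "s \<in> \<int>" unfolding int_lattice_def by (auto simp: axis_def dest!: spec[of _ i])
        with s show False by (auto elim!: Ints_cases)
      qed
      then show ?thesis using s by (intro bexI[of _ "y + s *\<^sub>R axis i 1"]) (auto simp: dist_norm)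
    qed
  qed
  then show ?thesis unfolding eq by blast
qed

lemma perforated_space_0_superset:
  assumes "0 \<in> closure D"
  shows "perforated_space D t \<subseteq> perforated_space D 0"
  using assms unfolding mem_perforated_space subset_iff by force

lemma periodic_on_subset: "periodic_on S f \<Longrightarrow> T \<subseteq> S \<Longrightarrow> periodic_on T f"
  unfolding periodic_on_def by blast

theorem corollary5p2:
  fixes H :: "real^'n \<Rightarrow> real^'n \<Rightarrow> real"
    and D :: "(real^'n) set"
    and R :: real
  assumes n_ge_2: "CARD('n) \<ge> 2"
    and A1_cont: "continuous_on UNIV (\<lambda>(y, p). H y p)"
    and A1_per: "\<And>p. periodic_on UNIV (\<lambda>y. H y p)"
    and A2: "filterlim (\<lambda>p. INF y. H y p) at_top at_infinity"
    and A3: "\<And>y. convex_on UNIV (H y)"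
    and A5: "\<And>y. (\<forall>p. H y 0 \<le> H y p) \<and> H y 0 = 0"
    and D_open: "open D"
    and D_connected: "connected D"
    and D_zero: "0 \<in> D"
    and D_compactly_contained: "compact (closure D)"
      "closure D \<subseteq> box (\<chi> i. - 1 / 2) (\<chi> i. 1 / 2)"
    and D_boundary_connected: "connected (frontier D)"
    and D_boundary_C1: "C1_boundary D"
    and R_pos: "R > 0"
  shows "\<exists>C>0. \<forall>\<eta>. \<eta> ` {0..<1/2} \<subseteq> {0..<1/2::real} \<longrightarrow>
           (\<eta> \<longlongrightarrow> 0) (at (0::real) within {0..<1/2}) \<longrightarrow>
           (\<forall>\<epsilon>\<in>{0<..<1/2}. \<forall>p. norm p \<le> R \<longrightarrow>
              \<bar>effective_H_constraint H (perforated_space D (\<eta> \<epsilon>)) p - effective_H H p\<bar>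
                \<le> C * (\<epsilon> + \<eta> \<epsilon>))"
proof -
  note DQ = D_compactly_contained(2)
  have Hper: "H (y + m) q = H y q" if "m \<in> int_lattice" for y m q
    using A1_per[of q] that unfolding periodic_on_def by simp
  have Hcont: "continuous_on S (\<lambda>x. H (f x) (g x))" if "continuous_on S f" "continuous_on S g"
    for S :: "'c::topological_space set" and f g
  proof -
    have "continuous_on S (\<lambda>x. (f x, g x))" using that by (intro continuous_intros)
    from continuous_on_compose2[OF A1_cont this] show ?thesis by simp
  qed
  have Hnonneg: "0 \<le> H y q" for y q using A5[of y] by metis
  have Hcoercive: "\<exists>L. \<forall>y q. H y q \<le> B \<longrightarrow> norm q \<le> L" for B
  proof -
    have "\<forall>\<^sub>F p in at_infinity. B + 1 \<le> (INF y. H y p)" using A2 unfolding filterlim_at_top by blast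
    then obtain b where b: "\<And>p. b \<le> norm p \<Longrightarrow> B + 1 \<le> (INF y. H y p)"
      unfolding eventually_at_infinity by blast
    have "norm q \<le> b" if "H y q \<le> B" for y q
    proof (rule ccontr)
      assume "\<not> norm q \<le> b"
      then have "B + 1 \<le> (INF y. H y q)" by (intro b) simp
      also have "\<dots> \<le> H y q" using Hnonneg by (intro cINF_lower bdd_belowI2[of _ 0]) auto
      finally show False using that by simp
    qed
    then show ?thesis by blast
  qed
  have problem: "cell_problem (\<lambda>y q. H y (p + q)) \<Omega> (- p)" if dom: "periodic_domain \<Omega>" for \<Omega> p
  proof -
    interpret periodic_domain \<Omega> by (rule dom)
    show ?thesis
    proof
      show "continuous_on UNIV (\<lambda>(y, q). H y (p + q))"
        unfolding case_prod_beta by (intro Hcont continuous_intros)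
      show "\<exists>L. \<forall>y q. H y (p + q) \<le> B \<longrightarrow> norm q \<le> L" for B
      proof -
        obtain L where L: "\<And>y q. H y q \<le> B \<Longrightarrow> norm q \<le> L" using Hcoercive by blast
        have "norm q \<le> L + norm p" if "H y (p + q) \<le> B" for y q
          using L[OF that] norm_triangle_ineq4[of "p + q" p] by simp
        then show ?thesis by blast
      qed
      show "convex_on UNIV (\<lambda>q. H y (p + q))" for y
      proof (rule convex_onI)
        fix s :: real and a b assume s: "0 < s" "s < 1"
        have "p + ((1 - s) *\<^sub>R a + s *\<^sub>R b) = (1 - s) *\<^sub>R (p + a) + s *\<^sub>R (p + b)" by (simp add: algebra_simps)
        then show "H y (p + ((1 - s) *\<^sub>R a + s *\<^sub>R b)) \<le> (1 - s) * H y (p + a) + s * H y (p + b)"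
          using convex_onD[OF A3[of y], of s "p + a" "p + b"] s by simp
      qed simp
    qed (use Hper Hnonneg A5 in auto)
  qed
  have bounded_H: "\<exists>B\<ge>0. \<forall>y q. norm q \<le> S \<longrightarrow> H y q \<le> B" for S
  proof -
    have "continuous_on (unit_cell \<times> cball 0 S) (\<lambda>(y, q). H y q)"
      using A1_cont by (rule continuous_on_subset) simp
    from compact_imp_bounded[OF compact_continuous_image[OF this compact_Times[OF compact_cbox compact_cball]]]
    obtain B where "B > 0" and im: "\<forall>x\<in>(\<lambda>(y, q). H y q) ` (unit_cell \<times> cball 0 S). norm x \<le> B"
      unfolding bounded_pos by blast
    then have B: "B > 0" "\<And>y q. y \<in> unit_cell \<Longrightarrow> norm q \<le> S \<Longrightarrow> \<bar>H y q\<bar> \<le> B"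
      using bspec[OF im, OF image_eqI[of _ "\<lambda>(y, q). H y q" "(_, _)"]] by simp_all
    have "H y q \<le> B" if "norm q \<le> S" for y q
      using B(2)[OF cell_rep_in_cell[of y] that] Hper[OF cell_rep_lattice, of "cell_rep y" y q] by simp
    with B(1) show ?thesis by (intro exI[of _ B]) auto
  qed
  \<comment> \<open>The zero function is a subsolution at level \<open>cmax\<close>, so this bounds
    both critical values for \<open>norm p \<le> R\<close>. The constant \<open>L\<close> is taken
    at \<open>cmax + 1\<close> to match the extra unit of level in the extension.\<close>
  obtain cmax where cmax: "0 \<le> cmax" "\<And>y q. norm q \<le> R \<Longrightarrow> H y q \<le> cmax" using bounded_H[of R] by blast
  obtain L0 where L0: "\<And>y q. H y q \<le> cmax + 1 \<Longrightarrow> norm q \<le> L0" using Hcoercive by blast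
  define L where "L = max L0 0"
  have L: "0 \<le> L" "\<And>y q. H y q \<le> cmax + 1 \<Longrightarrow> norm q \<le> L" using L0 by (force simp: L_def)+
  \<comment> \<open>A window independent of \<open>t\<close> whose interior contains the compact
    unit cell, so the oscillation bound on the cell uses paths within the window.\<close>
  define U where "U = (box (\<chi> i. - 1) (\<chi> i. 1) :: (real^'n) set)"
  have cellU: "unit_cell \<subseteq> U" unfolding U_def by (auto simp: mem_box_cart) (smt (verit, best) field_sum_of_halves)+
  have DU: "closure D \<subseteq> U" using DQ box_subset_cbox cellU by blast
  obtain M1 where M1: "\<And>u y y'. \<lbrakk>seg_lip L (U - closure D) u; y \<in> (U - closure D) \<inter> unit_cell;
      y' \<in> (U - closure D) \<inter> unit_cell\<rbrakk> \<Longrightarrow> \<bar>u y - u y'\<bar> \<le> M1"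
  proof (rule seg_lip_osc[of "U - closure D" unit_cell L])
    show oU: "open (U - closure D)" unfolding U_def by (intro open_Diff open_box closed_closure)
    show "connected (U - closure D)"
      using DU unfolding U_def
      by (intro connected_diff[OF D_open D_boundary_C1 D_boundary_connected open_box convex_connected[OF convex_box(2)]])
    fix z assume z: "z \<in> closure (U - closure D) \<inter> unit_cell"
    show "\<exists>e \<delta>. inward (U - closure D) z e \<delta>"
    proof (cases "z \<in> closure D")
      case False
      then have "z \<in> U - closure D" using z cellU by blast
      then show ?thesis using inward_open[OF oU] by blast
    next
      case True
      have "D \<inter> closure (U - closure D) = {}"
        using D_open closure_subset[of D] by (subst open_Int_closure_eq_empty) auto
      then have "z \<in> frontier D" using True z D_open by (auto simp: frontier_def interior_open)
      then show ?thesis using inward_diff[OF D_open D_boundary_C1 open_box] z cellU unfolding U_def by blast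
    qed
  qed (use L(1) in auto)
  define M0 where "M0 = max M1 0"
  have M0: "0 \<le> M0" "\<And>u y y'. \<lbrakk>seg_lip L (box (\<chi> i. - 1) (\<chi> i. 1) - closure D) u;
      y \<in> unit_cell - closure D; y' \<in> unit_cell - closure D\<rbrakk> \<Longrightarrow> \<bar>u y - u y'\<bar> \<le> M0"
    using M1 cellU unfolding M0_def U_def by (fastforce simp: le_max_iff_disj)+
  \<comment> \<open>The gradients that arise in the extension are bounded by
    \<open>L + 8 * M0\<close> after the shift by \<open>p\<close>; the maximum of \<open>H\<close>
    on that ball is bounded uniformly in \<open>p\<close> and \<open>t\<close>.\<close>
  obtain B where B: "0 \<le> B" "\<And>y q. norm q \<le> L + 8 * M0 \<Longrightarrow> H y q \<le> B"
    using bounded_H[of "L + 8 * M0"] by blast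
  have domain: "periodic_domain (perforated_space D t)" if "0 < t" "t < 1/2" for t
    using that by (intro periodic_domain_perforated_space D_open D_boundary_C1 D_boundary_connected DQ) auto
  have main: "\<bar>effective_H_constraint H (perforated_space D t) p - effective_H H p\<bar> \<le> B * t"
    if t: "0 \<le> t" "t < 1/2" and p: "norm p \<le> R" for t p
  proof -
    define F where "F y q = H y (p + q)" for y q
    interpret whole: cell_problem F UNIV "- p"
      unfolding F_def by (rule problem[OF periodic_domain_UNIV])
    obtain c0 v0 where c0': "0 \<le> c0" "v0 \<in> whole.Sub c0" "visc_supersolution F c0 (closure UNIV) v0"
      and THE0: "(THE c. \<exists>v. v \<in> whole.Sub c \<and> visc_supersolution F c (closure UNIV) v) = c0"
      by (rule whole.critical_value)
    note c0 = c0'[unfolded closure_UNIV]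
    have eff0: "effective_H H p = c0"
      unfolding effective_H_eq effective_H_constraint_def THE0[symmetric]
        state_constraint_cell_solution_iff[OF problem[OF periodic_domain_UNIV]] F_def ..
    have v0: "continuous_on UNIV v0" "periodic_on UNIV v0" "visc_subsolution F c0 UNIV v0"
      using c0(2) by (auto simp: whole.Sub_def)
    \<comment> \<open>By comparison with the solution \<open>v0\<close>, any periodic subsolution on
      the whole space bounds \<open>c0\<close> from above; this is how the extension is
      exploited.\<close>
    have sub_le: "c1 \<ge> c0" if "continuous_on UNIV v1" "periodic_on UNIV v1" "visc_subsolution F c1 UNIV v1" for v1 c1
      using whole.comparison[of v1 c1 v0 c0] that c0(3) v0 by simp
    have "F y 0 \<le> cmax" for y unfolding F_def using cmax(2)[of p y] p by simp
    then have c0max: "c0 \<le> cmax"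
      by (intro sub_le[of "\<lambda>_. 0"] whole.const_visc_sub) (auto simp: periodic_on_def)
    \<comment> \<open>The supersolution is returned along with the two bounds because it is compared
      once more with solutions in the punctured space.\<close>
    have perf: "\<exists>c v. 0 \<le> c \<and> c \<le> c0 \<and> c0 \<le> c + s * B \<and> effective_H_constraint H (perforated_space D s) p = c \<and>
        continuous_on (closure (perforated_space D s)) v \<and> periodic_on (closure (perforated_space D s)) v \<and>
        visc_supersolution F c (closure (perforated_space D s)) v"
      if s: "0 < s" "s < 1/2" for s
    proof -
      interpret perf: cell_problem F "perforated_space D s" "- p"
        unfolding F_def by (rule problem[OF domain[OF s]])
      obtain c v where cv: "0 \<le> c" "v \<in> perf.Sub c" "visc_supersolution F c (closure (perforated_space D s)) v"
        and THEc: "(THE c. \<exists>v. v \<in> perf.Sub c \<and> visc_supersolution F c (closure (perforated_space D s)) v) = c"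
        by (rule perf.critical_value)
      have eff: "effective_H_constraint H (perforated_space D s) p = c"
        unfolding effective_H_constraint_def THEc[symmetric]
          state_constraint_cell_solution_iff[OF problem[OF domain[OF s]]] F_def ..
      have v: "continuous_on (closure (perforated_space D s)) v" "periodic_on (closure (perforated_space D s)) v"
        using cv(2) by (auto simp: perf.Sub_def)
      have "visc_subsolution F c0 (perforated_space D s) v0"
        using visc_subsolution_open_subset[OF v0(3) open_UNIV perf.open_dom] by simp
      then have le: "c \<le> c0"
        using v cv(3) v0 by (intro perf.comparison[of v0 c0 v c])
          (auto intro: continuous_on_subset periodic_on_subset)
      obtain w where w: "continuous_on UNIV w" "periodic_on UNIV w" "visc_subsolution F (c + s * B) UNIV w"
      proof (rule extend_subsolution[OF perf.cell_problem_axioms DQ s cv(2,1) L(1) _ M0])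
        show "norm (q - - p) \<le> L" if "F y q \<le> c + 1" for y q
          using L(2)[of y "p + q"] that le c0max unfolding F_def by (simp add: add.commute)
        show "F y q \<le> B" if "norm (q - - p) \<le> L + 8 * M0" for y q
          using B(2)[of "p + q" y] that unfolding F_def by (simp add: add.commute)
      qed blast
      from sub_le[OF this] cv(1,3) le eff v show ?thesis by blast
    qed
    show ?thesis
    proof (cases "t = 0")
      case False
      with t have "0 < t" by simp
      from perf[OF this t(2)] eff0 show ?thesis by (auto simp: mult.commute)
    next
      case True
      \<comment> \<open>No direction is inward at a puncture, since points near it can be moved onto
        it. \<open>v0\<close> shows that \<open>c0\<close> is attained, and any other constant is
        compared through domains with holes of positive size.\<close>
      let ?\<Omega> = "perforated_space D 0"
      have D0: "0 \<in> closure D" using D_zero closure_subset[of D] by blast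
      have "closure D \<noteq> {}"
      proof
        assume "closure D = {}"
        with D0 show False by simp
      qed
      then have cl: "closure ?\<Omega> = UNIV" by (rule closure_perforated_space_0)
      have o: "open ?\<Omega>" by (rule perforated_space_open[OF D_compactly_contained(1)])
      have "effective_H_constraint H ?\<Omega> p = c0"
        unfolding effective_H_constraint_def
      proof (rule the_equality)
        have "visc_subsolution F c0 ?\<Omega> v0"
          using visc_subsolution_open_subset[OF v0(3) open_UNIV o] by simp
        then have "state_constraint_cell_solution H ?\<Omega> p c0 v0"
          using v0(1,2) c0(3) unfolding state_constraint_cell_solution_def cl F_def by blast
        then show "\<exists>v. state_constraint_cell_solution H ?\<Omega> p c0 v" by blast
      next
        fix c assume "\<exists>v. state_constraint_cell_solution H ?\<Omega> p c v"
        then obtain v where v: "continuous_on UNIV v" "periodic_on UNIV v" "visc_subsolution F c ?\<Omega> v"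
            "visc_supersolution F c UNIV v"
          unfolding state_constraint_cell_solution_def cl F_def by blast
        \<comment> \<open>The closure is the whole space, so \<open>v\<close> is a supersolution
          there and comparison with \<open>v0\<close> applies.\<close>
        have "c \<le> c0" using whole.comparison[of v0 c0 v c] v0 v by simp
        moreover have "c0 \<le> c"
        proof (rule field_le_epsilon)
          fix \<kappa> :: real assume \<kappa>: "0 < \<kappa>"
          \<comment> \<open>Small enough that the loss \<open>s * B\<close> is at most \<kappa>;
            dividing by \<open>B + 1\<close> covers \<open>B = 0\<close>.\<close>
          define s where "s = min (1/4) (\<kappa> / (B + 1))"
          have s: "0 < s" "s < 1/2" using \<kappa> B(1) by (auto simp: s_def)
          have "s * B \<le> \<kappa> / (B + 1) * (B + 1)" using s \<kappa> B(1) by (intro mult_mono) (auto simp: s_def)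
          then have sB: "s * B \<le> \<kappa>" using B(1) by simp
          interpret perf: cell_problem F "perforated_space D s" "- p"
            unfolding F_def by (rule problem[OF domain[OF s]])
          obtain cs vs where cs: "c0 \<le> cs + s * B" "continuous_on (closure (perforated_space D s)) vs"
            "periodic_on (closure (perforated_space D s)) vs"
            "visc_supersolution F cs (closure (perforated_space D s)) vs"
            using perf[OF s] by blast
          have "visc_subsolution F c (perforated_space D s) v"
            using visc_subsolution_open_subset[OF v(3) o perf.open_dom perforated_space_0_superset[OF D0]] .
          then have "cs \<le> c"
            using v(1,2) cs by (intro perf.comparison[of v c vs cs])
              (auto intro: continuous_on_subset periodic_on_subset)
          with cs(1) sB show "c0 \<le> c + \<kappa>" by simp
        qed
        ultimately show "c = c0" by simp
      qed
      with eff0 True show ?thesis by simp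
    qed
  qed
  show ?thesis
  \<comment> \<open>\<open>B\<close> may be zero while the constant has to be positive, hence
    \<open>B + 1\<close>.\<close>
  proof (intro exI[of _ "B + 1"] conjI allI impI ballI)
    show "0 < B + 1" using B(1) by simp
    fix \<eta> :: "real \<Rightarrow> real" and \<epsilon> :: real and p :: "real^'n"
    assume \<eta>: "\<eta> ` {0..<1/2} \<subseteq> {0..<1/2}" and \<epsilon>: "\<epsilon> \<in> {0<..<1/2}" and p: "norm p \<le> R"
    have "\<eta> \<epsilon> \<in> {0..<1/2}" using \<eta> \<epsilon> by (auto simp: image_subset_iff)
    then have "\<bar>effective_H_constraint H (perforated_space D (\<eta> \<epsilon>)) p - effective_H H p\<bar> \<le> B * \<eta> \<epsilon>"
      using main p by auto
    also have "\<dots> \<le> (B + 1) * (\<epsilon> + \<eta> \<epsilon>)"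
      using B(1) \<epsilon> \<open>\<eta> \<epsilon> \<in> {0..<1/2}\<close> by (intro mult_mono) auto
    finally show "\<bar>effective_H_constraint H (perforated_space D (\<eta> \<epsilon>)) p - effective_H H p\<bar> \<le> (B + 1) * (\<epsilon> + \<eta> \<epsilon>)" .
  qed
qed

end
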